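(* Let $1\le p\le\infty$. For every $\gamma\in[0,\infty]$, both $E^{D,p}_\gamma(\mathbb D)$ and $E^{N,p}_\gamma(\mathbb D)$ are singleton sets, and \[ E^{D,p}_\gamma(\mathbb D)=E^{N,p}_\gamma(\mathbb D)=\{\Phi_p(\gamma)\}, \] where \[ \Phi_p(\gamma):= \begin{cases} \dfrac{(1-\gamma)(p-2)}{6p},&0\le\gamma<1,\ 1\le p<4,\\[8pt] \dfrac16-\dfrac1{3p}-\dfrac{\gamma}{12},&0\le\gamma<1,\ 4\le p\le\infty,\\[8pt] 0,&1\le\gamma\le\infty,\ 1\le p<4,\\[8pt] \dfrac14-\dfrac1p-\dfrac1{6\gamma}+\dfrac{2}{3p\gamma},&1\le\gamma\le\infty,\ 4\le p\le\infty, \end{cases} \] with the terms $1/\gamma$ and $1/p$ interpreted as zero when $\gamma=\infty$ or $p=\infty$, respectively.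
   Context: $\mathbb D$ is the open unit disk in $\mathbb R^2$. $J_n$ is the Bessel function of the first kind; $j_{n,m}$ is the $m$-th positive zero of $J_n$ and $\rho_{n,m}$ the $m$-th positive zero of $J_n'$ ($n\in\mathbb Z_{\ge0}$, $m\in\mathbb Z_{\ge1}$). The Dirichlet eigenvalues of $-\Delta$ on $\mathbb D$ are $\lambda^D_{n,m}=j_{n,m}^2$, and the Neumann eigenvalues (excluding the constant eigenfunction) are $\lambda^N_{n,m}=\rho_{n,m}^2$. The $L^2(\mathbb D)$-normalized eigenfunctions used are, in polar coordinates, for $n\ge1$, \[ u^D_{n,m}(r,\theta)=\sqrt{\tfrac2\pi}\,\frac{J_n(j_{n,m}r)}{|J_{n+1}(j_{n,m})|}\cos(n\theta),\qquad u^N_{n,m}(r,\theta)=\left(\frac{2}{\pi\left(1-\frac{n^2}{\rho_{n,m}^2}\right)}\right)^{1/2}\frac{J_n(\rho_{n,m}r)}{|J_n(\rho_{n,m})|}\cos(n\theta), \] and for $n=0$, \[ u^D_{0,m}(r,\theta)=\frac1{\sqrt\pi}\frac{J_0(j_{0,m}r)}{|J_1(j_{0,m})|},\qquad u^N_{0,m}(r,\theta)=\frac1{\sqrt\pi}\frac{J_0(\rho_{0,m}r)}{|J_0(\rho_{0,m})|}. \] Let $B\in\{D,N\}$. For $\gamma\in[0,\infty)$, $E^{B,p}_\gamma(\mathbb D)$ is the set of all $\ell\in\mathbb R$ for which there exists a sequence $(n_k,m_k)_{k\ge1}\subset\mathbb Z_{\ge0}\times\mathbb Z_{\ge1}$ with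 $n_k\ge2$ and $\lambda^B_{n_k,m_k}\to\infty$ such that \[ \frac{\log m_k}{\log n_k}\to\gamma\quad\text{and}\quad \frac{\log\|u^B_{n_k,m_k}\|_{L^p(\mathbb D)}}{\log\lambda^B_{n_k,m_k}}\to\ell . \] For $\gamma=\infty$, $E^{B,p}_\infty(\mathbb D)$ is defined in the same way but using sequences (with $\lambda^B_{n_k,m_k}\to\infty$) satisfying either $n_k\ge2$ for all $k$ and $\frac{\log m_k}{\log n_k}\to\infty$, or $n_k\in\{0,1\}$ for all $k$ and $m_k\to\infty$. *)

theory Defs
  imports "HOL-Analysis.Analysis" "HOL-Probability.Essential_Supremum"
begin

definition bessel_J :: "nat \<Rightarrow> real \<Rightarrow> real" where
  "bessel_J n x = (\<Sum>k. (-1) ^ k / (fact k * fact (n + k)) * (x / 2) ^ (2 * k + n))"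

text \<open>The zeros below are enumerated in increasing order starting at \<open>m = 1\<close>, without
  multiplicity; the value for \<open>m = 0\<close> is arbitrary.\<close>

definition pos_zero :: "(real \<Rightarrow> real) \<Rightarrow> nat \<Rightarrow> real" where
  "pos_zero f m = (THE x. 0 < x \<and> f x = 0 \<and>
     finite {y. 0 < y \<and> y \<le> x \<and> f y = 0} \<and> card {y. 0 < y \<and> y \<le> x \<and> f y = 0} = m)"

definition j_zero :: "nat \<Rightarrow> nat \<Rightarrow> real" where
  "j_zero n m = pos_zero (bessel_J n) m"

definition rho_zero :: "nat \<Rightarrow> nat \<Rightarrow> real" where
  "rho_zero n m = pos_zero (deriv (bessel_J n)) m"

datatype bdry = Dirichlet | Neumann

fun eigval :: "bdry \<Rightarrow> nat \<Rightarrow> nat \<Rightarrow> real" where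
  "eigval Dirichlet n m = (j_zero n m)\<^sup>2"
| "eigval Neumann n m = (rho_zero n m)\<^sup>2"

fun eigfun_polar :: "bdry \<Rightarrow> nat \<Rightarrow> nat \<Rightarrow> real \<Rightarrow> real \<Rightarrow> real" where
  "eigfun_polar Dirichlet n m r \<theta> =
    (if n = 0
     then 1 / sqrt pi * (bessel_J 0 (j_zero 0 m * r) / \<bar>bessel_J 1 (j_zero 0 m)\<bar>)
     else sqrt (2 / pi) * (bessel_J n (j_zero n m * r) / \<bar>bessel_J (n + 1) (j_zero n m)\<bar>)
            * cos (real n * \<theta>))"
| "eigfun_polar Neumann n m r \<theta> =
    (if n = 0
     then 1 / sqrt pi * (bessel_J 0 (rho_zero 0 m * r) / \<bar>bessel_J 0 (rho_zero 0 m)\<bar>)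
     else sqrt (2 / (pi * (1 - (real n)\<^sup>2 / (rho_zero n m)\<^sup>2)))
            * (bessel_J n (rho_zero n m * r) / \<bar>bessel_J n (rho_zero n m)\<bar>)
            * cos (real n * \<theta>))"

text \<open>The Euclidean plane is identified with \<^typ>\<open>complex\<close>, so that the polar coordinates of
  \<open>z\<close> are \<open>(cmod z, Arg z)\<close>; the choice of the branch of the argument is immaterial because the
  angle only enters through \<open>cos (n\<theta>)\<close>.\<close>

definition eigfun :: "bdry \<Rightarrow> nat \<Rightarrow> nat \<Rightarrow> complex \<Rightarrow> real" where
  "eigfun B n m z = eigfun_polar B n m (cmod z) (Arg z)"

text \<open>Real-valued, hence meaningful only for functions that actually lie in \<open>L\<^sup>p\<close>, as all
  eigenfunctions do (they are bounded on the disk).\<close>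

definition Lp_norm :: "ereal \<Rightarrow> 'a measure \<Rightarrow> ('a \<Rightarrow> real) \<Rightarrow> real" where
  "Lp_norm p M f =
    (if p = \<infinity> then real_of_ereal (esssup M (\<lambda>x. ereal \<bar>f x\<bar>))
     else (LINT x|M. \<bar>f x\<bar> powr real_of_ereal p) powr (1 / real_of_ereal p))"

definition disk_norm :: "ereal \<Rightarrow> (complex \<Rightarrow> real) \<Rightarrow> real" where
  "disk_norm p f = Lp_norm p (lebesgue_on (ball 0 1)) f"

text \<open>For \<open>\<gamma> = \<infinity>\<close> there is the additional possibility that the angular frequency stays in
  \<open>{0, 1}\<close>, where the quotient of logarithms makes no sense.\<close>

definition regime :: "ereal \<Rightarrow> (nat \<Rightarrow> nat) \<Rightarrow> (nat \<Rightarrow> nat) \<Rightarrow> bool" where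
  "regime \<gamma> n m \<longleftrightarrow>
     ((\<forall>k. n k \<ge> 2) \<and> (\<lambda>k. ereal (ln (real (m k)) / ln (real (n k)))) \<longlonglongrightarrow> \<gamma>) \<or>
     (\<gamma> = \<infinity> \<and> (\<forall>k. n k \<in> {0, 1}) \<and> filterlim m at_top sequentially)"

definition exponent_set :: "bdry \<Rightarrow> ereal \<Rightarrow> ereal \<Rightarrow> real set" where
  "exponent_set B p \<gamma> = {l. \<exists>n m :: nat \<Rightarrow> nat.
     (\<forall>k. m k \<ge> 1) \<and>
     filterlim (\<lambda>k. eigval B (n k) (m k)) at_top sequentially \<and>
     regime \<gamma> n m \<and>
     (\<lambda>k. ln (disk_norm p (eigfun B (n k) (m k))) / ln (eigval B (n k) (m k))) \<longlonglongrightarrow> l}"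

text \<open>Note \<open>recip \<infinity> = 0\<close>.\<close>

definition recip :: "ereal \<Rightarrow> real" where
  "recip x = real_of_ereal (inverse x)"

definition Phi :: "ereal \<Rightarrow> ereal \<Rightarrow> real" where
  "Phi p \<gamma> =
    (if \<gamma> < 1 then
       (if p < 4 then (1 - real_of_ereal \<gamma>) * (real_of_ereal p - 2) / (6 * real_of_ereal p)
        else 1/6 - 1/3 * recip p - real_of_ereal \<gamma> / 12)
     else
       (if p < 4 then 0
        else 1/4 - recip p - 1/6 * recip \<gamma> + 2/3 * recip p * recip \<gamma>))"

end

theory Submission
  imports Defs
begin

text \<open>
  Up to a constant, the eigenfunction is \<open>J\<^sub>n(\<mu>r) cos(n\<theta>)\<close>, where \<open>\<mu>\<close> is the \<open>m\<close>-th positive zero of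
  \<open>J\<^sub>n\<close> or of \<open>J\<^sub>n'\<close>. In the variable \<open>s = ln t\<close>, \<open>t = \<mu>r\<close>, the function \<open>w(s) = J\<^sub>n(e\<^sup>s)\<close> solves
  \<open>w'' + Q w = 0\<close> with the increasing potential \<open>Q = t\<^sup>2 - n\<^sup>2\<close>, and everything is read off from this
  equation. No asymptotic expansion of \<open>J\<^sub>n\<close> is used; since the claim concerns quotients of
  logarithms, constants and powers of logarithms may be lost at every step. In the powers of \<open>n\<close> below,
  \<open>n\<close> is to be read as \<open>1\<close> if it is \<open>0\<close>.

  The energy \<open>E = Q w\<^sup>2 + w'\<^sup>2\<close> has derivative \<open>2 t\<^sup>2 w\<^sup>2\<close> and vanishes at \<open>t = 0\<close>, so \<open>E(\<mu>)\<close> is twice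
  the integral of \<open>t J\<^sub>n\<^sup>2\<close> over \<open>[0, \<mu>]\<close>. At an eigenvalue one of \<open>w\<close>, \<open>w'\<close> vanishes, and for both
  boundary conditions the normalizing constant is the same multiple of \<open>\<mu> / \<surd>E(\<mu>)\<close> (\<open>eigfun_eq\<close>).

  The quotient \<open>E / \<surd>Q\<close> is the square of the oscillation amplitude in the sense of Liouville and Green.
  It stays within constant factors of one number \<open>a\<^sup>2\<close> as soon as \<open>Q\<close> exceeds a multiple of \<open>n\<^bsup>4/3\<^esup>\<close>,
  uniformly in \<open>n\<close> (\<open>amplitude_sq_almost_constant\<close>); hence \<open>\<bar>w\<bar> \<le> C a Q\<^bsup>-1/4\<^esup>\<close> there. Below that level
  the wave has no zero, is at most \<open>C a n\<^bsup>-1/3\<^esup>\<close>, is of this size on a set of \<open>t dt\<close>-mass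
  \<open>n\<^bsup>4/3\<^esup>\<close>, and decays towards \<open>t = 0\<close> (\<open>turning_data_uniform\<close>). With \<open>D = \<mu>\<^sup>2 - n\<^sup>2\<close> it follows that the
  integral of \<open>t \<bar>J\<^sub>n\<bar>\<^sup>p\<close> over \<open>[0, \<mu>]\<close> is comparable to \<open>a\<^sup>p X\<^bsup>1-p/4\<^esup>\<close>, up to a factor \<open>ln D\<close>. Here
  \<open>X = D\<close> if \<open>p < 4\<close>, when the outer part of the disk dominates, and \<open>X = n\<^bsup>4/3\<^esup>\<close> if \<open>p \<ge> 4\<close>, when the
  first crest dominates (\<open>I_upper\<close>, \<open>I_lower\<close>). The angular factor costs only a constant: a rotation by a
  quarter of its period turns the cosine into a sine. Dividing by \<open>\<surd>E(\<mu>) = a D\<^bsup>1/4\<^esup>\<close> (up to constants)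
  eliminates \<open>a\<close> and yields
  \<open>\<parallel>u\<parallel>\<^sub>p \<approx> \<mu>\<^bsup>1-2/p\<^esup> D\<^bsup>-1/4\<^esup> X\<^bsup>1/p-1/4\<^esup>\<close> (\<open>norm_estimate\<close>).

  Sturm's comparison theorem counts the zeros below \<open>\<mu>\<close> and shows that \<open>D\<close> is comparable to
  \<open>max (n\<^bsup>4/3\<^esup> m\<^bsup>2/3\<^esup>) m\<^sup>2\<close> up to powers of a logarithm (\<open>ln_gap_bounds\<close>). Therefore \<open>ln D / ln \<mu>\<close> and
  \<open>ln n / ln \<mu>\<close> converge along every sequence in the regime \<open>\<gamma>\<close> (\<open>regime_exponents\<close>), and \<open>\<Phi>\<close> is the
  linear combination of the two limits dictated by the norm estimate (\<open>Phi_eq\<close>). The kink of \<open>\<Phi>\<close> at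
  \<open>\<gamma> = 1\<close> is the place where the two terms in the maximum, and \<open>n\<^sup>2\<close> and \<open>D\<close>, change order; the kink at
  \<open>p = 4\<close> is where \<open>Q\<^bsup>1-p/4\<^esup>\<close> changes its monotonicity. Since every regime contains an admissible
  sequence, the exponent sets are not empty.
\<close>

section \<open>Bessel functions in the logarithmic variable\<close>

text \<open>The entire function with \<open>J\<^sub>n(x) = (x/2)\<^sup>n G\<^sub>n(x\<^sup>2/4)\<close>; it
  makes differentiation and the three-term recurrence plain power series manipulations.\<close>

definition bessel_G :: "nat \<Rightarrow> real \<Rightarrow> real" where
  "bessel_G n u = (\<Sum>k. (-1) ^ k / (fact k * fact (n + k)) * u ^ k)"

lemma bessel_G_summable: "summable (\<lambda>k. (-1) ^ k / (fact k * fact (n + k)) * u ^ k :: real)"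
proof (rule summable_comparison_test[OF _ summable_exp[of "\<bar>u\<bar>"]], intro exI allI impI)
  fix k :: nat
  have "(fact k :: real) \<le> fact k * fact (n + k)"
    by (simp add: mult_le_cancel_left1)
  then have "1 / (fact k * fact (n + k)) \<le> (inverse (fact k) :: real)"
    using le_imp_inverse_le[of "fact k :: real" "fact k * fact (n + k)"]
    by (simp del: inverse_mult_distrib add: inverse_eq_divide)
  then show "norm ((-1) ^ k / (fact k * fact (n + k)) * u ^ k) \<le> inverse (fact k) * \<bar>u\<bar> ^ k"
    using mult_right_mono[of _ _ "\<bar>u\<bar> ^ k"] by (fastforce simp: abs_mult power_abs)
qed

lemma bessel_J_eq_G: "bessel_J n x = (x / 2) ^ n * bessel_G n ((x / 2)\<^sup>2)"
  unfolding bessel_J_def bessel_G_def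
  by (subst suminf_mult[OF bessel_G_summable, symmetric])
     (simp add: power_add power_mult[symmetric] mult_ac)

lemma bessel_G_deriv: "(bessel_G n has_real_derivative - bessel_G (n + 1) u) (at u)"
proof -
  let ?c = "\<lambda>k. (-1) ^ k / (fact k * fact (n + k)) :: real"
  have "diffs ?c k * u ^ k = - ((-1) ^ k / (fact k * fact (n + 1 + k)) * u ^ k)" for k
  proof -
    have "(fact (Suc k) :: real) = real (Suc k) * fact k" "n + Suc k = n + 1 + k" by simp_all
    then show ?thesis by (simp only: diffs_def) (simp add: divide_simps del: fact_Suc)
  qed
  then have "(\<Sum>k. diffs ?c k * u ^ k) = - bessel_G (n + 1) u"
    unfolding bessel_G_def using suminf_minus[OF bessel_G_summable[of "n + 1" u]] by simp
  then show ?thesis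
    using termdiffs_strong_converges_everywhere[of ?c u, OF bessel_G_summable]
    by (simp add: bessel_G_def[abs_def])
qed

lemma bessel_G_recurrence:
  "bessel_G n u = (real n + 1) * bessel_G (n + 1) u - u * bessel_G (n + 2) u"
proof -
  let ?c = "\<lambda>n k. (-1) ^ k / (fact k * fact (n + k)) :: real"
  have "(\<lambda>k. (real n + 1) * (?c (n + 1) k * u ^ k) - ?c n k * u ^ k) sums
      ((real n + 1) * bessel_G (n + 1) u - bessel_G n u)" (is "?f sums _")
    unfolding bessel_G_def by (intro sums_diff sums_mult summable_sums bessel_G_summable)
  moreover have "?f sums (u * bessel_G (n + 2) u)"
  proof (rule sums_Suc_imp)
    have "(real n + 1) * fact n \<noteq> (0::real)" by simp
    then show "?f 0 = 0" by (simp add: divide_simps add.commute)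
    have "?f (Suc k) = u * (?c (n + 2) k * u ^ k)" for k
    proof -
      have "(fact (Suc (Suc (n + k))) :: real) = (real n + real k + 2) * fact (Suc (n + k))"
        by simp
      then have "(real n + 1) * ?c (n + 1) (Suc k) - ?c n (Suc k) = ?c (n + 2) k"
        by (simp add: divide_simps del: fact_Suc) (simp add: algebra_simps)
      then show ?thesis by (simp add: algebra_simps)
    qed
    moreover have "(\<lambda>k. u * (?c (n + 2) k * u ^ k)) sums (u * bessel_G (n + 2) u)"
      unfolding bessel_G_def by (intro sums_mult summable_sums bessel_G_summable)
    ultimately show "(\<lambda>k. ?f (Suc k)) sums (u * bessel_G (n + 2) u)"
      by presburger
  qed
  ultimately show ?thesis using sums_unique2 by fastforce
qed

lemma bessel_J_recurrence:
  "x * (bessel_J n x + bessel_J (n + 2) x) = 2 * (real n + 1) * bessel_J (n + 1) x"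
  using arg_cong[OF bessel_G_recurrence[of n "(x / 2)\<^sup>2"], of "\<lambda>y. x * (x / 2) ^ n * y"]
  by (simp add: bessel_J_eq_G field_simps power2_eq_square)

lemma bessel_G_cont: "continuous_on S (bessel_G n)"
  by (meson DERIV_isCont bessel_G_deriv continuous_at_imp_continuous_on)

lemma bessel_J_cont [continuous_intros]:
  "continuous_on S f \<Longrightarrow> continuous_on S (\<lambda>x. bessel_J n (f x))"
  unfolding bessel_J_eq_G
  by (intro continuous_intros continuous_on_compose2[OF bessel_G_cont[of UNIV]]) auto

lemma bessel_J_deriv:
  assumes "x > 0"
  shows "(bessel_J n has_real_derivative (real n * bessel_J n x / x - bessel_J (n + 1) x)) (at x)"
proof -
  have "((\<lambda>x. (x / 2) ^ n) has_real_derivative real n * (x / 2) ^ (n - 1) * (1 / 2)) (at x)"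
    by (rule derivative_eq_intros refl | simp)+
  moreover have "((\<lambda>x. bessel_G n ((x / 2)\<^sup>2)) has_real_derivative
      - bessel_G (n + 1) ((x / 2)\<^sup>2) * (x / 2)) (at x)"
    by (rule DERIV_chain2[OF bessel_G_deriv]) (rule derivative_eq_intros refl | simp)+
  ultimately have "((\<lambda>x. (x / 2) ^ n * bessel_G n ((x / 2)\<^sup>2)) has_real_derivative
      (real n * (x / 2) ^ (n - 1) * (1 / 2)) * bessel_G n ((x / 2)\<^sup>2)
      + - bessel_G (n + 1) ((x / 2)\<^sup>2) * (x / 2) * (x / 2) ^ n) (at x)"
    by (rule DERIV_mult)
  moreover have "(real n * (x / 2) ^ (n - 1) * (1 / 2)) = real n * (x / 2) ^ n / x"
    using assms by (cases n) (simp_all add: field_simps)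
  moreover have "(x / 2) ^ (n + 1) = (x / 2) * (x / 2) ^ n" by simp
  ultimately show ?thesis
    unfolding bessel_J_eq_G[abs_def] by (elim back_subst[where P = "\<lambda>d. (_ has_real_derivative d) _"]) (simp only: mult_ac, simp)
qed

text \<open>The Bessel function in the variable \<open>s = ln t\<close>, in which Bessel's equation loses its
  first-order term.\<close>

definition wave :: "nat \<Rightarrow> real \<Rightarrow> real" where "wave n s = bessel_J n (exp s)"
text \<open>The derivative \<open>t J\<^sub>n'(t)\<close> of the wave in \<open>s\<close>, written so that the
  normalizing constant \<open>J\<^bsub>n+1\<^esub>(j)\<close> of the Dirichlet eigenfunctions is visible at a
  zero \<open>j\<close> of \<open>J\<^sub>n\<close>.\<close>

definition slope :: "nat \<Rightarrow> real \<Rightarrow> real" where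
  "slope n s = real n * bessel_J n (exp s) - exp s * bessel_J (n + 1) (exp s)"
definition potential :: "nat \<Rightarrow> real \<Rightarrow> real" where "potential n s = (exp s)\<^sup>2 - (real n)\<^sup>2"
definition energy :: "nat \<Rightarrow> real \<Rightarrow> real" where "energy n s = potential n s * (wave n s)\<^sup>2 + (slope n s)\<^sup>2"

lemma potential_deriv [derivative_intros]: "(potential n has_real_derivative 2 * (exp s)\<^sup>2) (at s)"
  unfolding potential_def by (auto intro!: derivative_eq_intros simp: power2_eq_square)

lemma wave_deriv: "(wave n has_real_derivative slope n s) (at s)"
proof -
  have "((\<lambda>s. bessel_J n (exp s)) has_real_derivative
    (real n * bessel_J n (exp s) / exp s - bessel_J (n + 1) (exp s)) * exp s) (at s)"
    by (rule DERIV_chain2[OF bessel_J_deriv]) (auto intro!: derivative_eq_intros)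
  then show ?thesis by (simp add: wave_def[abs_def] slope_def algebra_simps)
qed

text \<open>Bessel's equation in the logarithmic variable.\<close>

lemma slope_deriv: "(slope n has_real_derivative - potential n s * wave n s) (at s)"
proof -
  have "slope n = (\<lambda>s. real n * wave n s - exp s * wave (n + 1) s)"
    by (simp add: slope_def wave_def fun_eq_iff)
  moreover have "((\<lambda>s. real n * wave n s - exp s * wave (n + 1) s) has_real_derivative
     real n * slope n s - (exp s * wave (n + 1) s + exp s * slope (n + 1) s)) (at s)"
    by (rule derivative_eq_intros wave_deriv refl | simp)+
  moreover have "real n * slope n s - (exp s * wave (n + 1) s + exp s * slope (n + 1) s) = - potential n s * wave n s"
  proof -
    have "exp s * (exp s * (wave n s + wave (n + 2) s)) = exp s * (2 * (real n + 1) * wave (n + 1) s)"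
      unfolding wave_def by (subst bessel_J_recurrence) simp
    then show ?thesis
      by (simp add: potential_def wave_def slope_def algebra_simps power2_eq_square)
  qed
  ultimately show ?thesis by simp
qed

text \<open>The \<open>w'\<close>-terms cancel by the equation, and only the growth of the potential remains.
  This is the derivative of \<open>2 \<integral> t J\<^sub>n\<^sup>2\<close> with respect to \<open>ln
  t\<close>, so the energy controls the \<open>L\<^sup>2\<close> norm.\<close>

lemma energy_deriv: "(energy n has_real_derivative 2 * (exp s)\<^sup>2 * (wave n s)\<^sup>2) (at s)"
  unfolding energy_def
  by (rule derivative_eq_intros wave_deriv slope_deriv refl | simp add: algebra_simps power2_eq_square)+

lemma energy_nondecr: "s \<le> t \<Longrightarrow> energy n s \<le> energy n t"
  by (rule DERIV_nonneg_imp_nondecreasing[OF _ exI]) (auto intro: energy_deriv)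

text \<open>At \<open>t = 0\<close> the two terms \<open>- n\<^sup>2 J\<^sub>n(0)\<^sup>2\<close> and
  \<open>n\<^sup>2 J\<^sub>n(0)\<^sup>2\<close> cancel.\<close>

lemma energy_tendsto: "(energy n \<longlongrightarrow> 0) at_bot"
proof -
  let ?g = "\<lambda>t. (t\<^sup>2 - (real n)\<^sup>2) * (bessel_J n t)\<^sup>2 + (real n * bessel_J n t - t * bessel_J (n + 1) t)\<^sup>2"
  have "continuous_on UNIV ?g" by (intro continuous_intros)
  then have "isCont ?g 0" by (simp add: continuous_on_eq_continuous_at)
  moreover have "?g 0 = 0" by (simp add: power_mult_distrib)
  ultimately have "(?g \<longlongrightarrow> 0) (at 0)" by (simp add: isCont_def)
  moreover have "filterlim (exp::real\<Rightarrow>real) (at 0) at_bot"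
    by (simp add: filterlim_at exp_at_bot)
  ultimately have "((\<lambda>s. ?g (exp s)) \<longlongrightarrow> 0) at_bot"
    by (rule filterlim_compose)
  then show ?thesis by (simp add: energy_def[abs_def] potential_def wave_def slope_def)
qed

lemma wave_pos_near: "\<exists>s0. \<forall>s\<le>s0. 0 < wave n s"
proof -
  have "isCont (bessel_G n) 0" using bessel_G_deriv DERIV_isCont by blast
  moreover have "bessel_G n 0 > 0"
    unfolding bessel_G_def by (subst powser_zero) simp
  ultimately have "\<forall>\<^sub>F u in at 0. bessel_G n u > 0"
    unfolding isCont_def by (rule order_tendstoD(1))
  moreover have "filterlim (\<lambda>s::real. (exp s / 2)\<^sup>2) (at 0) at_bot"
  proof (rule filterlim_atI)
    have "((\<lambda>s::real. (exp s / 2)\<^sup>2) \<longlongrightarrow> (0 / 2)\<^sup>2) at_bot"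
      by (intro tendsto_intros exp_at_bot) auto
    then show "((\<lambda>s::real. (exp s / 2)\<^sup>2) \<longlongrightarrow> 0) at_bot" by simp
  qed simp
  ultimately have "\<forall>\<^sub>F s in at_bot. bessel_G n ((exp s / 2)\<^sup>2) > 0"
    by (rule eventually_compose_filterlim)
  then show ?thesis
    unfolding eventually_at_bot_linorder wave_def bessel_J_eq_G
    by (meson divide_pos_pos exp_gt_zero mult_pos_pos zero_less_numeral zero_less_power)
qed

text \<open>The energy increases from its limit \<open>0\<close> at \<open>t = 0\<close>, strictly so while
  \<open>J\<^sub>n > 0\<close>. In particular wave and slope have no common zero, and below the turning point
  the slope cannot vanish.\<close>

lemma energy_pos: "energy n s > 0"
proof -
  obtain s0 where s0: "\<And>s. s \<le> s0 \<Longrightarrow> 0 < wave n s" using wave_pos_near by blast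
  have "0 < energy n (min s0 s)"
  proof (rule DERIV_pos_imp_increasing_at_bot[where f = "energy n", OF _ energy_tendsto])
    fix x assume "x \<le> min s0 s"
    then have "2 * (exp x)\<^sup>2 * (wave n x)\<^sup>2 > 0" using s0[of x] by simp
    then show "\<exists>y. (energy n has_real_derivative y) (at x) \<and> 0 < y"
      using energy_deriv by blast
  qed
  also have "\<dots> \<le> energy n s" by (rule energy_nondecr) simp
  finally show ?thesis .
qed

section \<open>The Liouville--Green amplitude\<close>

text \<open>The natural scale at the turning point: the transition region has width
  \<open>n\<^bsup>1/3\<^esup>\<close> in \<open>t\<close>, the potential reaches
  \<open>n\<^bsup>4/3\<^esup>\<close> there, and \<open>J\<^sub>n\<close> has size
  \<open>n\<^bsup>-1/3\<^esup>\<close>. With this base all exponents except the variable \<open>p\<close> are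
  integers; the maximum with \<open>1\<close> lets the same formulas serve for \<open>n = 0\<close>.\<close>

definition cbrt_n :: "nat \<Rightarrow> real" where "cbrt_n n = root 3 (real (max 1 n))"

lemma cbrt_n_cube: "cbrt_n n ^ 3 = real (max 1 n)"
  unfolding cbrt_n_def by (rule odd_real_root_pow) simp

lemma cbrt_n_ge_1: "1 \<le> cbrt_n n"
  unfolding cbrt_n_def by simp

lemma le_cbrt_n_cube: "real n \<le> cbrt_n n ^ 3"
  unfolding cbrt_n_cube by simp

text \<open>The Liouville--Green transformation \<open>v = Q\<^bsup>1/4\<^esup> w\<close>, \<open>d\<zeta> =
  \<surd>Q ds\<close> turns the equation into \<open>v'' + v = small\<close>. This is \<open>v\<^sup>2 +
  (dv/d\<zeta>)\<^sup>2\<close> in terms of \<open>w\<close> and \<open>w'\<close>.\<close>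

definition green_energy :: "nat \<Rightarrow> real \<Rightarrow> real" where
  "green_energy n s = sqrt (potential n s) * (wave n s)\<^sup>2
     + (slope n s + (exp s)\<^sup>2 / (2 * potential n s) * wave n s)\<^sup>2 / sqrt (potential n s)"

text \<open>A primitive, up to sign, of a bound for the logarithmic derivative of the Liouville--Green energy.
  It is bounded where \<open>Q\<close> exceeds a multiple of \<open>n\<^bsup>4/3\<^esup>\<close>, which is why
  that is the level up to which the amplitude can be followed.\<close>

definition green_drift :: "nat \<Rightarrow> real \<Rightarrow> real" where
  "green_drift n s = 9 / 4 / sqrt (potential n s) + 5 / 12 * (real n)\<^sup>2 / sqrt (potential n s) ^ 3"

lemma potential_mono: "s \<le> t \<Longrightarrow> potential n s \<le> potential n t"
  by (simp add: potential_def power_mono)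

lemma potential_strict_mono: "s < t \<Longrightarrow> potential n s < potential n t"
  by (simp add: potential_def power_strict_mono)

lemma sqrt_potential_deriv:
  assumes "potential n s > 0"
  shows "((\<lambda>s. sqrt (potential n s)) has_real_derivative (exp s)\<^sup>2 / sqrt (potential n s)) (at s)"
  using assms by (auto intro!: derivative_eq_intros simp: field_simps)

text \<open>All terms of the size of the energy times \<open>Q'/Q\<close> cancel; up to sign, the remaining
  factor is \<open>Q\<^bsup>-1/4\<^esup>\<close> times the second derivative of
  \<open>Q\<^bsup>-1/4\<^esup>\<close>, which is integrable.\<close>

lemma green_energy_deriv:
  fixes s :: real
  assumes "potential n s > 0"
  defines "t \<equiv> exp s" and "S \<equiv> sqrt (potential n s)"
  shows "(green_energy n has_real_derivative
     2 * (t\<^sup>2 / S ^ 3 - 5 / 4 * t ^ 4 / S ^ 5) * (wave n s * (slope n s + t\<^sup>2 / (2 * potential n s) * wave n s))) (at s)"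
proof -
  have S: "S > 0" "potential n s = S\<^sup>2" using assms by simp_all
  \<comment> \<open>\<open>p = Q' / (4 Q)\<close>, and \<open>Y\<close> below is \<open>Q\<^bsup>1/4\<^esup>\<close> times the derivative of \<open>v\<close> with respect to \<open>\<zeta>\<close>.\<close>
  define p where "p = t\<^sup>2 / (2 * S\<^sup>2)"
  have tp: "t\<^sup>2 = 2 * p * S\<^sup>2" using S by (simp add: p_def)
  then have t4: "t ^ 4 = (2 * p * S\<^sup>2)\<^sup>2" by (metis power2_eq_square power_mult_distrib numeral_Bit0 power_add)
  have dp: "((\<lambda>s. (exp s)\<^sup>2 / (2 * potential n s)) has_real_derivative (2 * p - 4 * p\<^sup>2)) (at s)"
  proof -
    have "((\<lambda>s. (exp s)\<^sup>2 / (2 * potential n s)) has_real_derivative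
      ((2 * exp s * exp s) * (2 * potential n s) - (exp s)\<^sup>2 * (2 * (2 * (exp s)\<^sup>2))) / ((2 * potential n s) * (2 * potential n s))) (at s)"
      using assms(1) by (auto intro!: derivative_eq_intros simp: power2_eq_square)
    moreover have "((2 * exp s * exp s) * (2 * potential n s) - (exp s)\<^sup>2 * (2 * (2 * (exp s)\<^sup>2))) / ((2 * potential n s) * (2 * potential n s))
       = 2 * p - 4 * p\<^sup>2"
      unfolding S(2) t_def[symmetric] p_def using S(1)
      by (simp add: field_simps power2_eq_square)
    ultimately show ?thesis by simp
  qed
  define Y where "Y = slope n s + p * wave n s"
  have dY: "((\<lambda>s. slope n s + (exp s)\<^sup>2 / (2 * potential n s) * wave n s) has_real_derivative
      (- S\<^sup>2 * wave n s + ((2 * p - 4 * p\<^sup>2) * wave n s + p * slope n s))) (at s)"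
    by (rule derivative_eq_intros slope_deriv wave_deriv dp refl)+ (simp add: S p_def t_def)
  have dW2: "((\<lambda>s. (wave n s)\<^sup>2) has_real_derivative 2 * wave n s * slope n s) (at s)"
    using DERIV_power[OF wave_deriv, where n = 2] by (simp add: mult_ac)
  have dS: "((\<lambda>s. sqrt (potential n s)) has_real_derivative t\<^sup>2 / S) (at s)"
    using sqrt_potential_deriv[OF assms(1)] by (simp add: t_def S_def)
  have dY2: "((\<lambda>s. (slope n s + (exp s)\<^sup>2 / (2 * potential n s) * wave n s)\<^sup>2) has_real_derivative
      2 * Y * (- S\<^sup>2 * wave n s + ((2 * p - 4 * p\<^sup>2) * wave n s + p * slope n s))) (at s)"
  proof -
    define f where "f = (\<lambda>s. slope n s + (exp s)\<^sup>2 / (2 * potential n s) * wave n s)"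
    define d where "d = - S\<^sup>2 * wave n s + ((2 * p - 4 * p\<^sup>2) * wave n s + p * slope n s)"
    have "f s = Y" by (simp add: f_def Y_def p_def t_def S)
    moreover have "(f has_real_derivative d) (at s)" using dY by (simp only: f_def d_def)
    ultimately have "((\<lambda>s. (f s)\<^sup>2) has_real_derivative 2 * Y * d) (at s)"
      using DERIV_power[of f d s UNIV 2] by (simp add: mult_ac)
    then show ?thesis by (simp only: f_def d_def)
  qed
  have "(green_energy n has_real_derivative
      (t\<^sup>2 / S * (wave n s)\<^sup>2 + 2 * wave n s * slope n s * S
       + ((2 * Y * (- S\<^sup>2 * wave n s + ((2 * p - 4 * p\<^sup>2) * wave n s + p * slope n s))) * S - Y\<^sup>2 * (t\<^sup>2 / S)) / (S * S))) (at s)"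
    using DERIV_add[OF DERIV_mult[OF dS dW2] DERIV_divide[OF dY2 dS]] S
    by (simp add: green_energy_def[abs_def] Y_def p_def t_def)
  moreover have "t\<^sup>2 / S * (wave n s)\<^sup>2 + 2 * wave n s * slope n s * S
       + ((2 * Y * (- S\<^sup>2 * wave n s + ((2 * p - 4 * p\<^sup>2) * wave n s + p * slope n s))) * S - Y\<^sup>2 * (t\<^sup>2 / S)) / (S * S)
     = 2 * (t\<^sup>2 / S ^ 3 - 5 / 4 * t ^ 4 / S ^ 5) * (wave n s * Y)"
    unfolding tp t4 Y_def using S(1)
    by (simp add: divide_simps) (simp add: algebra_simps power2_eq_square power3_eq_cube power4_eq_xxxx eval_nat_numeral)
  ultimately show ?thesis by (simp add: Y_def p_def S(2))
qed

lemma green_drift_deriv: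
  fixes s :: real
  assumes "potential n s > 0"
  defines "t \<equiv> exp s" and "S \<equiv> sqrt (potential n s)"
  shows "(green_drift n has_real_derivative - (t\<^sup>2 / S ^ 3 + 5 / 4 * t ^ 4 / S ^ 5)) (at s)"
proof -
  have S: "S > 0" "potential n s = S\<^sup>2" using assms by simp_all
  then have t: "t\<^sup>2 = S\<^sup>2 + (real n)\<^sup>2" by (simp add: potential_def t_def)
  have t4: "t ^ 4 = t\<^sup>2 * (S\<^sup>2 + (real n)\<^sup>2)" unfolding t[symmetric] by (simp add: power2_eq_square power4_eq_xxxx)
  have dS: "((\<lambda>s. sqrt (potential n s)) has_real_derivative t\<^sup>2 / S) (at s)"
    using sqrt_potential_deriv[OF assms(1)] by (simp add: t_def S_def)
  have "(green_drift n has_real_derivative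
     (- (9 / 4 * (t\<^sup>2 / S)) / (S * S) - 5 / 12 * (real n)\<^sup>2 * (3 * S\<^sup>2 * (t\<^sup>2 / S)) / (S ^ 3 * S ^ 3))) (at s)"
    using DERIV_add[OF DERIV_divide[OF DERIV_const[of "9/4"] dS]
      DERIV_divide[OF DERIV_const[of "5 / 12 * (real n)\<^sup>2"] DERIV_power[OF dS, of 3]]] S
    by (simp add: green_drift_def[abs_def] S_def[symmetric] mult_ac)
  moreover have "- (9 / 4 * (t\<^sup>2 / S)) / (S * S) - 5 / 12 * (real n)\<^sup>2 * (3 * S\<^sup>2 * (t\<^sup>2 / S)) / (S ^ 3 * S ^ 3)
     = - (t\<^sup>2 / S ^ 3 + 5 / 4 * t ^ 4 / S ^ 5)"
    unfolding t4 using S(1)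
    by (simp add: divide_simps) (simp add: algebra_simps eval_nat_numeral)
  ultimately show ?thesis by simp
qed

lemma green_energy_nonneg: "potential n s > 0 \<Longrightarrow> 0 \<le> green_energy n s"
  unfolding green_energy_def by simp

lemma green_energy_deriv_bound:
  fixes s :: real
  assumes "potential n s > 0"
  defines "t \<equiv> exp s" and "S \<equiv> sqrt (potential n s)"
  shows "\<bar>2 * (t\<^sup>2 / S ^ 3 - 5 / 4 * t ^ 4 / S ^ 5) * (wave n s * (slope n s + t\<^sup>2 / (2 * potential n s) * wave n s))\<bar>
     \<le> (t\<^sup>2 / S ^ 3 + 5 / 4 * t ^ 4 / S ^ 5) * green_energy n s"
proof -
  have S: "S > 0" using assms by simp
  define Y where "Y = slope n s + t\<^sup>2 / (2 * potential n s) * wave n s"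
  have G: "green_energy n s = S * (wave n s)\<^sup>2 + Y\<^sup>2 / S" by (simp add: green_energy_def Y_def t_def S_def)
  have "0 \<le> (S * \<bar>wave n s\<bar> - \<bar>Y\<bar>)\<^sup>2 / S" using S by simp
  also have "\<dots> = green_energy n s - 2 * \<bar>wave n s * Y\<bar>"
    unfolding G using S by (simp add: field_simps power2_eq_square abs_mult)
  finally have 1: "\<bar>2 * (wave n s * Y)\<bar> \<le> green_energy n s" by (simp add: abs_mult)
  have 2: "\<bar>t\<^sup>2 / S ^ 3 - 5 / 4 * t ^ 4 / S ^ 5\<bar> \<le> t\<^sup>2 / S ^ 3 + 5 / 4 * t ^ 4 / S ^ 5"
  proof -
    have "0 \<le> t\<^sup>2 / S ^ 3" "0 \<le> 5 / 4 * t ^ 4 / S ^ 5" using S by simp_all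
    then show ?thesis by linarith
  qed
  have "\<bar>(t\<^sup>2 / S ^ 3 - 5 / 4 * t ^ 4 / S ^ 5) * (2 * (wave n s * Y))\<bar>
      \<le> (t\<^sup>2 / S ^ 3 + 5 / 4 * t ^ 4 / S ^ 5) * green_energy n s"
    unfolding abs_mult[of "t\<^sup>2 / S ^ 3 - _"] by (rule mult_mono[OF 2 1]) (use S in auto)
  then show ?thesis unfolding Y_def by (simp only: mult_ac)
qed

text \<open>Multiplying by \<open>exp (\<plusminus> drift)\<close> makes the Liouville--Green energy monotone,
  by the bound on its derivative.\<close>

lemma green_energy_almost_constant:
  assumes "potential n s > 0" "s \<le> t"
  shows "green_energy n t \<le> exp (green_drift n s) * green_energy n s" "green_energy n s \<le> exp (green_drift n s) * green_energy n t"
proof -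
  have pos: "potential n x > 0" if "s \<le> x" for x using potential_mono[OF that, of n] assms by simp
  have errt: "0 \<le> green_drift n t" unfolding green_drift_def using pos[OF assms(2)] by simp
  have id: "D * e + (e * - b) * L = (D - b * L) * e" for D e b L :: real
    by (simp add: algebra_simps)
  have id2: "D * e + (e * b) * L = (D + b * L) * e" for D e b L :: real
    by (simp add: algebra_simps)
  let ?b = "\<lambda>x. (exp x)\<^sup>2 / sqrt (potential n x) ^ 3 + 5 / 4 * (exp x) ^ 4 / sqrt (potential n x) ^ 5"
  have "green_energy n t * exp (green_drift n t) \<le> green_energy n s * exp (green_drift n s)"
  proof (rule DERIV_nonpos_imp_nonincreasing[OF assms(2)])
    fix x assume "s \<le> x"
    note q = pos[OF this]
    note b = green_energy_deriv_bound[OF q]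
    have "((\<lambda>x. green_energy n x * exp (green_drift n x)) has_real_derivative
      (2 * ((exp x)\<^sup>2 / sqrt (potential n x) ^ 3 - 5 / 4 * (exp x) ^ 4 / sqrt (potential n x) ^ 5) * (wave n x * (slope n x + (exp x)\<^sup>2 / (2 * potential n x) * wave n x))
       - ?b x * green_energy n x) * exp (green_drift n x)) (at x)" (is "(_ has_real_derivative ?d) _")
      using DERIV_mult[OF green_energy_deriv[OF q] DERIV_fun_exp[OF green_drift_deriv[OF q]]]
      by (simp only: id)
    moreover have "?d \<le> 0" using b by (intro mult_nonpos_nonneg) auto
    ultimately show "\<exists>y. ((\<lambda>x. green_energy n x * exp (green_drift n x)) has_real_derivative y) (at x) \<and> y \<le> 0"
      by blast
  qed
  moreover have "green_energy n s * exp (- green_drift n s) \<le> green_energy n t * exp (- green_drift n t)"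
  proof (rule DERIV_nonneg_imp_nondecreasing[OF assms(2)])
    fix x assume "s \<le> x"
    note q = pos[OF this]
    note b = green_energy_deriv_bound[OF q]
    have "((\<lambda>x. green_energy n x * exp (- green_drift n x)) has_real_derivative
      (2 * ((exp x)\<^sup>2 / sqrt (potential n x) ^ 3 - 5 / 4 * (exp x) ^ 4 / sqrt (potential n x) ^ 5) * (wave n x * (slope n x + (exp x)\<^sup>2 / (2 * potential n x) * wave n x))
       + ?b x * green_energy n x) * exp (- green_drift n x)) (at x)" (is "(_ has_real_derivative ?d) _")
      using DERIV_mult[OF green_energy_deriv[OF q] DERIV_fun_exp[OF DERIV_minus[OF green_drift_deriv[OF q]]]]
      by (simp only: id minus_minus minus_mult_minus) (simp only: id2)
    moreover have "?d \<ge> 0"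
      by (rule mult_nonneg_nonneg, use abs_le_D2[OF b] in linarith, simp)
    ultimately show "\<exists>y. ((\<lambda>x. green_energy n x * exp (- green_drift n x)) has_real_derivative y) (at x) \<and> y \<ge> 0"
      by blast
  qed
  moreover have "green_energy n t \<le> green_energy n t * exp (green_drift n t)" "green_energy n t * exp (- green_drift n t) \<le> green_energy n t"
    using errt green_energy_nonneg[OF pos[OF assms(2)]] by (auto simp: mult_le_cancel_left1 mult_le_cancel_left2)
  ultimately have 1: "green_energy n t \<le> exp (green_drift n s) * green_energy n s" and "green_energy n s * exp (- green_drift n s) \<le> green_energy n t"
    by (simp_all add: mult.commute)
  then have "exp (green_drift n s) * (green_energy n s * exp (- green_drift n s)) \<le> exp (green_drift n s) * green_energy n t"
    by (intro mult_left_mono) auto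
  then show "green_energy n t \<le> exp (green_drift n s) * green_energy n s" "green_energy n s \<le> exp (green_drift n s) * green_energy n t"
    using 1 by (simp_all add: mult.left_commute[of "exp _"] flip: exp_add)
qed

text \<open>The square of the amplitude of \<open>Q\<^bsup>1/4\<^esup> w\<close>, without the lower-order
  correction in the Liouville--Green energy. It is the convenient quantity because at a zero of
  \<open>w\<close> or of \<open>w'\<close> it is given by the normalizing constant.\<close>

definition amplitude_sq :: "nat \<Rightarrow> real \<Rightarrow> real" where
  "amplitude_sq n s = energy n s / sqrt (potential n s)"

text \<open>A shear by a bounded amount distorts the Euclidean norm of the plane by a bounded factor. It
  compares the energies with and without the Liouville--Green correction.\<close>

lemma quadratic_form_shear:
  fixes x y \<alpha> b :: real
  assumes "\<bar>\<alpha>\<bar> \<le> b"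
  shows "x\<^sup>2 + (y + \<alpha> * x)\<^sup>2 \<le> (2 + 2 * b\<^sup>2) * (x\<^sup>2 + y\<^sup>2)"
proof -
  have "\<alpha>\<^sup>2 \<le> b\<^sup>2" using assms by (metis abs_le_square_iff abs_of_nonneg abs_ge_zero order_trans)
  then have "\<alpha>\<^sup>2 * x\<^sup>2 \<le> b\<^sup>2 * x\<^sup>2" by (simp add: mult_right_mono)
  moreover have "0 \<le> (y - \<alpha> * x)\<^sup>2" "0 \<le> b\<^sup>2 * y\<^sup>2" "0 \<le> x\<^sup>2" by simp_all
  moreover have "(y + \<alpha> * x)\<^sup>2 = 2 * y\<^sup>2 + 2 * (\<alpha>\<^sup>2 * x\<^sup>2) - (y - \<alpha> * x)\<^sup>2"
    by (simp add: algebra_simps power2_eq_square)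
  moreover have "(2 + 2 * b\<^sup>2) * (x\<^sup>2 + y\<^sup>2) = 2 * x\<^sup>2 + 2 * y\<^sup>2 + 2 * (b\<^sup>2 * x\<^sup>2) + 2 * (b\<^sup>2 * y\<^sup>2)"
    by (simp add: algebra_simps)
  ultimately show ?thesis by linarith
qed

text \<open>The two dimensionless quantities that enter the drift and the correction term are bounded above
  the transition region.\<close>

lemma turning_point_scale:
  assumes "q > 0" "q * cbrt_n n ^ 4 \<le> potential n s"
  shows "1 / sqrt (potential n s) \<le> 1 / sqrt q" "(real n)\<^sup>2 / sqrt (potential n s) ^ 3 \<le> 1 / sqrt q ^ 3" "potential n s > 0"
proof -
  let ?h = "cbrt_n n"
  have h: "?h \<ge> 1" by (rule cbrt_n_ge_1)
  have "sqrt (q * ?h ^ 4) = sqrt q * ?h\<^sup>2"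
    using h by (simp add: real_sqrt_mult real_sqrt_power[symmetric] power4_eq_xxxx power2_eq_square flip: power_mult)
  then have S: "sqrt q * ?h\<^sup>2 \<le> sqrt (potential n s)" using assms(2) real_sqrt_le_mono by metis
  have "sqrt q * 1 \<le> sqrt q * ?h\<^sup>2" using h assms(1) by (intro mult_left_mono) auto
  then have S1: "sqrt q \<le> sqrt (potential n s)" using S by linarith
  then show "potential n s > 0" using assms(1) by (metis not_le real_sqrt_gt_zero real_sqrt_le_0_iff order_trans)
  show "1 / sqrt (potential n s) \<le> 1 / sqrt q" using S1 assms(1) by (intro divide_left_mono) (auto intro: less_le_trans mult_pos_pos)
  have "(real n)\<^sup>2 \<le> (?h ^ 3)\<^sup>2" by (intro power_mono le_cbrt_n_cube) simp
  then have "(real n)\<^sup>2 * sqrt q ^ 3 \<le> ?h ^ 6 * sqrt q ^ 3"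
    using assms(1) by (intro mult_right_mono) (auto simp flip: power_mult)
  also have "\<dots> = (sqrt q * ?h\<^sup>2) ^ 3" by (simp add: power_mult_distrib flip: power_mult)
  also have "\<dots> \<le> sqrt (potential n s) ^ 3" using S assms(1) by (intro power_mono) auto
  finally show "(real n)\<^sup>2 / sqrt (potential n s) ^ 3 \<le> 1 / sqrt q ^ 3"
    using \<open>potential n s > 0\<close> assms(1) by (simp add: divide_simps)
qed

lemma green_energy_amplitude_sq_comparable:
  assumes "potential n s > 0" and "(exp s)\<^sup>2 / (2 * sqrt (potential n s) ^ 3) \<le> b"
  shows "green_energy n s \<le> (2 + 2 * b\<^sup>2) * amplitude_sq n s" "amplitude_sq n s \<le> (2 + 2 * b\<^sup>2) * green_energy n s"
proof -
  define S where "S = sqrt (potential n s)"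
  define r where "r = sqrt S"
  have S: "S > 0" "potential n s = S\<^sup>2" using assms by (simp_all add: S_def)
  then have r: "r > 0" "S = r\<^sup>2" by (simp_all add: r_def)
  define x where "x = r * wave n s"
  define y where "y = slope n s / r"
  define \<alpha> where "\<alpha> = (exp s)\<^sup>2 / (2 * S ^ 3)"
  have "0 \<le> \<alpha>" using S(1) by (simp add: \<alpha>_def)
  moreover have "\<alpha> \<le> b" using assms(2) by (simp only: \<alpha>_def S_def)
  ultimately have \<alpha>: "\<bar>\<alpha>\<bar> \<le> b" "\<bar>- \<alpha>\<bar> \<le> b" by simp_all
  have "amplitude_sq n s = (S\<^sup>2 * (wave n s)\<^sup>2 + (slope n s)\<^sup>2) / S"
    using S(1) unfolding amplitude_sq_def energy_def S(2) by simp
  then have en: "amplitude_sq n s = x\<^sup>2 + y\<^sup>2"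
    unfolding r(2) x_def y_def using r(1) by (simp add: field_simps power2_eq_square)
  moreover have "green_energy n s = S * (wave n s)\<^sup>2 + (slope n s + (exp s)\<^sup>2 / (2 * S\<^sup>2) * wave n s)\<^sup>2 / S"
    using S(1) unfolding green_energy_def S(2) by simp
  moreover have "y + \<alpha> * x = (slope n s + (exp s)\<^sup>2 / (2 * S\<^sup>2) * wave n s) / r"
    unfolding x_def y_def \<alpha>_def r(2) using r(1)
    by (simp add: add_divide_distrib power2_eq_square power3_eq_cube)
  then have "(y + \<alpha> * x)\<^sup>2 = (slope n s + (exp s)\<^sup>2 / (2 * S\<^sup>2) * wave n s)\<^sup>2 / S"
    by (simp only: power_divide r(2))
  ultimately have "green_energy n s = x\<^sup>2 + (y + \<alpha> * x)\<^sup>2"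
    by (simp add: x_def r(2) power_mult_distrib)
  moreover have "x\<^sup>2 + y\<^sup>2 = x\<^sup>2 + ((y + \<alpha> * x) + (- \<alpha>) * x)\<^sup>2" by simp
  ultimately show "green_energy n s \<le> (2 + 2 * b\<^sup>2) * amplitude_sq n s" "amplitude_sq n s \<le> (2 + 2 * b\<^sup>2) * green_energy n s"
    using quadratic_form_shear[OF \<alpha>(1), of x y] quadratic_form_shear[OF \<alpha>(2), of x "y + \<alpha> * x"]
    by (simp_all only: en)
qed

lemma amplitude_sq_pos: "potential n s > 0 \<Longrightarrow> 0 < amplitude_sq n s"
  by (simp add: amplitude_sq_def energy_pos)

text \<open>The constant does not depend on \<open>n\<close>; this uniformity is what makes all later
  estimates uniform over the spectrum.\<close>

lemma amplitude_sq_almost_constant: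
  assumes "q > 0"
  shows "\<exists>K\<ge>1. \<forall>n s t. q * cbrt_n n ^ 4 \<le> potential n s \<and> s \<le> t \<longrightarrow>
     amplitude_sq n t \<le> K * amplitude_sq n s \<and> amplitude_sq n s \<le> K * amplitude_sq n t"
proof -
  define r where "r = 1 / sqrt q"
  define b where "b = r + r ^ 3"
  define H where "H = 9 / 4 * r + 5 / 12 * r ^ 3"
  define L where "L = 2 + 2 * b\<^sup>2"
  have r: "r > 0" using assms by (simp add: r_def)
  have L: "L \<ge> 1" by (simp add: L_def add_increasing2)
  have H: "H \<ge> 0" using r by (simp add: H_def)
  have *: "amplitude_sq n t \<le> L * exp H * L * amplitude_sq n s \<and> amplitude_sq n s \<le> L * exp H * L * amplitude_sq n t"
    if *: "q * cbrt_n n ^ 4 \<le> potential n s" "s \<le> t" for n s t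
  proof -
    note s = turning_point_scale[OF assms *(1)]
    have t0: "q * cbrt_n n ^ 4 \<le> potential n t" using *(1) potential_mono[OF *(2)] by (rule order_trans)
    have bnd: "(exp x)\<^sup>2 / (2 * sqrt (potential n x) ^ 3) \<le> b" if "q * cbrt_n n ^ 4 \<le> potential n x" for x
    proof -
      note x = turning_point_scale[OF assms that]
      have "sqrt (potential n x) ^ 2 = potential n x" using x(3) by simp
      then have "(exp x)\<^sup>2 = sqrt (potential n x) ^ 2 + (real n)\<^sup>2" by (simp only: potential_def)
      then have "(exp x)\<^sup>2 / (2 * sqrt (potential n x) ^ 3) = (1 / sqrt (potential n x) + (real n)\<^sup>2 / sqrt (potential n x) ^ 3) / 2"
        using x(3) by (simp add: add_divide_distrib power2_eq_square power3_eq_cube)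
      also have "\<dots> \<le> (r + r ^ 3) / 2"
        by (intro divide_right_mono add_mono) (use x in \<open>simp_all add: r_def power_divide\<close>)
      also have "\<dots> \<le> b" using r by (simp add: b_def)
      finally show ?thesis .
    qed
    have "green_drift n s = 9 / 4 * (1 / sqrt (potential n s)) + 5 / 12 * ((real n)\<^sup>2 / sqrt (potential n s) ^ 3)"
      by (simp add: green_drift_def)
    also have "\<dots> \<le> H" unfolding H_def
      by (intro add_mono mult_left_mono) (use s in \<open>simp_all add: r_def power_divide\<close>)
    finally have err: "exp (green_drift n s) \<le> exp H" by simp
    have Q: "potential n s > 0" "potential n t > 0" using s(3) turning_point_scale(3)[OF assms t0] by auto
    note cs = green_energy_amplitude_sq_comparable[OF Q(1) bnd[OF *(1)], folded L_def]
    note ct = green_energy_amplitude_sq_comparable[OF Q(2) bnd[OF t0], folded L_def]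
    note m = green_energy_almost_constant[OF Q(1) *(2)]
    have chain: "e \<le> L * (exp H * (L * e'))"
      if "e \<le> L * g" "g \<le> exp (green_drift n s) * g'" "0 \<le> g'" "g' \<le> L * e'" for e g e' g'
    proof -
      have "g \<le> exp H * g'" using that(2) mult_right_mono[OF err that(3)] by linarith
      also have "\<dots> \<le> exp H * (L * e')" using that(4) by simp
      finally have "L * g \<le> L * (exp H * (L * e'))" using L by (intro mult_left_mono) auto
      then show ?thesis using that(1) by linarith
    qed
    have "amplitude_sq n t \<le> L * (exp H * (L * amplitude_sq n s))"
      by (rule chain[OF ct(2) m(1) green_energy_nonneg[OF Q(1)] cs(1)])
    moreover have "amplitude_sq n s \<le> L * (exp H * (L * amplitude_sq n t))"
      by (rule chain[OF cs(2) m(2) green_energy_nonneg[OF Q(2)] ct(1)])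
    ultimately show ?thesis by (simp only: mult.assoc)
  qed
  have "1 * 1 \<le> L * exp H" using L H by (intro mult_mono) auto
  then have "1 * 1 \<le> L * exp H * L" using L by (intro mult_mono) auto
  then have K: "1 \<le> L * exp H * L" by simp
  show ?thesis
    by (rule exI[of _ "L * exp H * L"], rule conjI[OF K], intro allI impI, elim conjE, rule *)
qed

section \<open>Sturm oscillation\<close>

lemma wave_cont: "continuous_on S (wave n)"
  by (meson DERIV_continuous_on wave_deriv has_field_derivative_at_within)

lemma slope_cont: "continuous_on S (slope n)"
  by (meson DERIV_continuous_on slope_deriv has_field_derivative_at_within)

text \<open>Sturm comparison with the sine of frequency \<open>\<surd>q\<close>: if \<open>w\<close> had no
  zero, its Wronskian with the sine would be monotone on the interval, but its values at the two ends have the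
  opposite order.\<close>

lemma wave_zero_exists:
  assumes "q > 0" "q \<le> potential n a"
  shows "\<exists>z\<in>{a..a + pi / sqrt q}. wave n z = 0"
proof (rule ccontr)
  assume neg: "\<not> ?thesis"
  define k where "k = sqrt q"
  define b where "b = a + pi / k"
  have k: "k > 0" "k\<^sup>2 = q" using assms by (simp_all add: k_def)
  have ab: "a < b" using k by (simp add: b_def)
  have nz: "wave n x \<noteq> 0" if "a \<le> x" "x \<le> b" for x using neg that by (auto simp: b_def k_def)
  \<comment> \<open>the Wronskian of the wave with the comparison sine\<close>
  define F where "F = (\<lambda>s. slope n s * sin (k * (s - a)) - wave n s * (k * cos (k * (s - a))))"
  have dF: "(F has_real_derivative (q - potential n s) * sin (k * (s - a)) * wave n s) (at s)" for s
  proof -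
    have 1: "((\<lambda>s. sin (k * (s - a))) has_real_derivative k * cos (k * (s - a))) (at s)"
      by (auto intro!: derivative_eq_intros)
    have 2: "((\<lambda>s. k * cos (k * (s - a))) has_real_derivative - k\<^sup>2 * sin (k * (s - a))) (at s)"
      by (auto intro!: derivative_eq_intros simp: power2_eq_square)
    show ?thesis
      using DERIV_diff[OF DERIV_mult[OF slope_deriv[of n s] 1] DERIV_mult[OF wave_deriv[of n s] 2]]
      unfolding F_def k(2) by (elim back_subst[where P = "\<lambda>d. (_ has_real_derivative d) _"]) (simp add: algebra_simps)
  qed
  have Fab: "F a = - k * wave n a" "F b = k * wave n b" using k by (simp_all add: F_def b_def)
  have sgn: "(q - potential n s) * sin (k * (s - a)) \<le> 0" if "a \<le> s" "s \<le> b" for s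
  proof (rule mult_nonpos_nonneg)
    show "q - potential n s \<le> 0" using assms(2) potential_mono[OF that(1), of n] by simp
    have "k * (s - a) \<le> pi" using that k by (simp add: b_def field_simps)
    then show "0 \<le> sin (k * (s - a))" using that k by (intro sin_ge_zero) auto
  qed
  consider "\<forall>x\<in>{a..b}. wave n x > 0" | "\<forall>x\<in>{a..b}. wave n x < 0"
  proof -
    have False if "x \<in> {a..b}" "y \<in> {a..b}" "wave n x > 0" "wave n y < 0" for x y
    proof -
      have "\<exists>z\<in>closed_segment y x. wave n z = 0"
      proof (rule IVT'_closed_segment_real)
        show "0 \<in> closed_segment (wave n y) (wave n x)" using that by (simp add: closed_segment_eq_real_ivl)
      qed (rule wave_cont)
      moreover have "closed_segment y x \<subseteq> {a..b}" using that by (auto simp: closed_segment_eq_real_ivl)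
      ultimately show False using nz by auto
    qed
    then show thesis using nz that by (metis atLeastAtMost_iff linorder_neqE_linordered_idom)
  qed
  then show False
  proof cases
    case 1
    have "F b \<le> F a"
    proof (rule DERIV_nonpos_imp_nonincreasing[where f = F])
      fix x assume x: "a \<le> x" "x \<le> b"
      have "((q - potential n x) * sin (k * (x - a))) * wave n x \<le> 0"
        by (rule mult_nonpos_nonneg[OF sgn[OF x]]) (use 1 x in \<open>simp add: less_imp_le\<close>)
      then show "\<exists>y. (F has_real_derivative y) (at x) \<and> y \<le> 0"
        using dF[of x] by blast
    qed (use ab in simp)
    moreover have "wave n a > 0" "wave n b > 0" using 1 ab by auto
    then have "k * wave n a > 0" "k * wave n b > 0" using k(1) by simp_all
    ultimately show False using Fab by simp
  next
    case 2
    have "F a \<le> F b"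
    proof (rule DERIV_nonneg_imp_nondecreasing[where f = F])
      fix x assume x: "a \<le> x" "x \<le> b"
      have "((q - potential n x) * sin (k * (x - a))) * wave n x \<ge> 0"
        by (rule mult_nonpos_nonpos[OF sgn[OF x]]) (use 2 x in \<open>simp add: less_imp_le\<close>)
      then show "\<exists>y. (F has_real_derivative y) (at x) \<and> y \<ge> 0"
        using dF[of x] by blast
    qed (use ab in simp)
    moreover have "wave n a < 0" "wave n b < 0" using 2 ab by auto
    then have "k * wave n a < 0" "k * wave n b < 0" using k(1) by (simp_all add: mult_pos_neg)
    ultimately show False using Fab by simp
  qed
qed

text \<open>Rolle's theorem between two zeros of the wave, found in the first and in the last third.\<close>

lemma slope_zero_exists:
  assumes "q > 0" "q \<le> potential n a"
  shows "\<exists>z\<in>{a..a + 3 * pi / sqrt q}. slope n z = 0"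
proof -
  define L where "L = pi / sqrt q"
  have L: "L > 0" using assms by (simp add: L_def)
  have "potential n a \<le> potential n (a + 2 * L)" using L by (intro potential_mono) simp
  then have "q \<le> potential n (a + 2 * L)" using assms by simp
  then obtain y z where y: "y \<in> {a..a + L}" "wave n y = 0" and z: "z \<in> {a + 2 * L..a + 2 * L + L}" "wave n z = 0"
    using wave_zero_exists[OF assms] wave_zero_exists[OF assms(1), of n "a + 2 * L"] unfolding L_def by blast
  have "y < z" using y z L by simp
  then obtain x where "y < x" "x < z" "slope n x = 0"
    using Rolle_deriv[of y z "wave n" "\<lambda>x. (*) (slope n x)"] y z wave_cont wave_deriv
    by (metis has_field_derivative_imp_has_derivative mult.commute mult_cancel_left1 mult_zero_left)
  then show ?thesis using y z L by (intro bexI[of _ x]) (auto simp: L_def)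
qed

lemma zeros_simple: "wave n s = 0 \<Longrightarrow> slope n s \<noteq> 0"
  using energy_pos[of n s] by (auto simp: energy_def)

lemma MVT_abs:
  fixes f g :: "real \<Rightarrow> real"
  assumes "\<And>s. (f has_real_derivative g s) (at s)"
  shows "\<exists>z\<in>closed_segment u v. \<bar>f v - f u\<bar> = \<bar>v - u\<bar> * \<bar>g z\<bar>"
proof (cases u v rule: linorder_cases)
  case less
  obtain z where z: "u < z" "z < v" "f v - f u = (v - u) * g z" using MVT2[OF less assms] by blast
  have "z \<in> closed_segment u v" using z by (simp add: closed_segment_eq_real_ivl)
  moreover have "\<bar>f v - f u\<bar> = \<bar>v - u\<bar> * \<bar>g z\<bar>" unfolding z(3) by (rule abs_mult)
  ultimately show ?thesis by blast
next
  case greater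
  obtain z where z: "v < z" "z < u" "f u - f v = (u - v) * g z" using MVT2[OF greater assms] by blast
  have "z \<in> closed_segment u v" using z by (simp add: closed_segment_eq_real_ivl)
  moreover have "\<bar>f u - f v\<bar> = \<bar>u - v\<bar> * \<bar>g z\<bar>" unfolding z(3) by (rule abs_mult)
  ultimately show ?thesis by (metis abs_minus_commute)
qed simp

text \<open>At a maximum of \<open>\<bar>w\<bar>\<close> over \<open>[a, b]\<close> the slope vanishes, and by
  the equation \<open>\<bar>w''\<bar>\<close> is at most \<open>q\<close> times that maximum; so
  \<open>w\<close> needs the distance \<open>1/\<surd>q\<close> to come down to a zero, and there is a zero in
  \<open>[a, b]\<close> for either kind of end points.\<close>

lemma zero_spacing:
  assumes ab: "a < b" and Q: "0 \<le> potential n a" "potential n b \<le> q"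
    and zeros: "(wave n a = 0 \<and> wave n b = 0) \<or> (slope n a = 0 \<and> slope n b = 0)"
  shows "1 / sqrt q \<le> b - a"
proof -
  have "potential n a < potential n b" by (rule potential_strict_mono[OF ab])
  then have q: "q > 0" using Q by simp
  have Qx: "\<bar>potential n x\<bar> \<le> q" if "a \<le> x" "x \<le> b" for x
    using Q potential_mono[OF that(1), of n] potential_mono[OF that(2), of n] by simp
  have "\<exists>x\<in>{a..b}. \<forall>y\<in>{a..b}. \<bar>wave n y\<bar> \<le> \<bar>wave n x\<bar>"
    by (intro continuous_attains_sup continuous_intros wave_cont) (use ab in auto)
  then obtain x where x: "x \<in> {a..b}" and max: "\<And>y. y \<in> {a..b} \<Longrightarrow> \<bar>wave n y\<bar> \<le> \<bar>wave n x\<bar>" by blast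
  have M: "wave n x \<noteq> 0"
  proof
    assume "wave n x = 0"
    then have z: "wave n y = 0" if "y \<in> {a..b}" for y using max[OF that] by simp
    obtain y where y: "a < y" "y < b" "wave n b - wave n a = (b - a) * slope n y"
      using MVT2[OF ab, of "wave n" "slope n"] wave_deriv by blast
    then have "slope n y = 0" using z[of a] z[of b] ab by simp
    then show False using zeros_simple[of n y] z[of y] y by simp
  qed
  have Vx: "slope n x = 0"
  proof (cases "a < x \<and> x < b")
    case True
    define d where "d = min (x - a) (b - x)"
    have d: "d > 0" "\<And>y. \<bar>x - y\<bar> < d \<Longrightarrow> y \<in> {a..b}" using True by (auto simp: d_def)
    show ?thesis
    proof (cases "wave n x > 0")
      case True
      then have "\<forall>y. \<bar>x - y\<bar> < d \<longrightarrow> wave n y \<le> wave n x" using max d(2) by (metis abs_le_iff abs_of_pos)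
      then show ?thesis using DERIV_local_max[OF wave_deriv d(1)] by blast
    next
      case False
      have "wave n x \<le> wave n y" if "\<bar>x - y\<bar> < d" for y
        using max[OF d(2)[OF that]] False by linarith
      then have "\<forall>y. \<bar>x - y\<bar> < d \<longrightarrow> wave n x \<le> wave n y" by blast
      then show ?thesis using DERIV_local_min[OF wave_deriv d(1)] by blast
    qed
  next
    case False
    then have "x = a \<or> x = b" using x by auto
    then show ?thesis using zeros M by auto
  qed
  obtain c where c: "c \<in> {a..b}" "wave n c = 0"
  proof (cases "wave n a = 0")
    case True then show ?thesis using that[of a] ab by simp
  next
    case False
    then have "slope n a = 0" "slope n b = 0" using zeros by auto
    obtain y where y: "a < y" "y < b" "slope n b - slope n a = (b - a) * (- potential n y * wave n y)"
      using MVT2[OF ab, of "slope n" "\<lambda>s. - potential n s * wave n s"] slope_deriv by blast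
    then have "potential n y * wave n y = 0" using \<open>slope n a = 0\<close> \<open>slope n b = 0\<close> ab by simp
    moreover have "potential n y > 0" using potential_strict_mono[OF y(1), of n] Q by simp
    ultimately show ?thesis using that[of y] y by simp
  qed
  obtain y where y: "y \<in> closed_segment c x" "\<bar>wave n x - wave n c\<bar> = \<bar>x - c\<bar> * \<bar>slope n y\<bar>"
    using MVT_abs[OF wave_deriv] by blast
  obtain z where z: "z \<in> closed_segment x y" "\<bar>slope n y - slope n x\<bar> = \<bar>y - x\<bar> * \<bar>- potential n z * wave n z\<bar>"
    using MVT_abs[OF slope_deriv] by blast
  have in_ab: "closed_segment u v \<subseteq> {a..b}" if "u \<in> {a..b}" "v \<in> {a..b}" for u v
    using that by (auto simp: closed_segment_eq_real_ivl split: if_splits)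
  have yz: "y \<in> {a..b}" "z \<in> {a..b}" using in_ab y(1) z(1) x c(1) by blast+
  have "\<bar>slope n y\<bar> \<le> (b - a) * (q * \<bar>wave n x\<bar>)"
  proof -
    have "\<bar>slope n y\<bar> = \<bar>y - x\<bar> * \<bar>potential n z * wave n z\<bar>" using z(2) Vx by simp
    also have "\<dots> \<le> (b - a) * (q * \<bar>wave n x\<bar>)"
      unfolding abs_mult[of "potential n z"]
    proof (rule mult_mono)
      show "\<bar>potential n z\<bar> * \<bar>wave n z\<bar> \<le> q * \<bar>wave n x\<bar>"
        by (rule mult_mono) (use yz Qx[of z] max[of z] q in simp_all)
    qed (use x yz in auto)
    finally show ?thesis .
  qed
  then have "\<bar>wave n x\<bar> \<le> (b - a) * ((b - a) * (q * \<bar>wave n x\<bar>))"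
  proof -
    have "\<bar>wave n x\<bar> = \<bar>x - c\<bar> * \<bar>slope n y\<bar>" using y(2) c(2) by simp
    also have "\<dots> \<le> (b - a) * ((b - a) * (q * \<bar>wave n x\<bar>))"
      by (rule mult_mono[OF _ \<open>\<bar>slope n y\<bar> \<le> _\<close>]) (use c(1) x in auto)
    finally show ?thesis .
  qed
  then have "\<bar>wave n x\<bar> * 1 \<le> \<bar>wave n x\<bar> * (q * (b - a)\<^sup>2)" by (simp add: mult_ac power2_eq_square)
  moreover have "0 < \<bar>wave n x\<bar>" using M by simp
  ultimately have "1 \<le> q * (b - a)\<^sup>2" by (simp only: mult_le_cancel_left_pos)
  then have "sqrt 1 \<le> sqrt (q * (b - a)\<^sup>2)" by (rule real_sqrt_le_mono)
  then have "1 \<le> sqrt q * (b - a)" using ab by (simp add: real_sqrt_mult)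
  then show ?thesis using q by (simp add: field_simps)
qed

text \<open>The empty set is excluded because the right-hand side is negative when \<open>b\<close> is much
  smaller than \<open>a\<close>.\<close>

lemma separated_card_le:
  fixes Z :: "real set"
  assumes "d > 0" "Z \<subseteq> {a..b}" "\<And>x y. x \<in> Z \<Longrightarrow> y \<in> Z \<Longrightarrow> x < y \<Longrightarrow> d \<le> y - x"
  shows "finite Z" "real (card Z) \<le> (b - a) / d + 1 \<or> Z = {}"
proof -
  define f where "f = (\<lambda>x. \<lfloor>(x - a) / d\<rfloor>)"
  have inj: "inj_on f Z"
  proof (rule linorder_inj_onI)
    fix x y assume xy: "x < y" "x \<in> Z" "y \<in> Z"
    have "(x - a + d) / d \<le> (y - a) / d"
      using assms(3)[OF xy(2,3,1)] assms(1) by (intro divide_right_mono) auto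
    then have "(x - a) / d + 1 \<le> (y - a) / d" using assms(1) by (simp add: add_divide_distrib)
    then show "f x \<noteq> f y" unfolding f_def by linarith
  qed auto
  have im: "f ` Z \<subseteq> {0..\<lfloor>(b - a) / d\<rfloor>}"
  proof
    fix y assume "y \<in> f ` Z"
    then obtain x where x: "x \<in> Z" "y = f x" by blast
    then have "a \<le> x" "x \<le> b" using assms(2) by auto
    then have "0 \<le> (x - a) / d" "(x - a) / d \<le> (b - a) / d" using assms(1) by (auto intro: divide_right_mono)
    then show "y \<in> {0..\<lfloor>(b - a) / d\<rfloor>}" by (simp add: x f_def floor_mono)
  qed
  show fin: "finite Z" using inj im by (meson finite_atLeastAtMost_int finite_imageD finite_subset)
  show "real (card Z) \<le> (b - a) / d + 1 \<or> Z = {}"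
  proof (cases "Z = {}")
    case False
    then have "a \<le> b" using assms(2) by fastforce
    then have p: "(b - a) / d \<ge> 0" using assms(1) by simp
    have "card Z \<le> card {0..\<lfloor>(b - a) / d\<rfloor>}" using inj im by (metis card_inj_on_le finite_atLeastAtMost_int)
    also have "\<dots> = nat (\<lfloor>(b - a) / d\<rfloor> + 1)" by simp
    finally have "real (card Z) \<le> real (nat (\<lfloor>(b - a) / d\<rfloor> + 1))" by simp
    also have "\<dots> \<le> (b - a) / d + 1" using p by linarith
    finally show ?thesis by simp
  qed simp
qed

text \<open>The intervals of length \<open>L\<close> are spaced by \<open>2 L\<close>, so that zeros in
  different ones are different.\<close>

lemma card_ge_disjoint_intervals:
  fixes Z :: "real set"
  assumes "L > 0" "finite Z" "a \<le> b"
    "\<And>x. a \<le> x \<Longrightarrow> x + L \<le> b \<Longrightarrow> \<exists>z\<in>Z. x \<le> z \<and> z \<le> x + L"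
  shows "(b - a) / (2 * L) - 1 \<le> real (card Z)"
proof -
  define k where "k = nat \<lfloor>(b - a) / (2 * L)\<rfloor>"
  have "(b - a) / (2 * L) \<ge> 0" using assms by simp
  then have k: "real k \<le> (b - a) / (2 * L)" "(b - a) / (2 * L) - 1 \<le> real k" unfolding k_def by linarith+
  have "\<exists>z. z \<in> Z \<and> a + 2 * L * real j \<le> z \<and> z \<le> a + 2 * L * real j + L" if "j < k" for j
  proof -
    have "real j + 1 \<le> (b - a) / (2 * L)" using k(1) that by linarith
    then have "2 * L * (real j + 1) \<le> b - a" using assms(1) by (simp add: field_simps)
    then have "a + 2 * L * real j + L \<le> b" using assms(1) by (simp add: algebra_simps)
    moreover have "a \<le> a + 2 * L * real j" using assms(1) by simp
    ultimately show ?thesis using assms(4) by blast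
  qed
  then obtain z where z: "\<And>j. j < k \<Longrightarrow> z j \<in> Z \<and> a + 2 * L * real j \<le> z j \<and> z j \<le> a + 2 * L * real j + L"
    by metis
  have "inj_on z {..<k}"
  proof (rule linorder_inj_onI)
    fix i j assume ij: "i < j" "i \<in> {..<k}" "j \<in> {..<k}"
    have "2 * L * (real i + 1) \<le> 2 * L * real j" using ij(1) assms(1) by (intro mult_left_mono) auto
    then have "a + 2 * L * real i + L < a + 2 * L * real j" using assms(1) by (simp add: algebra_simps)
    then show "z i \<noteq> z j" using z[of i] z[of j] ij by fastforce
  qed auto
  then have "card {..<k} \<le> card Z" using z assms(2) by (intro card_inj_on_le[of z]) auto
  then show ?thesis using k(2) by simp
qed

section \<open>Up to the turning point\<close>

lemma first_zero:
  fixes f :: "real \<Rightarrow> real"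
  assumes cont: "\<And>S. continuous_on S f" and "a \<le> b" "f a > 0" "f b = 0"
  obtains c where "a < c" "c \<le> b" "f c = 0" "\<And>x. a \<le> x \<Longrightarrow> x < c \<Longrightarrow> f x > 0"
proof -
  define Z where "Z = {x\<in>{a..b}. f x = 0}"
  have "closed Z" unfolding Z_def
    by (intro continuous_closed_preimage_constant cont) auto
  moreover have "bounded Z" by (rule bounded_subset[of "{a..b}"]) (auto simp: Z_def)
  ultimately have "compact Z" by (simp add: compact_eq_bounded_closed)
  moreover have "Z \<noteq> {}" using assms by (auto simp: Z_def)
  ultimately have "\<exists>c\<in>Z. \<forall>x\<in>Z. c \<le> x" by (rule compact_attains_inf)
  then obtain c where c: "c \<in> Z" "\<And>x. x \<in> Z \<Longrightarrow> c \<le> x" by blast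
  have "f x > 0" if x: "a \<le> x" "x < c" for x
  proof (rule ccontr)
    assume "\<not> f x > 0"
    then have "f x \<le> 0" by simp
    then obtain y where "a \<le> y" "y \<le> x" "f y = 0"
      using IVT2'[OF _ _ _ cont, of x 0 a] x(1) assms(3) by (meson less_imp_le)
    then have "y \<in> Z" using x c(1) by (auto simp: Z_def)
    then show False using c(2)[of y] \<open>y \<le> x\<close> x by simp
  qed
  moreover have "a \<le> c" "c \<le> b" "f c = 0" using c(1) by (auto simp: Z_def)
  moreover have "a \<noteq> c" using \<open>f c = 0\<close> assms(3) by auto
  ultimately show thesis by (intro that[of c]) auto
qed

lemma potential_neg:
  assumes "s < ln (real n)" "n \<ge> 1"
  shows "potential n s < 0"
proof -
  have "exp s < exp (ln (real n))" using assms(1) by (simp only: exp_less_cancel_iff)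
  then have "exp s < real n" using assms(2) by simp
  then have "(exp s)\<^sup>2 < (real n)\<^sup>2" by (intro power_strict_mono) auto
  then show ?thesis by (simp add: potential_def)
qed

lemma potential_ln: "n \<ge> 1 \<Longrightarrow> potential n (ln (real n)) = 0"
  unfolding potential_def by simp

text \<open>There the potential is not positive, so a vanishing slope would make the energy
  nonpositive.\<close>

lemma slope_nz_before_turning: "s \<le> ln (real n) \<Longrightarrow> n \<ge> 1 \<Longrightarrow> slope n s \<noteq> 0"
proof
  assume *: "s \<le> ln (real n)" "n \<ge> 1" "slope n s = 0"
  then have "potential n s \<le> 0" using potential_mono[OF *(1), of n] potential_ln by simp
  then have "potential n s * (wave n s)\<^sup>2 \<le> 0" by (simp add: mult_nonpos_nonneg)
  then show False using energy_pos[of n s] * by (simp add: energy_def)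
qed

lemma bessel_J_at_0: "n \<ge> 1 \<Longrightarrow> bessel_J n 0 = 0"
  by (simp add: bessel_J_eq_G)

text \<open>Near \<open>t = 0\<close> the slope increases from its limit \<open>0\<close>, because \<open>w''
  = - Q w > 0\<close>; afterwards it cannot change sign before the turning point \<open>t = n\<close>.\<close>

lemma slope_pos_before_turning:
  assumes n: "n \<ge> 1" and s: "s \<le> ln (real n)"
  shows "slope n s > 0"
proof -
  obtain s0 where s0: "\<And>x. x \<le> s0 \<Longrightarrow> 0 < wave n x" using wave_pos_near by blast
  define a where "a = min (s0 - 1) (s - 1)"
  have "continuous_on UNIV (\<lambda>t. real n * bessel_J n t - t * bessel_J (n + 1) t)" by (intro continuous_intros)
  then have "isCont (\<lambda>t. real n * bessel_J n t - t * bessel_J (n + 1) t) 0"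
    by (simp add: continuous_on_eq_continuous_at)
  then have "((\<lambda>t. real n * bessel_J n t - t * bessel_J (n + 1) t) \<longlongrightarrow> 0) (at 0)"
    using bessel_J_at_0[OF n] unfolding isCont_def by simp
  moreover have "filterlim (exp::real\<Rightarrow>real) (at 0) at_bot" by (simp add: filterlim_at exp_at_bot)
  ultimately have lim: "(slope n \<longlongrightarrow> 0) at_bot"
    unfolding slope_def[abs_def] by (rule filterlim_compose)
  have a: "slope n a > 0"
  proof (rule DERIV_pos_imp_increasing_at_bot[where f = "slope n", OF _ lim])
    fix x assume x: "x \<le> a"
    then have "potential n x < 0" using s n by (intro potential_neg) (auto simp: a_def)
    moreover have "0 < wave n x" using x s0 by (simp add: a_def)
    ultimately have "- potential n x * wave n x > 0" by (simp add: mult_neg_pos)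
    then show "\<exists>y. (slope n has_real_derivative y) (at x) \<and> 0 < y" using slope_deriv by blast
  qed
  show ?thesis
  proof (rule ccontr)
    assume "\<not> slope n s > 0"
    then have "slope n s \<le> 0" by simp
    moreover have "a \<le> s" by (simp add: a_def)
    ultimately obtain y where "a \<le> y" "y \<le> s" "slope n y = 0"
      using IVT2'[OF _ _ _ slope_cont, of n s 0 a] a by (meson less_imp_le)
    then show False using slope_nz_before_turning[of y n] s n by simp
  qed
qed

lemma wave_pos_if_slope_pos:
  assumes "\<And>x. x < s \<Longrightarrow> slope n x > 0"
  shows "wave n s > 0"
proof -
  obtain s0 where s0: "\<And>x. x \<le> s0 \<Longrightarrow> 0 < wave n x" using wave_pos_near by blast
  show ?thesis
  proof (cases "s \<le> s0")
    case False
    have "wave n s0 < wave n s"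
    proof (rule DERIV_pos_imp_increasing_open[where f = "wave n"])
      show "\<exists>y. (wave n has_real_derivative y) (at x) \<and> 0 < y" if "s0 < x" "x < s" for x
        using wave_deriv assms that by blast
    qed (use False wave_cont in auto)
    then show ?thesis using s0[of s0] by simp
  qed (use s0 in auto)
qed

lemma wave_pos_before_turning: "n \<ge> 1 \<Longrightarrow> s \<le> ln (real n) \<Longrightarrow> wave n s > 0"
  by (rule wave_pos_if_slope_pos) (auto intro: slope_pos_before_turning)

text \<open>The derivative of \<open>w'/w\<close> is \<open>- E / w\<^sup>2\<close>.\<close>

lemma log_deriv_mono:
  assumes n: "n \<ge> 1" and st: "s \<le> t" "t \<le> ln (real n)"
  shows "slope n t / wave n t \<le> slope n s / wave n s"
proof (rule DERIV_nonpos_imp_nonincreasing[where f = "\<lambda>x. slope n x / wave n x", OF st(1)])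
  fix x assume "s \<le> x" "x \<le> t"
  then have W: "wave n x > 0" using wave_pos_before_turning[OF n] st by simp
  have "((\<lambda>x. slope n x / wave n x) has_real_derivative
    ((- potential n x * wave n x) * wave n x - slope n x * slope n x) / (wave n x * wave n x)) (at x)"
    by (rule DERIV_divide[OF slope_deriv wave_deriv]) (use W in simp)
  moreover have "(- potential n x * wave n x) * wave n x - slope n x * slope n x = - energy n x"
    by (simp add: energy_def power2_eq_square)
  moreover have "- energy n x / (wave n x * wave n x) \<le> 0" using energy_pos[of n x] by simp
  ultimately show "\<exists>y. ((\<lambda>x. slope n x / wave n x) has_real_derivative y) (at x) \<and> y \<le> 0" by metis
qed

lemma cbrt_n_cube_pos: "n \<ge> 1 \<Longrightarrow> cbrt_n n ^ 3 = real n"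
  using cbrt_n_cube[of n] by (simp add: max_def split: if_splits)

text \<open>If the logarithmic derivative at the turning point were small, the convex wave would keep half of
  its size on an interval of length about \<open>n\<^bsup>-2/3\<^esup>\<close> before it, and the energy
  collected there would exceed the square of the slope.\<close>

lemma log_deriv_lower:
  assumes n: "n \<ge> 1"
  shows "(cbrt_n n)\<^sup>2 / 4 * wave n (ln (real n)) \<le> slope n (ln (real n))"
proof (rule ccontr)
  define s0 where "s0 = ln (real n)"
  define h where "h = cbrt_n n"
  have h: "h \<ge> 1" "h ^ 3 = real n" using cbrt_n_ge_1 cbrt_n_cube_pos[OF n] by (simp_all add: h_def)
  assume "\<not> ?thesis"
  then have V0: "slope n s0 < h\<^sup>2 / 4 * wave n s0" by (simp add: s0_def h_def)
  define W0 where "W0 = wave n s0"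
  have W0: "W0 > 0" using wave_pos_before_turning[OF n] by (simp add: W0_def s0_def)
  \<comment> \<open>The interval is short enough for the wave to keep half of its size and for \<open>t\<close> to stay comparable to \<open>n\<close>.\<close>
  define \<sigma> where "\<sigma> = 1 / (2 * h\<^sup>2)"
  have h2: "h\<^sup>2 \<ge> 1" using h(1) by simp
  have \<sigma>: "\<sigma> > 0" "\<sigma> \<le> 1 / 2" using h2 h(1) unfolding \<sigma>_def by (auto simp: field_simps)
  obtain \<xi> where \<xi>: "s0 - \<sigma> < \<xi>" "\<xi> < s0" "energy n s0 - energy n (s0 - \<sigma>) = (s0 - (s0 - \<sigma>)) * (2 * (exp \<xi>)\<^sup>2 * (wave n \<xi>)\<^sup>2)"
    using MVT2[of "s0 - \<sigma>" s0 "energy n" "\<lambda>s. 2 * (exp s)\<^sup>2 * (wave n s)\<^sup>2"] energy_deriv \<sigma> by auto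
  obtain \<eta> where \<eta>: "\<xi> < \<eta>" "\<eta> < s0" "wave n s0 - wave n \<xi> = (s0 - \<xi>) * slope n \<eta>"
    using MVT2[of \<xi> s0 "wave n" "slope n"] wave_deriv \<xi> by auto
  have "slope n \<eta> \<le> slope n s0"
  proof (rule DERIV_nonneg_imp_nondecreasing[where f = "slope n"])
    fix x assume "\<eta> \<le> x" "x \<le> s0"
    then have "potential n x \<le> 0" "wave n x > 0"
      using potential_mono[of x s0 n] potential_ln[OF n] wave_pos_before_turning[OF n] by (auto simp: s0_def)
    then have "- potential n x * wave n x \<ge> 0" by (simp add: mult_nonpos_nonneg)
    then show "\<exists>y. (slope n has_real_derivative y) (at x) \<and> 0 \<le> y" using slope_deriv by blast
  qed (use \<eta> in simp)
  then have "(s0 - \<xi>) * slope n \<eta> \<le> \<sigma> * (h\<^sup>2 / 4 * W0)"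
    using \<xi> \<eta> V0 slope_pos_before_turning[OF n, of \<eta>] \<sigma> by (intro mult_mono) (auto simp: s0_def W0_def less_imp_le)
  also have "\<dots> = W0 / 8" using h(1) by (simp add: \<sigma>_def)
  finally have W\<xi>: "wave n \<xi> \<ge> W0 / 2" using \<eta>(3) W0 unfolding W0_def by linarith
  have "exp (s0 - 1 / 2) \<le> exp \<xi>" using \<xi> \<sigma> by simp
  moreover have "exp s0 = real n" using n by (simp add: s0_def)
  then have "exp (s0 - 1 / 2) = real n * exp (- 1 / 2)" using exp_add[of s0 "- 1 / 2"] by simp
  ultimately have "(real n * exp (- 1 / 2))\<^sup>2 \<le> (exp \<xi>)\<^sup>2" by (intro power_mono) auto
  moreover have "(exp (- 1 / 2 :: real))\<^sup>2 = exp (- 1)" by (simp add: exp_double[symmetric])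
  moreover have "exp (- 1 :: real) \<ge> 1 / 3" using exp_le by (simp add: exp_minus field_simps)
  moreover have "(real n)\<^sup>2 * (1 / 3) \<le> (real n)\<^sup>2 * exp (- 1)" using \<open>exp (- 1 :: real) \<ge> 1 / 3\<close> by (intro mult_left_mono) auto
  ultimately have e\<xi>: "(real n)\<^sup>2 / 3 \<le> (exp \<xi>)\<^sup>2" by (simp add: power_mult_distrib)
  have "(W0 / 2)\<^sup>2 \<le> (wave n \<xi>)\<^sup>2" using W\<xi> W0 by (intro power_mono) auto
  then have "((real n)\<^sup>2 / 3) * (W0\<^sup>2 / 4) \<le> (exp \<xi>)\<^sup>2 * (wave n \<xi>)\<^sup>2"
    using e\<xi> by (intro mult_mono) (auto simp: power_divide)
  then have "\<sigma> * (2 * (((real n)\<^sup>2 / 3) * (W0\<^sup>2 / 4))) \<le> \<sigma> * (2 * ((exp \<xi>)\<^sup>2 * (wave n \<xi>)\<^sup>2))"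
    using \<sigma>(1) by (intro mult_left_mono) auto
  also have "\<dots> = energy n s0 - energy n (s0 - \<sigma>)" unfolding \<xi>(3) by (simp add: mult_ac)
  also have "\<dots> < energy n s0" using energy_pos by simp
  also have "\<dots> = (slope n s0)\<^sup>2" using potential_ln[OF n] by (simp add: energy_def s0_def)
  also have "\<dots> \<le> (h\<^sup>2 / 4 * W0)\<^sup>2"
    using V0 slope_pos_before_turning[OF n, of s0] by (intro power_mono) (auto simp: s0_def W0_def)
  finally have "\<sigma> * (2 * (((real n)\<^sup>2 / 3) * (W0\<^sup>2 / 4))) < (h\<^sup>2 / 4 * W0)\<^sup>2" .
  moreover have "\<sigma> * (2 * (((real n)\<^sup>2 / 3) * (W0\<^sup>2 / 4))) = h ^ 4 * W0\<^sup>2 / 12"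
  proof -
    have n2: "(real n)\<^sup>2 = h\<^sup>2 * h ^ 4" unfolding h(2)[symmetric] by (simp add: eval_nat_numeral)
    have "\<sigma> * h\<^sup>2 = 1 / 2" using h(1) by (simp add: \<sigma>_def)
    have "\<sigma> * (2 * ((a * b / 3) * (w / 4))) = (\<sigma> * a) * (b * w / 6)" for a b w :: real
      by (simp add: field_simps)
    then show ?thesis unfolding n2 by (simp only: \<open>\<sigma> * h\<^sup>2 = 1 / 2\<close>)
  qed
  moreover have "(h\<^sup>2 / 4 * W0)\<^sup>2 = h ^ 4 * W0\<^sup>2 / 16" by (simp add: power_mult_distrib power_divide flip: power_mult)
  moreover have "0 < h ^ 4 * W0\<^sup>2" using h(1) W0 by simp
  ultimately show False by linarith
qed

text \<open>The first crest is not too close to the turning point: before \<open>Q\<close> has reached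
  \<open>n\<^bsup>4/3\<^esup>/2\<close>, the slope cannot lose the amount, at least
  \<open>n\<^bsup>2/3\<^esup> w/4\<close>, that it has at the turning point. This keeps every eigenvalue
  inside the region where the amplitude is almost constant.\<close>

lemma slope_zero_lower:
  assumes n: "n \<ge> 1" and s1: "slope n s1 = 0" "\<And>x. x < s1 \<Longrightarrow> slope n x > 0"
  shows "(cbrt_n n) ^ 4 / 2 < potential n s1"
proof (rule ccontr)
  define s0 where "s0 = ln (real n)"
  define h where "h = cbrt_n n"
  have h: "h \<ge> 1" "h ^ 3 = real n" using cbrt_n_ge_1 cbrt_n_cube_pos[OF n] by (simp_all add: h_def)
  assume "\<not> ?thesis"
  then have Q1: "potential n s1 \<le> h ^ 4 / 2" by (simp add: h_def)
  have s01: "s0 < s1" using slope_nz_before_turning[OF _ n, of s1] s1(1) by (force simp: s0_def)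
  define \<Delta> where "\<Delta> = s1 - s0"
  have \<Delta>: "\<Delta> > 0" using s01 by (simp add: \<Delta>_def)
  have V0: "slope n s0 > 0" using s1(2) s01 by simp
  have W0: "wave n s0 \<le> 4 / h\<^sup>2 * slope n s0"
  proof -
    have "h\<^sup>2 / 4 * wave n s0 \<le> slope n s0" using log_deriv_lower[OF n] by (simp add: s0_def h_def)
    then show ?thesis using h(1) by (simp add: field_simps)
  qed
  have D: "\<Delta> \<le> 1 / (4 * h\<^sup>2)"
  proof -
    have "exp s1 = real n * exp \<Delta>" using n by (simp add: \<Delta>_def s0_def exp_diff)
    then have "potential n s1 = (real n)\<^sup>2 * ((exp \<Delta>)\<^sup>2 - 1)" by (simp add: potential_def algebra_simps power_mult_distrib)
    moreover have "1 + 2 * \<Delta> \<le> exp (2 * \<Delta>)" by (rule exp_ge_add_one_self)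
    then have "(real n)\<^sup>2 * (2 * \<Delta>) \<le> (real n)\<^sup>2 * ((exp \<Delta>)\<^sup>2 - 1)" by (intro mult_left_mono) (auto simp: exp_double)
    ultimately have "(real n)\<^sup>2 * (2 * \<Delta>) \<le> h ^ 4 / 2" using Q1 by simp
    moreover have "(real n)\<^sup>2 = h\<^sup>2 * h ^ 4" unfolding h(2)[symmetric] by (simp add: eval_nat_numeral)
    ultimately have "h ^ 4 * (h\<^sup>2 * (2 * \<Delta>)) \<le> h ^ 4 * (1 / 2)" by (simp add: mult_ac)
    moreover have "h ^ 4 > 0" using h by simp
    ultimately have "h\<^sup>2 * (2 * \<Delta>) \<le> 1 / 2" by (simp only: mult_le_cancel_left_pos)
    then show ?thesis using h by (simp add: field_simps)
  qed
  have Wpos: "wave n x > 0" if "x \<le> s1" for x using that s1(2) by (intro wave_pos_if_slope_pos) auto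
  obtain \<xi> where \<xi>: "s0 < \<xi>" "\<xi> < s1" "slope n s1 - slope n s0 = (s1 - s0) * (- potential n \<xi> * wave n \<xi>)"
    using MVT2[of s0 s1 "slope n" "\<lambda>s. - potential n s * wave n s"] slope_deriv s01 by auto
  obtain \<eta> where \<eta>: "s0 < \<eta>" "\<eta> < \<xi>" "wave n \<xi> - wave n s0 = (\<xi> - s0) * slope n \<eta>"
    using MVT2[of s0 \<xi> "wave n" "slope n"] wave_deriv \<xi> by auto
  have "slope n \<eta> \<le> slope n s0"
  proof (rule DERIV_nonpos_imp_nonincreasing[where f = "slope n"])
    fix x assume x: "s0 \<le> x" "x \<le> \<eta>"
    then have "potential n x \<ge> 0" "wave n x > 0"
      using potential_mono[of s0 x n] potential_ln[OF n] Wpos[of x] \<eta> \<xi> by (auto simp: s0_def)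
    then have "- potential n x * wave n x \<le> 0" by simp
    then show "\<exists>y. (slope n has_real_derivative y) (at x) \<and> y \<le> 0" using slope_deriv by blast
  qed (use \<eta> in simp)
  then have "(\<xi> - s0) * slope n \<eta> \<le> \<Delta> * slope n s0"
    using \<xi> \<eta> \<Delta> s1(2)[of \<eta>] by (intro mult_mono) (auto simp: \<Delta>_def)
  also have "\<dots> \<le> 1 / (4 * h\<^sup>2) * slope n s0" using D V0 by (intro mult_right_mono) auto
  finally have "wave n \<xi> \<le> (4 / h\<^sup>2 + 1 / (4 * h\<^sup>2)) * slope n s0" using \<eta>(3) W0 by (simp add: algebra_simps)
  also have "4 / h\<^sup>2 + 1 / (4 * h\<^sup>2) = 17 / (4 * h\<^sup>2)" using h(1) by (simp add: field_simps)
  finally have W\<xi>: "wave n \<xi> \<le> 17 / (4 * h\<^sup>2) * slope n s0" .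
  have Q\<xi>: "potential n \<xi> \<le> h ^ 4 / 2" "0 \<le> potential n \<xi>"
    using potential_mono[of \<xi> s1 n] potential_mono[of s0 \<xi> n] Q1 \<xi> potential_ln[OF n] by (auto simp: s0_def)
  have "slope n s0 = \<Delta> * (potential n \<xi> * wave n \<xi>)" using \<xi>(3) s1(1) by (simp add: \<Delta>_def)
  also have "\<dots> \<le> 1 / (4 * h\<^sup>2) * (h ^ 4 / 2 * (17 / (4 * h\<^sup>2) * slope n s0))"
    using D W\<xi> Q\<xi> Wpos[of \<xi>] \<xi> \<Delta> h(1) by (intro mult_mono) auto
  also have "\<dots> = 17 / 32 * slope n s0" using h(1) by (simp add: field_simps power2_eq_square power4_eq_xxxx)
  finally show False using V0 by simp
qed

section \<open>The first crest\<close>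

text \<open>The slope has a zero soon after \<open>Q\<close> has reached the size
  \<open>n\<^bsup>4/3\<^esup>\<close>, by oscillation; so the first crest is not too far from the turning
  point either.\<close>

lemma first_slope_zero:
  assumes n: "n \<ge> 1"
  obtains s1 where "slope n s1 = 0" "\<And>x. x < s1 \<Longrightarrow> slope n x > 0" "ln (real n) < s1"
    "potential n s1 \<le> (6 * pi + 1) * exp (6 * pi) * cbrt_n n ^ 4"
proof -
  define h where "h = cbrt_n n"
  have h: "h \<ge> 1" "h ^ 3 = real n" using cbrt_n_ge_1 cbrt_n_cube_pos[OF n] by (simp_all add: h_def)
  \<comment> \<open>the point where the potential equals \<open>h\<^sup>4\<close>\<close>
  define x where "x = ln ((real n)\<^sup>2 + h ^ 4) / 2"
  have pos: "(real n)\<^sup>2 + h ^ 4 > 0" using h(1) by (intro add_nonneg_pos) auto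
  have ex: "(exp x)\<^sup>2 = (real n)\<^sup>2 + h ^ 4" using pos by (simp add: x_def exp_double[symmetric])
  then have Qx: "potential n x = h ^ 4" by (simp add: potential_def)
  have h4: "h ^ 4 > 0" using h(1) by simp
  have sh: "sqrt (h ^ 4) = h\<^sup>2" by (rule real_sqrt_unique) (simp_all flip: power_mult)
  obtain z where z: "x \<le> z" "z \<le> x + 3 * pi / h\<^sup>2" "slope n z = 0"
    using slope_zero_exists[OF h4, of n x] unfolding Qx sh by auto
  have xln: "ln (real n) < x"
  proof -
    have "potential n (ln (real n)) < potential n x" using Qx h4 potential_ln[OF n] by simp
    then show ?thesis using potential_mono[of x "ln (real n)" n] by (meson not_le)
  qed
  then have "ln (real n) \<le> z" using z by simp
  from first_zero[OF slope_cont this slope_pos_before_turning[OF n order_refl] z(3)]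
  obtain s1 where s1: "ln (real n) < s1" "s1 \<le> z" "slope n s1 = 0"
    "\<And>y. ln (real n) \<le> y \<Longrightarrow> y < s1 \<Longrightarrow> slope n y > 0" by blast
  have V: "slope n y > 0" if "y < s1" for y
    using slope_pos_before_turning[OF n, of y] s1(4)[of y] that by linarith
  define y where "y = 6 * pi / h\<^sup>2"
  have h2: "h\<^sup>2 \<ge> 1" using h(1) by simp
  have y: "0 \<le> y" "y \<le> 6 * pi" using h2 by (simp_all add: y_def divide_le_eq mult_le_cancel_left1)
  have "potential n s1 \<le> potential n (x + 3 * pi / h\<^sup>2)" using s1(2) z(2) by (intro potential_mono) simp
  also have "\<dots> = ((real n)\<^sup>2 + h ^ 4) * exp y - (real n)\<^sup>2"
    unfolding potential_def exp_add power_mult_distrib ex by (simp add: y_def exp_double[symmetric])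
  also have "\<dots> = (real n)\<^sup>2 * (exp y - 1) + h ^ 4 * exp y" by (simp add: algebra_simps)
  also have "\<dots> \<le> (real n)\<^sup>2 * (y * exp (6 * pi)) + h ^ 4 * exp (6 * pi)"
  proof (intro add_mono mult_left_mono)
    have "1 + (- y) \<le> exp (- y)" by (rule exp_ge_add_one_self)
    then have "exp y * (1 - y) \<le> exp y * exp (- y)" by (intro mult_left_mono) auto
    then have "exp y - 1 \<le> y * exp y" by (simp add: algebra_simps flip: exp_add)
    also have "\<dots> \<le> y * exp (6 * pi)" using y by (intro mult_left_mono) auto
    finally show "exp y - 1 \<le> y * exp (6 * pi)" .
  qed (use y in auto)
  also have "(real n)\<^sup>2 = h\<^sup>2 * h ^ 4" unfolding h(2)[symmetric] by (simp add: eval_nat_numeral)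
  also have "h\<^sup>2 * h ^ 4 * (y * exp (6 * pi)) + h ^ 4 * exp (6 * pi) = (6 * pi + 1) * exp (6 * pi) * h ^ 4"
  proof -
    have "a * b * (w * e) + b * e = (a * w + 1) * e * b" for a b w e :: real by (simp add: algebra_simps)
    moreover have "h\<^sup>2 * y = 6 * pi" using h(1) by (simp add: y_def)
    ultimately show ?thesis by (simp only:)
  qed
  finally show thesis using s1 V by (intro that[of s1]) (auto simp: h_def)
qed

text \<open>What is needed to know about the wave up to the point \<open>exp s1\<close>, where the oscillation
  starts. With \<open>a\<close> the amplitude there and \<open>h = n\<^bsup>1/3\<^esup>\<close>: the potential
  has size \<open>h\<^sup>4\<close>, neither the wave nor its slope has an earlier zero, the wave is at most
  of size \<open>a/h\<close>, its mass is no larger than if it lived on the transition region only, and it has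
  the size \<open>a/h\<close> on a set of \<open>t dt\<close>-mass \<open>h\<^sup>4\<close>. All constants are
  merged into \<open>C\<close>, in which the predicate is monotone.\<close>

definition turning_data :: "real \<Rightarrow> nat \<Rightarrow> real \<Rightarrow> real \<Rightarrow> bool" where
  "turning_data C n s0 s1 \<longleftrightarrow> s0 \<le> s1 \<and> cbrt_n n ^ 4 \<le> C * potential n s1 \<and> potential n s1 \<le> C * cbrt_n n ^ 4 \<and>
     (\<forall>s<s1. wave n s \<noteq> 0 \<and> slope n s \<noteq> 0) \<and>
     (\<forall>s\<le>s1. \<bar>wave n s\<bar> * cbrt_n n \<le> C * sqrt (amplitude_sq n s1)) \<and>
     integral {0..exp s1} (\<lambda>t. t * \<bar>bessel_J n t\<bar>) \<le> C * (sqrt (amplitude_sq n s1) * cbrt_n n ^ 3) \<and>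
     (\<forall>s\<in>{s0..s1}. sqrt (amplitude_sq n s1) \<le> C * (\<bar>wave n s\<bar> * cbrt_n n)) \<and>
     cbrt_n n ^ 4 \<le> C * ((exp s1)\<^sup>2 - (exp s0)\<^sup>2)"

lemma turning_data_mono:
  assumes "turning_data C n s0 s1" "0 < C" "C \<le> C'"
  shows "turning_data C' n s0 s1"
proof -
  have up: "C * x \<le> C' * x" if "0 \<le> x" for x using that assms by (simp add: mult_right_mono)
  have h: "cbrt_n n \<ge> 1" by (rule cbrt_n_ge_1)
  have Q: "potential n s1 \<ge> 0"
  proof (rule ccontr)
    assume "\<not> ?thesis"
    then have "C * potential n s1 \<le> 0" using assms(2) by (simp add: mult_nonneg_nonpos)
    moreover have "cbrt_n n ^ 4 > 0" using h by simp
    ultimately show False using assms(1) unfolding turning_data_def by simp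
  qed
  have e: "amplitude_sq n s1 \<ge> 0" using Q energy_pos[of n s1] by (simp add: amplitude_sq_def)
  have le: "s0 \<le> s1" using assms(1) by (simp add: turning_data_def)
  have "(exp s1)\<^sup>2 - (exp s0)\<^sup>2 \<ge> 0" using le by (simp add: power_mono)
  note u = up[OF Q] up[OF this] up[of "cbrt_n n ^ 4"] up[of "sqrt (amplitude_sq n s1)"]
    up[of "sqrt (amplitude_sq n s1) * cbrt_n n ^ 3"]
  have u6: "C * (\<bar>wave n s\<bar> * cbrt_n n) \<le> C' * (\<bar>wave n s\<bar> * cbrt_n n)" for s using h by (intro up) auto
  show ?thesis
    using assms(1) u h e unfolding turning_data_def
    by (auto intro: order_trans[OF _ u6] order_trans)
qed

lemma bessel_J_pos_below_turning:
  assumes n: "n \<ge> 1" and s1: "\<And>x. x < s1 \<Longrightarrow> slope n x > 0" and t: "0 < t" "t \<le> exp s1"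
  shows "bessel_J n t > 0" "bessel_J n t \<le> wave n s1"
proof -
  have lt: "ln t \<le> s1" using t by (metis exp_gt_zero exp_ln ln_le_cancel_iff ln_exp)
  have "wave n (ln t) > 0" using s1 lt by (intro wave_pos_if_slope_pos) auto
  then show "bessel_J n t > 0" using t by (simp add: wave_def)
  have "wave n (ln t) \<le> wave n s1"
  proof (rule DERIV_nonneg_imp_increasing_open[where f = "wave n", OF lt])
    show "\<exists>y. (wave n has_real_derivative y) (at x) \<and> 0 \<le> y" if "ln t < x" "x < s1" for x
      using wave_deriv s1 that by (meson less_imp_le)
  qed (rule wave_cont)
  then show "bessel_J n t \<le> wave n s1" using t by (simp add: wave_def)
qed

text \<open>Below the turning point \<open>J\<^sub>n \<le> (4/h\<^sup>2) t J\<^sub>n'\<close>, so \<open>t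
  J\<^sub>n\<close> is dominated by a multiple of the derivative of \<open>J\<^sub>n\<close>. This replaces
  the exponential decay of \<open>J\<^sub>n\<close> towards the origin.\<close>

lemma bessel_J_integral_below_n:
  assumes n: "n \<ge> 1"
  shows "integral {0..real n} (\<lambda>t. t * \<bar>bessel_J n t\<bar>) \<le> 4 * cbrt_n n ^ 4 * bessel_J n (real n)"
proof -
  define h where "h = cbrt_n n"
  have h: "h \<ge> 1" "h ^ 3 = real n" using cbrt_n_ge_1 cbrt_n_cube_pos[OF n] by (simp_all add: h_def)
  define g where "g = (\<lambda>t. real n * bessel_J n t / t - bessel_J (n + 1) t)"
  have "(g has_integral (bessel_J n (real n) - bessel_J n 0)) {0..real n}"
  proof (rule fundamental_theorem_of_calculus_interior)
    show "continuous_on {0..real n} (bessel_J n)" by (intro continuous_intros)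
    show "(bessel_J n has_vector_derivative g t) (at t)" if "t \<in> {0<..<real n}" for t
      using bessel_J_deriv[of t n] that unfolding g_def
      by (simp add: has_real_derivative_iff_has_vector_derivative)
  qed simp
  then have g: "((\<lambda>t. 4 * h ^ 4 * g t) has_integral (4 * h ^ 4 * bessel_J n (real n))) {0..real n}"
    using has_integral_mult_right[of g _ _ "4 * h ^ 4"] bessel_J_at_0[OF n] by simp
  have f: "((\<lambda>t. t * \<bar>bessel_J n t\<bar>) has_integral integral {0..real n} (\<lambda>t. t * \<bar>bessel_J n t\<bar>)) {0..real n}"
    by (intro integrable_integral integrable_continuous_interval continuous_intros)
  have "integral {0..real n} (\<lambda>t. t * \<bar>bessel_J n t\<bar>) \<le> 4 * h ^ 4 * bessel_J n (real n)"
  proof (rule has_integral_le[OF f g])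
    fix t assume t: "t \<in> {0..real n}"
    show "t * \<bar>bessel_J n t\<bar> \<le> 4 * h ^ 4 * g t"
    proof (cases "t = 0")
      case True then show ?thesis using bessel_J_at_0[of "n + 1"] by (simp add: g_def)
    next
      case False
      then have t0: "0 < t" "t \<le> real n" using t by auto
      define s where "s = ln t"
      have s: "s \<le> ln (real n)" "exp s = t" using t0 by (simp_all add: s_def)
      have W: "wave n s > 0" "wave n (ln (real n)) > 0" using wave_pos_before_turning[OF n] s by auto
      have "h\<^sup>2 / 4 \<le> slope n (ln (real n)) / wave n (ln (real n))"
        using log_deriv_lower[OF n] W(2) by (simp add: h_def pos_le_divide_eq)
      also have "\<dots> \<le> slope n s / wave n s" by (rule log_deriv_mono[OF n s(1) order_refl])
      finally have "h\<^sup>2 / 4 * wave n s \<le> slope n s" using W(1) by (simp add: pos_le_divide_eq)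
      moreover have "slope n s = t * g t" using t0 by (simp add: slope_def s g_def field_simps)
      moreover have "wave n s = bessel_J n t" by (simp add: wave_def s)
      ultimately have J: "bessel_J n t > 0" "h\<^sup>2 * bessel_J n t \<le> 4 * (t * g t)" using W by auto
      then have "0 < h\<^sup>2 * bessel_J n t" using h(1) by simp
      then have "0 < t * g t" using J(2) by linarith
      then have gpos: "g t \<ge> 0" using t0 by (simp add: zero_less_mult_iff)
      have "h\<^sup>2 * (t * bessel_J n t) = t * (h\<^sup>2 * bessel_J n t)" by simp
      also have "\<dots> \<le> t * (4 * (t * g t))" using J t0 by (intro mult_left_mono) auto
      also have "\<dots> = 4 * g t * t\<^sup>2" by (simp add: power2_eq_square)
      also have "\<dots> \<le> 4 * g t * (real n)\<^sup>2" using t0 gpos by (intro mult_left_mono power_mono) auto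
      also have "(real n)\<^sup>2 = h\<^sup>2 * h ^ 4" unfolding h(2)[symmetric] by (simp add: eval_nat_numeral)
      finally have "h\<^sup>2 * (t * bessel_J n t) \<le> h\<^sup>2 * (4 * h ^ 4 * g t)" by (simp add: mult_ac)
      moreover have "h\<^sup>2 > 0" using h(1) by simp
      ultimately have "t * bessel_J n t \<le> 4 * h ^ 4 * g t" by (simp only: mult_le_cancel_left_pos)
      then show ?thesis using J(1) by simp
    qed
  qed
  then show ?thesis by (simp add: h_def)
qed

lemma linear_integral: "a \<le> b \<Longrightarrow> ((\<lambda>t. M * t) has_integral M * (b\<^sup>2 - a\<^sup>2) / 2) {a..b::real}"
proof -
  assume "a \<le> b"
  then have "((\<lambda>t. M * t) has_integral (M * b\<^sup>2 / 2 - M * a\<^sup>2 / 2)) {a..b}"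
    by (intro fundamental_theorem_of_calculus)
       (auto intro!: derivative_eq_intros simp flip: has_real_derivative_iff_has_vector_derivative)
  then show ?thesis by (simp add: algebra_simps diff_divide_distrib)
qed

lemma one_minus_exp_lower:
  fixes d :: real
  assumes "0 \<le> d"
  shows "d * exp (- d) \<le> 1 - exp (- d)"
proof -
  have "exp (- d) * (1 + d) \<le> exp (- d) * exp d" by (intro mult_left_mono exp_ge_add_one_self) auto
  then show ?thesis by (simp add: algebra_simps flip: exp_add)
qed

text \<open>For \<open>n \<ge> 1\<close> the oscillation starts at the first crest, the first zero of the
  slope. There the energy is \<open>Q w\<^sup>2\<close>, which relates the height of the crest to the
  amplitude.\<close>

lemma turning_data_pos:
  assumes n: "n \<ge> 1"
  defines "C0 \<equiv> (6 * pi + 1) * exp (6 * pi)"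
  shows "\<exists>s0 s1. turning_data (8 + 2 * C0 + C0 * exp 4) n s0 s1"
proof -
  define h where "h = cbrt_n n"
  have h: "h \<ge> 1" "h ^ 3 = real n" using cbrt_n_ge_1 cbrt_n_cube_pos[OF n] by (simp_all add: h_def)
  have n2: "(real n)\<^sup>2 = h\<^sup>2 * h ^ 4" unfolding h(2)[symmetric] by (simp add: eval_nat_numeral)
  have C0: "C0 \<ge> 1"
  proof -
    have "1 * 1 \<le> (6 * pi + 1) * exp (6 * pi)" by (intro mult_mono) (auto simp: pi_ge_zero)
    then show ?thesis by (simp add: C0_def)
  qed
  define C where "C = 8 + 2 * C0 + C0 * exp 4"
  have e4: "exp 4 > (0::real)" by simp
  have C: "C \<ge> 8 + 2 * C0" "C \<ge> C0 * exp 4" "C \<ge> 10" "C > 0" 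
  proof -
    have "0 \<le> C0 * exp 4" using C0 by simp
    then show "C \<ge> 8 + 2 * C0" "C \<ge> C0 * exp 4" "C \<ge> 10" "C > 0" using C0 unfolding C_def by linarith+
  qed
  obtain s1 where s1: "slope n s1 = 0" "\<And>x. x < s1 \<Longrightarrow> slope n x > 0" "ln (real n) < s1" "potential n s1 \<le> C0 * h ^ 4"
    using first_slope_zero[OF n] unfolding C0_def h_def by metis
  have Ql: "h ^ 4 / 2 < potential n s1" using slope_zero_lower[OF n s1(1,2)] by (simp add: h_def)
  have Wpos: "wave n x > 0" if "x \<le> s1" for x using that s1(2) by (intro wave_pos_if_slope_pos) auto
  define M where "M = wave n s1"
  define S where "S = sqrt (potential n s1)"
  define a where "a = sqrt (amplitude_sq n s1)"
  have h4: "h ^ 4 \<ge> 1" using h(1) by simp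
  have Qpos: "potential n s1 > 0" using Ql h4 by linarith
  then have S: "S > 0" "S\<^sup>2 = potential n s1" by (simp_all add: S_def)
  have M: "M > 0" using Wpos by (simp add: M_def)
  have WM: "wave n s \<le> M" if "s \<le> s1" for s
    using bessel_J_pos_below_turning(2)[OF n s1(2), of s1 "exp s"] that by (simp add: M_def wave_def)
  have en: "amplitude_sq n s1 = S * M\<^sup>2"
    unfolding amplitude_sq_def energy_def s1(1) S_def[symmetric] M_def[symmetric] S(2)[symmetric]
    using S(1) by (simp add: power2_eq_square)
  have Sl: "h\<^sup>2 / 4 \<le> S"
  proof (rule power2_le_imp_le)
    have "(h\<^sup>2 / 4)\<^sup>2 = h ^ 4 / 16" by (simp add: power_divide flip: power_mult)
    also have "\<dots> \<le> S\<^sup>2" using Ql h4 unfolding S(2) by linarith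
    finally show "(h\<^sup>2 / 4)\<^sup>2 \<le> S\<^sup>2" .
  qed (use S in simp)
  have Su: "S \<le> C0 * h\<^sup>2"
  proof (rule power2_le_imp_le)
    have "C0 * 1 \<le> C0 * C0" using C0 by (intro mult_left_mono) auto
    then have "C0 * h ^ 4 \<le> C0\<^sup>2 * h ^ 4" using h4 by (intro mult_right_mono) (auto simp: power2_eq_square)
    also have "\<dots> = (C0 * h\<^sup>2)\<^sup>2" by (simp add: power_mult_distrib flip: power_mult)
    finally show "S\<^sup>2 \<le> (C0 * h\<^sup>2)\<^sup>2" using s1(4) unfolding S(2) by linarith
  qed (use C0 in simp)
  have aa: "a\<^sup>2 = S * M\<^sup>2" "a \<ge> 0" unfolding a_def using en S by (simp_all add: amplitude_sq_def)
  have Mh: "M * h \<le> 2 * a"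
  proof (rule power2_le_imp_le)
    have "(M * h)\<^sup>2 = (h\<^sup>2) * M\<^sup>2" by (simp add: power_mult_distrib)
    also have "\<dots> \<le> (4 * S) * M\<^sup>2" using Sl by (intro mult_right_mono) auto
    finally show "(M * h)\<^sup>2 \<le> (2 * a)\<^sup>2" by (simp add: power_mult_distrib aa)
  qed (use aa in simp)
  have aM: "a \<le> C0 * (M * h)"
  proof (rule power2_le_imp_le)
    have "a\<^sup>2 \<le> (C0 * h\<^sup>2) * M\<^sup>2" unfolding aa using Su by (intro mult_right_mono) auto
    also have "\<dots> \<le> C0\<^sup>2 * (h\<^sup>2 * M\<^sup>2)"
    proof -
      have "C0 * 1 \<le> C0 * C0" using C0 by (intro mult_left_mono) auto
      then have "C0 * (h\<^sup>2 * M\<^sup>2) \<le> C0\<^sup>2 * (h\<^sup>2 * M\<^sup>2)" by (intro mult_right_mono) (auto simp: power2_eq_square)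
      then show ?thesis by (simp add: mult_ac)
    qed
    finally show "a\<^sup>2 \<le> (C0 * (M * h))\<^sup>2" by (simp add: power_mult_distrib mult_ac)
  qed (use C0 M h in simp)
  \<comment> \<open>At the crest the wave looks like a cosine of frequency \<open>S\<close>, so it stays above half of its height on an interval of length \<open>1/S\<close>.\<close>
  define \<delta> where "\<delta> = 1 / S"
  have h2: "h\<^sup>2 \<ge> 1" using h(1) by simp
  have d: "\<delta> > 0" "\<delta> \<ge> 1 / (C0 * h\<^sup>2)" "\<delta> \<le> 4"
  proof -
    show "\<delta> > 0" using S by (simp add: \<delta>_def)
    show "\<delta> \<ge> 1 / (C0 * h\<^sup>2)" unfolding \<delta>_def using Su S C0 h2 by (intro divide_left_mono) auto
    have "1 / 4 \<le> S" using Sl h2 by linarith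
    then show "\<delta> \<le> 4" using S(1) by (simp add: \<delta>_def field_simps)
  qed
  define s0 where "s0 = s1 - \<delta>"
  have bump: "M / 2 \<le> wave n s" if s: "s0 \<le> s" "s \<le> s1" for s
  proof -
    have QW: "potential n y * wave n y \<le> S\<^sup>2 * M" if y: "y \<le> s1" for y
    proof (cases "potential n y \<ge> 0")
      case True
      then show ?thesis using WM[OF y] Wpos[OF y] potential_mono[OF y, of n] unfolding S(2)
        by (intro mult_mono) auto
    next
      case False
      then have "potential n y * wave n y \<le> 0" using Wpos[OF y] by (simp add: mult_nonpos_nonneg)
      also have "0 \<le> S\<^sup>2 * M" using M by simp
      finally show ?thesis .
    qed
    \<comment> \<open>Two integrations of \<open>w'' \<ge> - S\<^sup>2 M\<close> backwards from the crest.\<close>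
    define f where "f = (\<lambda>y. slope n y - S\<^sup>2 * M * (s1 - y))"
    have V: "f x \<le> f s1" if "x \<le> s1" for x
    proof (rule DERIV_nonneg_imp_nondecreasing[where f = f, OF that])
      fix y assume y: "x \<le> y" "y \<le> s1"
      have "(f has_real_derivative (- potential n y * wave n y - S\<^sup>2 * M * (0 - 1))) (at y)"
        unfolding f_def by (intro DERIV_diff slope_deriv DERIV_cmult DERIV_const DERIV_ident)
      then show "\<exists>z. (f has_real_derivative z) (at y) \<and> 0 \<le> z"
        using QW[OF y(2)] by (intro exI[of _ "- potential n y * wave n y - S\<^sup>2 * M * (0 - 1)"]) simp
    qed
    define g where "g = (\<lambda>y. wave n y + S\<^sup>2 * M / 2 * (s1 - y)\<^sup>2)"
    have "g s1 \<le> g s"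
    proof (rule DERIV_nonpos_imp_nonincreasing[where f = g, OF s(2)])
      fix y assume y: "s \<le> y" "y \<le> s1"
      have "((\<lambda>y. (s1 - y)\<^sup>2) has_real_derivative 2 * (s1 - y) * (0 - 1)) (at y)"
        by (rule derivative_eq_intros refl | simp)+
      then have "(g has_real_derivative (slope n y + S\<^sup>2 * M / 2 * (2 * (s1 - y) * (0 - 1)))) (at y)"
        unfolding g_def by (intro DERIV_add wave_deriv DERIV_cmult)
      moreover have "slope n y + S\<^sup>2 * M / 2 * (2 * (s1 - y) * (0 - 1)) = f y" by (simp add: f_def field_simps)
      moreover have "f y \<le> 0" using V[OF y(2)] s1(1) by (simp add: f_def)
      ultimately show "\<exists>z. (g has_real_derivative z) (at y) \<and> z \<le> 0" by metis
    qed
    then have "M \<le> wave n s + S\<^sup>2 * M / 2 * (s1 - s)\<^sup>2" by (simp add: g_def M_def)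
    also have "S\<^sup>2 * M / 2 * (s1 - s)\<^sup>2 \<le> S\<^sup>2 * M / 2 * (1 / S)\<^sup>2"
      using s M by (intro mult_left_mono power_mono) (auto simp: s0_def \<delta>_def)
    also have "S\<^sup>2 * M / 2 * (1 / S)\<^sup>2 = M / 2" using S(1) by (simp add: power_divide)
    finally show ?thesis by simp
  qed
  have int: "integral {0..exp s1} (\<lambda>t. t * \<bar>bessel_J n t\<bar>) \<le> (4 + C0) * h ^ 4 * M"
  proof -
    have "exp (ln (real n)) < exp s1" using s1(3) by (simp only: exp_less_cancel_iff)
    then have es1: "real n < exp s1" using n by simp
    have io: "(\<lambda>t. t * \<bar>bessel_J n t\<bar>) integrable_on {u..v}" for u v :: real
      by (intro integrable_continuous_interval continuous_intros)
    have "integral {0..real n} (\<lambda>t. t * \<bar>bessel_J n t\<bar>) \<le> 4 * h ^ 4 * bessel_J n (real n)"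
      using bessel_J_integral_below_n[OF n] by (simp add: h_def)
    also have "\<dots> \<le> 4 * h ^ 4 * M"
      using bessel_J_pos_below_turning(2)[OF n s1(2), of s1 "real n"] es1 n h(1)
      by (intro mult_left_mono) (auto simp: M_def)
    finally have 1: "integral {0..real n} (\<lambda>t. t * \<bar>bessel_J n t\<bar>) \<le> 4 * h ^ 4 * M" .
    have "integral {real n..exp s1} (\<lambda>t. t * \<bar>bessel_J n t\<bar>) \<le> M * ((exp s1)\<^sup>2 - (real n)\<^sup>2) / 2"
    proof (rule has_integral_le[OF integrable_integral[OF io] linear_integral])
      fix t assume t: "t \<in> {real n..exp s1}"
      then have "bessel_J n t > 0" "bessel_J n t \<le> M"
        using bessel_J_pos_below_turning[OF n s1(2), of s1 t] n by (auto simp: M_def)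
      then show "t * \<bar>bessel_J n t\<bar> \<le> M * t" using t n by (simp add: mult.commute mult_right_mono)
    qed (use es1 in simp)
    also have "\<dots> = M * potential n s1 / 2" by (simp add: potential_def)
    also have "\<dots> \<le> M * (C0 * h ^ 4) / 2" using s1(4) M by (intro divide_right_mono mult_left_mono) auto
    also have "\<dots> \<le> C0 * h ^ 4 * M" using M C0 h4 by simp
    finally have 2: "integral {real n..exp s1} (\<lambda>t. t * \<bar>bessel_J n t\<bar>) \<le> C0 * h ^ 4 * M" .
    have "integral {0..exp s1} (\<lambda>t. t * \<bar>bessel_J n t\<bar>)
        = integral {0..real n} (\<lambda>t. t * \<bar>bessel_J n t\<bar>) + integral {real n..exp s1} (\<lambda>t. t * \<bar>bessel_J n t\<bar>)"
      using es1 by (intro Henstock_Kurzweil_Integration.integral_combine[symmetric] io) auto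
    then show ?thesis using 1 2 by (simp add: algebra_simps)
  qed
  have "turning_data C n s0 s1"
    unfolding turning_data_def h_def[symmetric] a_def[symmetric]
  proof (intro conjI allI ballI impI)
    show "s0 \<le> s1" using d by (simp add: s0_def)
    have "h ^ 4 \<le> 2 * potential n s1" using Ql by simp
    also have "\<dots> \<le> C * potential n s1" using C Qpos by (intro mult_right_mono) auto
    finally show "h ^ 4 \<le> C * potential n s1" .
    have "C0 * h ^ 4 \<le> C * h ^ 4" using C(1) C0 h4 by (intro mult_right_mono) auto
    then show "potential n s1 \<le> C * h ^ 4" using s1(4) by linarith
    show "slope n s \<noteq> 0" if "s < s1" for s using s1(2)[OF that] by simp
    show "wave n s \<noteq> 0" if "s < s1" for s using Wpos[of s] that by simp
    show "\<bar>wave n s\<bar> * h \<le> C * a" if "s \<le> s1" for s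
    proof -
      have "\<bar>wave n s\<bar> * h \<le> M * h" using WM[OF that] Wpos[OF that] h by (intro mult_right_mono) auto
      also have "\<dots> \<le> 2 * a" by (rule Mh)
      also have "\<dots> \<le> C * a" using C aa by (intro mult_right_mono) auto
      finally show ?thesis .
    qed
    have "(4 + C0) * h ^ 4 * M = (4 + C0) * h ^ 3 * (M * h)" by (simp add: eval_nat_numeral)
    also have "\<dots> \<le> (4 + C0) * h ^ 3 * (2 * a)" using Mh C0 h(1) by (intro mult_left_mono) auto
    also have "\<dots> = (8 + 2 * C0) * (a * h ^ 3)" by (simp add: algebra_simps)
    also have "\<dots> \<le> C * (a * h ^ 3)" using C aa h(1) by (intro mult_right_mono) auto
    finally show "integral {0..exp s1} (\<lambda>t. t * \<bar>bessel_J n t\<bar>) \<le> C * (a * h ^ 3)" using int by linarith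
    show "a \<le> C * (\<bar>wave n s\<bar> * h)" if "s \<in> {s0..s1}" for s
    proof -
      have "M \<le> 2 * wave n s" using bump[of s] that by simp
      then have "C0 * (M * h) \<le> C0 * ((2 * wave n s) * h)" using C0 h by (intro mult_left_mono mult_right_mono) auto
      also have "\<dots> = (2 * C0) * (\<bar>wave n s\<bar> * h)" using Wpos[of s] that by simp
      also have "\<dots> \<le> C * (\<bar>wave n s\<bar> * h)" using C h by (intro mult_right_mono) auto
      finally show ?thesis using aM by linarith
    qed
    show "h ^ 4 \<le> C * ((exp s1)\<^sup>2 - (exp s0)\<^sup>2)"
    proof -
      have "exp (ln (real n)) < exp s1" using s1(3) by (simp only: exp_less_cancel_iff)
      then have es1: "real n \<le> exp s1" using n by simp
      define D where "D = 1 / (C0 * h\<^sup>2)"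
      have D: "0 \<le> D" "D \<le> \<delta>" using d C0 by (auto simp: D_def)
      have "1 * 1 \<le> C0 * h\<^sup>2" using C0 h2 by (intro mult_mono) auto
      then have D1: "D \<le> 1" by (simp add: D_def)
      have "exp s0 = exp s1 * exp (- \<delta>)" by (simp add: s0_def flip: exp_add)
      then have "(exp s0)\<^sup>2 = (exp s1)\<^sup>2 * exp (- 2 * \<delta>)" by (simp add: power_mult_distrib exp_double[symmetric])
      also have "\<dots> \<le> (exp s1)\<^sup>2 * exp (- D)" using D d(1) by (intro mult_left_mono) auto
      finally have "(exp s1)\<^sup>2 - (exp s0)\<^sup>2 \<ge> (exp s1)\<^sup>2 * (1 - exp (- D))" by (simp add: algebra_simps)
      moreover have "(real n)\<^sup>2 * (D * exp (- 4)) \<le> (exp s1)\<^sup>2 * (1 - exp (- D))"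
      proof (intro mult_mono power_mono es1)
        have "D * exp (- 4) \<le> D * exp (- D)" using D D1 by (intro mult_left_mono) auto
        then show "D * exp (- 4) \<le> 1 - exp (- D)" using one_minus_exp_lower[OF D(1)] by linarith
      qed (use D in auto)
      moreover have "(C0 * exp 4) * ((real n)\<^sup>2 * (D * exp (- 4))) = h ^ 4"
      proof -
        have "exp 4 * exp (- 4) = (1::real)" by (simp flip: exp_add)
        moreover have "C0 * h\<^sup>2 * D = 1" using C0 h2 h(1) by (simp add: D_def)
        moreover have "(C0 * x) * ((y * z) * (w * v)) = (C0 * y * w) * (x * v) * z" for x y z w v :: real
          by (simp add: mult_ac)
        ultimately show ?thesis unfolding n2 by (simp only: mult_1)
      qed
      moreover have "0 \<le> C0 * exp 4" using C0 by simp
      ultimately have "h ^ 4 \<le> (C0 * exp 4) * ((exp s1)\<^sup>2 - (exp s0)\<^sup>2)"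
        using mult_left_mono[of "(real n)\<^sup>2 * (D * exp (- 4))" "(exp s1)\<^sup>2 - (exp s0)\<^sup>2" "C0 * exp 4"] by linarith
      also have "\<dots> \<le> C * ((exp s1)\<^sup>2 - (exp s0)\<^sup>2)"
        using C d by (intro mult_right_mono) (auto simp: s0_def power_mono)
      finally show ?thesis .
    qed
  qed
  then show ?thesis unfolding C_def by blast
qed

text \<open>For \<open>n = 0\<close> there is no turning point; any point near the origin serves, since
  uniformity is not an issue for a single function.\<close>

lemma turning_data_zero: "\<exists>C>0. \<exists>s0 s1. turning_data C 0 s0 s1"
proof -
  have "bessel_G 0 0 = 1" unfolding bessel_G_def by (subst powser_zero) simp
  then have J0: "bessel_J 0 0 = 1" by (simp add: bessel_J_eq_G)
  have "isCont (bessel_J 0) 0"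
    using bessel_J_cont[of UNIV "\<lambda>x. x" 0] by (simp add: continuous_on_eq_continuous_at)
  then have "\<forall>\<^sub>F t in at 0. bessel_J 0 t > 1 / 2"
    unfolding isCont_def J0 by (rule order_tendstoD(1)) simp
  moreover have "filterlim (exp::real\<Rightarrow>real) (at 0) at_bot" by (simp add: filterlim_at exp_at_bot)
  ultimately have "\<forall>\<^sub>F s in at_bot. wave 0 s > 1 / 2" unfolding wave_def by (rule eventually_compose_filterlim)
  then obtain s2 where s2: "\<And>s. s \<le> s2 \<Longrightarrow> wave 0 s > 1 / 2" unfolding eventually_at_bot_linorder by blast
  obtain s3 where s3: "\<And>s. s \<le> s3 \<Longrightarrow> wave 1 s > 0" using wave_pos_near by blast
  define s1 where "s1 = min s2 s3"
  define s0 where "s0 = s1 - 1"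
  have W: "wave 0 s > 1 / 2" if "s \<le> s1" for s using s2 that by (simp add: s1_def)
  have V: "slope 0 s < 0" if "s \<le> s1" for s
    using s3[of s] that by (simp add: s1_def slope_def wave_def)
  have h: "cbrt_n 0 = 1" by (simp add: cbrt_n_def)
  have W1: "wave 0 s \<le> 1" if "s \<le> s1" for s
  proof -
    have "bessel_J 0 (exp s) \<le> bessel_J 0 0"
    proof (rule DERIV_nonpos_imp_decreasing_open[where f = "bessel_J 0"])
      show "\<exists>y. (bessel_J 0 has_real_derivative y) (at x) \<and> y \<le> 0" if "0 < x" "x < exp s" for x
      proof -
        have "ln x \<le> s1" using that \<open>s \<le> s1\<close> by (metis exp_ln exp_less_cancel_iff less_imp_le less_le_trans not_le)
        then have "bessel_J 1 x > 0" using s3[of "ln x"] that by (simp add: s1_def wave_def)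
        then show ?thesis using bessel_J_deriv[OF that(1), of 0] by (intro exI conjI) auto
      qed
    qed (use bessel_J_cont[of _ "\<lambda>x. x" 0] in auto)
    then show ?thesis by (simp add: J0 wave_def)
  qed
  define a where "a = sqrt (amplitude_sq 0 s1)"
  have Q: "potential 0 s1 > 0" by (simp add: potential_def)
  then have a: "a > 0" by (simp add: a_def amplitude_sq_pos)
  define I where "I = integral {0..exp s1} (\<lambda>t. t * \<bar>bessel_J 0 t\<bar>)"
  define C where "C = 1 / potential 0 s1 + potential 0 s1 + 1 / a + \<bar>I\<bar> / a + 2 * a + 1 / ((exp s1)\<^sup>2 - (exp s0)\<^sup>2)"
  have d: "(exp s1)\<^sup>2 - (exp s0)\<^sup>2 > 0" by (simp add: s0_def power_strict_mono)
  have C: "C \<ge> 1 / potential 0 s1" "C \<ge> potential 0 s1" "C \<ge> 1 / a" "C \<ge> \<bar>I\<bar> / a" "C \<ge> 2 * a"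
     "C \<ge> 1 / ((exp s1)\<^sup>2 - (exp s0)\<^sup>2)" "C > 0"
  proof -
    have "1 / potential 0 s1 > 0" "potential 0 s1 > 0" "1 / a > 0" "\<bar>I\<bar> / a \<ge> 0" "2 * a > 0" "1 / ((exp s1)\<^sup>2 - (exp s0)\<^sup>2) > 0"
      using Q a d by auto
    then show "C \<ge> 1 / potential 0 s1" "C \<ge> potential 0 s1" "C \<ge> 1 / a" "C \<ge> \<bar>I\<bar> / a" "C \<ge> 2 * a"
     "C \<ge> 1 / ((exp s1)\<^sup>2 - (exp s0)\<^sup>2)" "C > 0" unfolding C_def by linarith+
  qed
  have "turning_data C 0 s0 s1"
    unfolding turning_data_def h a_def[symmetric] I_def[symmetric]
  proof (intro conjI allI ballI impI)
    show "s0 \<le> s1" by (simp add: s0_def)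
    show "1 ^ 4 \<le> C * potential 0 s1" using C(1) Q by (simp add: pos_divide_le_eq)
    show "potential 0 s1 \<le> C * 1 ^ 4" using C by simp
    show "wave 0 s \<noteq> 0" "slope 0 s \<noteq> 0" if "s < s1" for s using W[of s] V[of s] that by auto
    show "\<bar>wave 0 s\<bar> * 1 \<le> C * a" if "s \<le> s1" for s
    proof -
      have "1 \<le> C * a" using C(3) a by (simp add: pos_divide_le_eq)
      then show ?thesis using W[OF that] W1[OF that] by simp
    qed
    show "I \<le> C * (a * 1 ^ 3)" using C(4) a by (simp add: pos_divide_le_eq)
    show "a \<le> C * (\<bar>wave 0 s\<bar> * 1)" if "s \<in> {s0..s1}" for s
    proof -
      have "2 * a * (1 / 2) \<le> C * wave 0 s" using C(5) W[of s] that a by (intro mult_mono) auto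
      then show ?thesis using W[of s] that by simp
    qed
    show "1 ^ 4 \<le> C * ((exp s1)\<^sup>2 - (exp s0)\<^sup>2)" using C(6) d by (simp add: pos_divide_le_eq)
  qed
  then show ?thesis using C(7) by blast
qed

lemma turning_data_uniform: "\<exists>C\<ge>1. \<forall>n. \<exists>s0 s1. turning_data C n s0 s1"
proof -
  define C0 where "C0 = (6 * pi + 1) * exp (6 * pi)"
  define C1 where "C1 = 8 + 2 * C0 + C0 * exp 4"
  have "C0 \<ge> 0" by (simp add: C0_def)
  then have C1: "C1 \<ge> 8" by (simp add: C1_def)
  obtain C2 s0 s1 where C2: "C2 > 0" "turning_data C2 0 s0 s1" using turning_data_zero by blast
  have "\<exists>s0 s1. turning_data (max C1 C2) n s0 s1" for n
  proof (cases "n = 0")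
    case True
    then show ?thesis using turning_data_mono[OF C2(2,1), of "max C1 C2"] by auto
  next
    case False
    then obtain u v where "turning_data C1 n u v"
      using turning_data_pos[of n] unfolding C1_def C0_def by auto
    then show ?thesis using turning_data_mono[of C1 n u v "max C1 C2"] C1 by auto
  qed
  then show ?thesis using C1 by (intro exI[of _ "max C1 C2"]) auto
qed

section \<open>Rotations of the plane\<close>

lemma scaled_ball_preimage:
  fixes c z :: complex
  assumes "cmod c = 1"
  shows "(\<lambda>w. c * w) -` ball (c * z) r = ball z r"
proof -
  have "dist (c * z) (c * w) = dist z w" for w
    using assms by (simp add: dist_norm norm_mult flip: right_diff_distrib)
  then show ?thesis by auto
qed

text \<open>By Vitali's covering theorem an open set is, up to a null set, a disjoint union of countably many
  balls, and a rotation maps them to disjoint balls of the same measure. Applied to the inverse rotation as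
  well, this yields equality.\<close>

lemma emeasure_rotation_le:
  fixes c :: complex
  assumes c: "cmod c = 1" and U: "open U"
  shows "emeasure lborel U \<le> emeasure lborel ((\<lambda>w. inverse c * w) -` U)"
proof -
  let ?f = "\<lambda>w. inverse c * w"
  have ci: "cmod (inverse c) = 1" using c by (simp add: norm_inverse)
  have c0: "c \<noteq> 0" using c by auto
  define K where "K = {(z::complex, r::real). 0 < r \<and> ball z r \<subseteq> U}"
  obtain \<C> where "countable \<C>" "\<C> \<subseteq> K"
    and disj: "pairwise (\<lambda>i j. disjnt (ball (fst i) (snd i)) (ball (fst j) (snd j))) \<C>"
    and neg: "negligible (U - (\<Union>i\<in>\<C>. ball (fst i) (snd i)))"
  proof (rule Vitali_covering_theorem_balls[of U K fst snd])
    fix x :: complex and d :: real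
    assume x: "x \<in> U" "0 < d"
    then obtain e where "e > 0" "ball x e \<subseteq> U" using U open_contains_ball by blast
    then show "\<exists>i. i \<in> K \<and> x \<in> ball (fst i) (snd i) \<and> snd i < d"
      using x by (intro exI[of _ "(x, min e (d / 2))"]) (auto simp: K_def)
  qed auto
  let ?B = "\<lambda>i. ball (fst i) (snd i)"
  have sub: "(\<Union>i\<in>\<C>. ?B i) \<subseteq> U"
  proof (rule UN_least)
    fix i assume "i \<in> \<C>"
    then have "i \<in> K" using \<open>\<C> \<subseteq> K\<close> by blast
    then show "?B i \<subseteq> U" by (simp add: K_def split_beta)
  qed
  have dj: "disjoint_family_on ?B \<C>"
    using disj by (auto simp: disjoint_family_on_def pairwise_def disjnt_def)
  have meas: "(\<Union>i\<in>\<C>. ?B i) \<in> sets lborel" by (intro sets.countable_UN'[OF \<open>countable \<C>\<close>]) auto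
  have "emeasure lborel U \<le> emeasure lborel ((\<Union>i\<in>\<C>. ?B i) \<union> (U - (\<Union>i\<in>\<C>. ?B i)))"
    using U meas by (intro emeasure_mono) auto
  also have "\<dots> \<le> emeasure lborel (\<Union>i\<in>\<C>. ?B i) + emeasure lborel (U - (\<Union>i\<in>\<C>. ?B i))"
    using U meas by (intro emeasure_subadditive) auto
  also have "emeasure lborel (U - (\<Union>i\<in>\<C>. ?B i)) = 0"
    using neg U meas by (auto simp: negligible_iff_null_sets null_sets_def emeasure_completion)
  also have "emeasure lborel (\<Union>i\<in>\<C>. ?B i) = (\<integral>\<^sup>+i. emeasure lborel (?B i) \<partial>count_space \<C>)"
    by (intro emeasure_UN_countable[OF _ \<open>countable \<C>\<close> dj]) auto
  also have "\<dots> = (\<integral>\<^sup>+i. emeasure lborel (?f -` ?B i) \<partial>count_space \<C>)"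
  proof (intro nn_integral_cong)
    fix i assume "i \<in> space (count_space \<C>)"
    then have "0 < snd i" using \<open>\<C> \<subseteq> K\<close> by (auto simp: K_def)
    moreover have "?f -` ?B i = ball (c * fst i) (snd i)"
      using scaled_ball_preimage[OF ci, of "c * fst i" "snd i"] c0
      by (simp add: mult.assoc[symmetric])
    ultimately show "emeasure lborel (?B i) = emeasure lborel (?f -` ?B i)"
      by (simp add: emeasure_ball)
  qed
  also have "\<dots> = emeasure lborel (\<Union>i\<in>\<C>. ?f -` ?B i)"
  proof (rule emeasure_UN_countable[symmetric, OF _ \<open>countable \<C>\<close>])
    show "disjoint_family_on (\<lambda>i. ?f -` ?B i) \<C>" using dj unfolding disjoint_family_on_def by blast
    show "?f -` ?B i \<in> sets lborel" for i
      using measurable_sets_borel[of ?f borel "?B i"] by simp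
  qed
  also have "\<dots> \<le> emeasure lborel (?f -` U)"
    using sub U measurable_sets_borel[of ?f borel U] by (intro emeasure_mono) auto
  finally show ?thesis by simp
qed

lemma lborel_rotation:
  fixes c :: complex
  assumes c: "cmod c = 1"
  shows "distr lborel borel (\<lambda>w. c * w) = lborel"
proof (rule lborel_eqI[symmetric])
  fix l u :: complex
  assume lu: "\<And>b. b \<in> Basis \<Longrightarrow> l \<bullet> b \<le> u \<bullet> b"
  have c0: "c \<noteq> 0" using c by auto
  let ?U = "box l u"
  have ci: "cmod (inverse c) = 1" using c by (simp add: norm_inverse)
  have "open ((\<lambda>w. c * w) -` ?U)" by (intro open_vimage continuous_intros) auto
  from emeasure_rotation_le[OF c this]
  have "emeasure lborel ((\<lambda>w. c * w) -` ?U) \<le> emeasure lborel ?U"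
    using c0 by (simp add: vimage_def mult.assoc[symmetric])
  moreover have "emeasure lborel ?U \<le> emeasure lborel ((\<lambda>w. c * w) -` ?U)"
    using emeasure_rotation_le[OF ci open_box, of l u] by simp
  ultimately have "emeasure lborel ((\<lambda>w. c * w) -` ?U) = emeasure lborel ?U" by simp
  then show "emeasure (distr lborel borel (\<lambda>w. c * w)) ?U = (\<Prod>b\<in>Basis. (u - l) \<bullet> b)"
    using lu by (simp add: emeasure_distr emeasure_lborel_box)
qed simp

section \<open>Norms of separated functions on the disk\<close>

lemma cmod_measurable_disk: "cmod \<in> borel_measurable (lebesgue_on (ball 0 1))"
  by (intro measurable_restrict_space1 measurable_completion) simp

text \<open>The radius of a point of the unit disk has density \<open>2 \<pi> r\<close>, since a disk of
  radius \<open>x\<close> has area \<open>\<pi> x\<^sup>2\<close>. This replaces polar coordinates for radial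
  functions.\<close>

lemma radial_distr:
  "distr (lebesgue_on (ball (0::complex) 1)) borel cmod
     = density lborel (\<lambda>r. ennreal (2 * pi * r) * indicator {0..1} r)"
proof (rule measure_eqI_lessThan)
  note m = cmod_measurable_disk
  have dens: "emeasure (density lborel (\<lambda>r. ennreal (2 * pi * r) * indicator {0..1} r)) {x<..}
      = (if x < 0 then ennreal pi else if x \<le> 1 then ennreal (pi * (1 - x\<^sup>2)) else 0)" for x
  proof -
    have int: "(\<integral>\<^sup>+r. ennreal (2 * pi * r) * indicator {a..1} r \<partial>lborel) = ennreal (pi * (1 - a\<^sup>2))"
      if "0 \<le> a" "a \<le> 1" for a
    proof -
      have "(\<integral>\<^sup>+r. ennreal (2 * pi * r) * indicator {a..1} r \<partial>lborel) = ennreal (pi * 1\<^sup>2 - pi * a\<^sup>2)"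
        using that by (intro nn_integral_FTC_Icc) (auto intro!: derivative_eq_intros)
      then show ?thesis by (simp add: algebra_simps)
    qed
    have "emeasure (density lborel (\<lambda>r. ennreal (2 * pi * r) * indicator {0..1} r)) {x<..}
      = (\<integral>\<^sup>+r. ennreal (2 * pi * r) * indicator {0..1} r * indicator {x<..} r \<partial>lborel)"
      by (subst emeasure_density) auto
    also have "\<dots> = (\<integral>\<^sup>+r. ennreal (2 * pi * r) * indicator {max 0 x..1} r \<partial>lborel)"
      using AE_lborel_singleton[of x]
      by (intro nn_integral_cong_AE, elim AE_mp) (auto split: split_indicator simp: max_def)
    also have "\<dots> = (if x < 0 then ennreal pi else if x \<le> 1 then ennreal (pi * (1 - x\<^sup>2)) else 0)"
      using int[of "max 0 x"] by (auto simp: max_def)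
    finally show ?thesis .
  qed
  have dist: "emeasure (distr (lebesgue_on (ball (0::complex) 1)) borel cmod) {x<..}
      = (if x < 0 then ennreal pi else if x \<le> 1 then ennreal (pi * (1 - x\<^sup>2)) else 0)" for x
  proof -
    have ball: "emeasure lborel (ball (0::complex) 1) = ennreal pi"
      by (simp add: emeasure_ball unit_ball_vol_2)
    have "emeasure (distr (lebesgue_on (ball (0::complex) 1)) borel cmod) {x<..}
       = emeasure (lebesgue_on (ball (0::complex) 1)) (ball 0 1 - cball 0 x)"
      using m by (subst emeasure_distr) (auto intro!: arg_cong[where f = "emeasure _"])
    also have "\<dots> = emeasure lborel (ball (0::complex) 1 - cball 0 x)"
      by (subst emeasure_restrict_space) (auto simp: emeasure_completion)
    also have "\<dots> = (if x < 0 then ennreal pi else if x \<le> 1 then ennreal (pi * (1 - x\<^sup>2)) else 0)"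
    proof -
      consider "x < 0" | "0 \<le> x" "x < 1" | "x = 1" | "1 < x" by linarith
      then show ?thesis
      proof cases
        case 1
        then have "ball (0::complex) 1 - cball 0 x = ball 0 1" by auto
        then show ?thesis using 1 ball by simp
      next
        case 2
        then have "emeasure lborel (ball (0::complex) 1 - cball 0 x)
          = emeasure lborel (ball (0::complex) 1) - emeasure lborel (cball (0::complex) x)"
          by (intro emeasure_Diff) (auto simp: emeasure_cball)
        also have "\<dots> = ennreal pi - ennreal (pi * x\<^sup>2)"
          using 2 ball by (simp add: emeasure_cball unit_ball_vol_2)
        also have "\<dots> = ennreal (pi - pi * x\<^sup>2)" using 2 by (simp add: ennreal_minus)
        finally show ?thesis using 2 by (simp add: algebra_simps)
      next
        case 3
        then have "ball (0::complex) 1 - cball 0 x = {}" by auto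
        then show ?thesis by (simp only:) (use 3 in simp)
      next
        case 4
        then have "ball (0::complex) 1 - cball 0 x = {}" by auto
        then show ?thesis by (simp only:) (use 4 in simp)
      qed
    qed
    finally show ?thesis .
  qed
  show "emeasure (distr (lebesgue_on (ball (0::complex) 1)) borel cmod) {x<..} < \<infinity>" for x
    unfolding dist by simp
  show "emeasure (distr (lebesgue_on (ball (0::complex) 1)) borel cmod) {x<..}
     = emeasure (density lborel (\<lambda>r. ennreal (2 * pi * r) * indicator {0..1} r)) {x<..}" for x
    unfolding dist dens ..
qed simp_all

lemma radial_integral:
  fixes f :: "real \<Rightarrow> real"
  assumes f: "continuous_on UNIV f"
  shows "integrable (lebesgue_on (ball 0 1)) (\<lambda>z. f (cmod z))"
    and "(LINT z|lebesgue_on (ball 0 1). f (cmod z)) = 2 * pi * integral {0..1} (\<lambda>r. r * f r)"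
proof -
  have fm[measurable]: "f \<in> borel_measurable borel" using f by (rule borel_measurable_continuous_onI)
  have d: "density lborel (\<lambda>r. ennreal (2 * pi * r) * indicator {0..1} r)
      = density lborel (\<lambda>r. ennreal (2 * pi * r * indicator {0..1} r))"
    by (intro density_cong) (auto split: split_indicator)
  have c: "set_integrable lborel {0..1} (\<lambda>r. r * f r)"
    by (intro borel_integrable_atLeastAtMost' continuous_intros continuous_on_subset[OF f]) auto
  have eq: "(2 * pi * r * indicator {0..1} r) *\<^sub>R f r = (2 * pi) * (indicator {0..1} r *\<^sub>R (r * f r))" for r
    by simp
  have "integrable lborel (\<lambda>r. (2 * pi * r * indicator {0..1} r) *\<^sub>R f r)"
    unfolding eq using c by (simp add: set_integrable_def)
  then have "integrable (distr (lebesgue_on (ball (0::complex) 1)) borel cmod) f"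
    unfolding radial_distr d
    by (subst integrable_density) (auto split: split_indicator intro!: AE_I2)
  then show "integrable (lebesgue_on (ball 0 1)) (\<lambda>z. f (cmod z))"
    by (simp add: integrable_distr_eq[OF cmod_measurable_disk fm])
  have "(LINT z|lebesgue_on (ball 0 1). f (cmod z)) = (LINT r|distr (lebesgue_on (ball (0::complex) 1)) borel cmod. f r)"
    by (rule integral_distr[OF cmod_measurable_disk fm, symmetric])
  also have "\<dots> = (LINT r|lborel. (2 * pi * r * indicator {0..1} r) *\<^sub>R f r)"
    unfolding radial_distr d
    by (subst integral_density) (auto split: split_indicator intro!: AE_I2)
  also have "\<dots> = 2 * pi * (LINT r:{0..1}|lborel. r * f r)"
    unfolding eq set_lebesgue_integral_def by simp
  also have "(LINT r:{0..1}|lborel. r * f r) = integral {0..1} (\<lambda>r. r * f r)"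
    by (rule set_borel_integral_eq_integral[OF c])
  finally show "(LINT z|lebesgue_on (ball 0 1). f (cmod z)) = 2 * pi * integral {0..1} (\<lambda>r. r * f r)" .
qed

text \<open>The function \<open>cos (n\<theta>)\<close>, as the real part of a power. In this form it is Borel
  measurable and its behaviour under rotations is evident; it differs from the cosine at most at the
  origin.\<close>

definition angular :: "nat \<Rightarrow> complex \<Rightarrow> real" where
  "angular n z = Re (sgn z ^ n)"

lemma sgn_borel_measurable [measurable]: "(sgn :: complex \<Rightarrow> complex) \<in> borel_measurable borel"
  unfolding sgn_eq[abs_def] by measurable

lemma angular_measurable [measurable]: "angular n \<in> borel_measurable borel"
  unfolding angular_def[abs_def] by measurable

lemma angular_le_1: "\<bar>angular n z\<bar> \<le> 1"
proof -
  have "cmod (sgn z ^ n) \<le> 1" by (simp add: norm_power norm_sgn power_le_one)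
  then show ?thesis unfolding angular_def using abs_Re_le_cmod order_trans by blast
qed

text \<open>The two values are the real part and, up to sign, the imaginary part of the same number of modulus
  one.\<close>

lemma angular_quarter_turn:
  assumes n: "n \<ge> 1" and z: "z \<noteq> 0"
  shows "1 / 2 \<le> \<bar>angular n z\<bar> \<or> 1 / 2 \<le> \<bar>angular n (cis (pi / (2 * real n)) * z)\<bar>"
proof -
  define \<zeta> where "\<zeta> = sgn z ^ n"
  have "cis (pi / (2 * real n)) ^ n = \<i>" 
  proof -
    have "real n * (pi / (2 * real n)) = pi / 2" using n by simp
    then show ?thesis by (simp only: Complex.DeMoivre cis_pi_half)
  qed
  then have "sgn (cis (pi / (2 * real n)) * z) ^ n = \<i> * \<zeta>"
    by (simp add: \<zeta>_def sgn_mult power_mult_distrib sgn_cis)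
  then have 1: "angular n (cis (pi / (2 * real n)) * z) = - Im \<zeta>" "angular n z = Re \<zeta>"
    by (simp_all add: angular_def \<zeta>_def)
  have "cmod \<zeta> = 1" using z by (simp add: \<zeta>_def norm_power norm_sgn)
  then have 2: "(Re \<zeta>)\<^sup>2 + (Im \<zeta>)\<^sup>2 = 1" by (simp add: cmod_def)
  show ?thesis
  proof (rule ccontr)
    assume "\<not> ?thesis"
    then have "\<bar>Re \<zeta>\<bar> < 1 / 2" "\<bar>Im \<zeta>\<bar> < 1 / 2" using 1 by auto
    then have "(Re \<zeta>)\<^sup>2 < (1 / 2)\<^sup>2" "(Im \<zeta>)\<^sup>2 < (1 / 2)\<^sup>2"
      by (metis abs_ge_zero power2_abs power_strict_mono zero_less_numeral)+
    then show False using 2 by (simp add: power2_eq_square)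
  qed
qed

lemma unit_ball_borel [measurable]: "ball (0::complex) 1 \<in> sets borel"
  by simp

lemma disk_integral_lborel:
  fixes F :: "complex \<Rightarrow> real"
  assumes [measurable]: "F \<in> borel_measurable borel"
  shows "(LINT z|lebesgue_on (ball 0 1). F z) = (LINT z|lborel. indicator (ball 0 1) z *\<^sub>R F z)"
  by (subst integral_restrict_space) (auto intro!: integral_completion)

lemma disk_integral_rotation:
  fixes F :: "complex \<Rightarrow> real"
  assumes [measurable]: "F \<in> borel_measurable borel" and c: "cmod c = 1"
  shows "(LINT z|lebesgue_on (ball 0 1). F (c * z)) = (LINT z|lebesgue_on (ball 0 1). F z)"
proof -
  have "(LINT z|lebesgue_on (ball 0 1). F z) = (LINT z|distr lborel borel (\<lambda>w. c * w). indicator (ball 0 1) z *\<^sub>R F z)"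
    unfolding lborel_rotation[OF c] by (rule disk_integral_lborel) measurable
  also have "\<dots> = (LINT z|lborel. indicator (ball 0 1) (c * z) *\<^sub>R F (c * z))"
    by (rule integral_distr) measurable
  also have "\<dots> = (LINT z|lborel. indicator (ball 0 1) z *\<^sub>R F (c * z))"
    using c by (intro Bochner_Integration.integral_cong) (auto simp: norm_mult split: split_indicator)
  also have "\<dots> = (LINT z|lebesgue_on (ball 0 1). F (c * z))"
    by (rule disk_integral_lborel[symmetric]) measurable
  finally show ?thesis by simp
qed

lemma separated_function_measurable:
  assumes "continuous_on UNIV g"
  shows "(\<lambda>z. g (cmod z) * angular n z) \<in> borel_measurable borel"
proof -
  have [measurable]: "g \<in> borel_measurable borel" using assms by (rule borel_measurable_continuous_onI)
  show ?thesis by measurable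
qed

lemma disk_measurable: "F \<in> borel_measurable borel \<Longrightarrow> F \<in> borel_measurable (lebesgue_on (ball (0::complex) 1))"
  by (intro measurable_restrict_space1 measurable_completion) simp

text \<open>The sum of the integrand and of its rotation by a quarter period dominates a multiple of the
  radial function, and both have the same integral. This spares the integral of \<open>\<bar>cos
  (n\<theta>)\<bar>\<^sup>p\<close>. The hypothesis at \<open>0\<close> makes the origin harmless, where the
  angular factor vanishes.\<close>

lemma disk_norm_finite_bounds:
  fixes g :: "real \<Rightarrow> real"
  assumes g: "continuous_on UNIV g" and p: "1 \<le> p" and g0: "n \<ge> 1 \<Longrightarrow> g 0 = 0"
  defines "I \<equiv> integral {0..1} (\<lambda>r. r * \<bar>g r\<bar> powr p)"
    and "U \<equiv> LINT z|lebesgue_on (ball 0 1). \<bar>g (cmod z) * angular n z\<bar> powr p"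
  shows "U \<le> 2 * pi * I" "(1 / 2) powr p * (pi * I) \<le> U"
proof -
  define f where "f = (\<lambda>r. \<bar>g r\<bar> powr p)"
  have f: "continuous_on UNIV f" unfolding f_def using p g
    by (intro continuous_on_powr' continuous_intros) auto
  note rad = radial_integral[OF f]
  define u where "u = (\<lambda>z. \<bar>g (cmod z) * angular n z\<bar> powr p)"
  have [measurable]: "u \<in> borel_measurable borel"
    unfolding u_def using separated_function_measurable[OF g, of n] by measurable
  have uf: "u z \<le> f (cmod z)" for z
  proof -
    have "\<bar>g (cmod z) * angular n z\<bar> \<le> \<bar>g (cmod z)\<bar>"
      unfolding abs_mult using angular_le_1[of n z] by (simp add: mult_left_le)
    then show ?thesis unfolding u_def f_def using p by (intro powr_mono2) auto
  qed
  have u0: "0 \<le> u z" for z by (simp add: u_def)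
  have iu: "integrable (lebesgue_on (ball 0 1)) (\<lambda>z. u (c * z))" if "cmod c = 1" for c
  proof (rule Bochner_Integration.integrable_bound[OF rad(1)])
    show "(\<lambda>z. u (c * z)) \<in> borel_measurable (lebesgue_on (ball 0 1))"
      by (rule disk_measurable) measurable
    show "AE z in lebesgue_on (ball 0 1). norm (u (c * z)) \<le> norm (f (cmod z))"
      using uf u0 that by (intro AE_I2) (metis abs_of_nonneg mult_1 norm_mult order_trans real_norm_def)
  qed
  have R: "2 * pi * I = (LINT z|lebesgue_on (ball 0 1). f (cmod z))" by (subst rad(2)) (simp only: I_def f_def)
  have U: "U = (LINT z|lebesgue_on (ball 0 1). u z)" by (simp add: U_def u_def)
  show "U \<le> 2 * pi * I" unfolding R U using iu[of 1] rad(1) uf by (intro integral_mono) auto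
  show "(1 / 2) powr p * (pi * I) \<le> U"
  proof (cases "n \<ge> 1")
    case False
    then have "n = 0" by simp
    then have "u z = f (cmod z)" for z by (simp add: u_def f_def angular_def)
    then have "U = 2 * pi * I" unfolding R U by (intro Bochner_Integration.integral_cong) simp_all
    moreover have "U \<ge> 0" unfolding U by (rule integral_nonneg_AE) (simp add: u0)
    moreover have "(1 / 2) powr p \<le> (1::real)" using p by (simp add: powr_le1)
    ultimately have I0: "0 \<le> pi * I" and h: "(1 / 2) powr p \<le> (1::real)"
      by (simp_all add: mult.commute)
    have "(1 / 2) powr p * (pi * I) \<le> 1 * (pi * I)" by (rule mult_right_mono[OF h I0])
    then show ?thesis using I0 using \<open>U = 2 * pi * I\<close> by linarith
  next
    case True
    define c where "c = cis (pi / (2 * real n))"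
    have c: "cmod c = 1" by (simp add: c_def)
    have low: "(1 / 2) powr p * f (cmod z) \<le> u z + u (c * z)" for z
    proof (cases "z = 0")
      case True
      then show ?thesis using g0[OF \<open>n \<ge> 1\<close>] u0[of 0] by (simp add: f_def)
    next
      case False
      have *: "(1 / 2) powr p * f (cmod z) \<le> u w" if "cmod w = cmod z" "1 / 2 \<le> \<bar>angular n w\<bar>" for w
      proof -
        have "u w = \<bar>angular n w\<bar> powr p * f (cmod z)"
          unfolding u_def f_def abs_mult that(1) by (simp add: powr_mult mult.commute)
        moreover have "(1 / 2) powr p \<le> \<bar>angular n w\<bar> powr p" using that p by (intro powr_mono2) auto
        ultimately show ?thesis by (simp add: mult_right_mono f_def)
      qed
      show ?thesis
        using angular_quarter_turn[OF True False] *[of z] *[of "c * z"] c u0[of z] u0[of "c * z"]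
        unfolding c_def[symmetric] by (auto simp: norm_mult)
    qed
    have "(1 / 2) powr p * (2 * pi * I) = (LINT z|lebesgue_on (ball 0 1). (1 / 2) powr p * f (cmod z))"
      unfolding R by simp
    also have "\<dots> \<le> (LINT z|lebesgue_on (ball 0 1). u z + u (c * z))"
      using low iu[of 1] iu[OF c] rad(1) by (intro integral_mono) auto
    also have "\<dots> = U + (LINT z|lebesgue_on (ball 0 1). u (c * z))"
      unfolding U using iu[of 1] iu[OF c] by (intro Bochner_Integration.integral_add) auto
    also have "(LINT z|lebesgue_on (ball 0 1). u (c * z)) = U" unfolding U by (rule disk_integral_rotation[OF _ c]) measurable
    finally show ?thesis by simp
  qed
qed

text \<open>As for finite exponents, at almost every point the function or its rotation is at least half of
  the radial factor; continuity of the latter removes the exceptional set.\<close>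

lemma disk_esssup_bounds:
  fixes g :: "real \<Rightarrow> real"
  assumes g: "continuous_on UNIV g" and g0: "n \<ge> 1 \<Longrightarrow> g 0 = 0"
    and B: "\<And>r. 0 \<le> r \<Longrightarrow> r < 1 \<Longrightarrow> \<bar>g r\<bar> \<le> B"
  defines "N \<equiv> Lp_norm \<infinity> (lebesgue_on (ball 0 1)) (\<lambda>z. g (cmod z) * angular n z)"
  shows "N \<le> B" "0 \<le> r \<Longrightarrow> r < 1 \<Longrightarrow> \<bar>g r\<bar> \<le> 2 * N"
proof -
  define u where "u = (\<lambda>z. g (cmod z) * angular n z)"
  let ?M = "lebesgue_on (ball (0::complex) 1)"
  have ub[measurable]: "u \<in> borel_measurable borel"
    unfolding u_def using separated_function_measurable[OF g, of n] .
  have um: "(\<lambda>z. ereal \<bar>u z\<bar>) \<in> borel_measurable ?M"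
    by (rule disk_measurable) measurable
  have uB: "\<bar>u z\<bar> \<le> B" if "z \<in> ball 0 1" for z
  proof -
    have "\<bar>u z\<bar> \<le> \<bar>g (cmod z)\<bar>"
      unfolding u_def abs_mult using angular_le_1[of n z] by (simp add: mult_left_le)
    then show ?thesis using B[of "cmod z"] that by simp
  qed
  have nz: "emeasure ?M (space ?M) \<noteq> 0"
    by (simp add: emeasure_restrict_space emeasure_completion emeasure_ball unit_ball_vol_2)
  let ?e = "esssup ?M (\<lambda>z. ereal \<bar>u z\<bar>)"
  have le: "?e \<le> ereal B" using uB by (intro esssup_I um AE_I2) auto
  have ge: "0 \<le> ?e"
  proof -
    have "esssup ?M (\<lambda>z. 0::ereal) \<le> ?e" by (rule esssup_mono) auto
    then show ?thesis using esssup_const[OF nz, of "0::ereal"] by simp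
  qed
  have N: "?e = ereal N" unfolding N_def Lp_norm_def u_def[symmetric] using le ge by (cases ?e) auto
  then show "N \<le> B" using le by simp
  have "AE z in ?M. ereal \<bar>u z\<bar> \<le> ?e" by (rule esssup_AE)
  then have AEu: "AE z in ?M. \<bar>u z\<bar> \<le> N" unfolding N by simp
  then have AEl: "AE z in lborel. z \<in> ball 0 1 \<longrightarrow> \<bar>u z\<bar> \<le> N"
    by (subst (asm) AE_restrict_space_iff) (auto simp: AE_completion_iff)
  have AEg: "AE z in lborel. z \<in> ball 0 1 \<longrightarrow> \<bar>g (cmod z)\<bar> \<le> 2 * N"
  proof (cases "n \<ge> 1")
    case False
    have N0: "N \<ge> 0" using ge N by simp
    from False have "n = 0" by simp
    show ?thesis using AEl
    proof eventually_elim
      case (elim z)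
      have "u z = g (cmod z)" by (simp add: u_def angular_def \<open>n = 0\<close>)
      then show ?case using elim N0 by auto
    qed
  next
    case True
    have N0: "N \<ge> 0" using ge N by simp
    define c where "c = cis (pi / (2 * real n))"
    have c: "cmod c = 1" by (simp add: c_def)
    have "AE z in distr lborel borel (\<lambda>w. c * w). z \<in> ball 0 1 \<longrightarrow> \<bar>u z\<bar> \<le> N"
      using AEl unfolding lborel_rotation[OF c] .
    then have "AE z in lborel. c * z \<in> ball 0 1 \<longrightarrow> \<bar>u (c * z)\<bar> \<le> N"
      by (subst (asm) AE_distr_iff) auto
    with AEl show ?thesis
    proof eventually_elim
      case (elim z)
      show ?case
      proof
        assume z: "z \<in> ball 0 1"
        show "\<bar>g (cmod z)\<bar> \<le> 2 * N"
        proof (cases "z = 0")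
          case True then show ?thesis using g0[OF \<open>n \<ge> 1\<close>] N0 by simp
        next
          case False
          have *: "\<bar>g (cmod z)\<bar> \<le> 2 * N" if "cmod w = cmod z" "1 / 2 \<le> \<bar>angular n w\<bar>" "\<bar>u w\<bar> \<le> N" for w
          proof -
            have "\<bar>g (cmod z)\<bar> * (1 / 2) \<le> \<bar>u w\<bar>"
              unfolding u_def abs_mult that(1) using that(2) by (intro mult_left_mono) auto
            then show ?thesis using that(3) by simp
          qed
          show ?thesis
            using angular_quarter_turn[OF True False] *[of z] *[of "c * z"] c elim z
            unfolding c_def[symmetric] by (auto simp: norm_mult)
        qed
      qed
    qed
  qed
  then have AEs: "AE z \<in> ball 0 1 in lebesgue. z \<in> {z. \<bar>g (cmod z)\<bar> \<le> 2 * N}"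
    by (auto simp: AE_completion_iff intro: AE_completion)
  have "closed {z. \<bar>g (cmod z)\<bar> \<le> 2 * N}"
    by (intro closed_Collect_le continuous_intros continuous_on_compose2[OF g]) auto
  from mem_closed_if_AE_lebesgue_open[OF open_ball this AEs, of "complex_of_real r"]
  show "\<bar>g r\<bar> \<le> 2 * N" if "0 \<le> r" "r < 1" using that by simp
qed

section \<open>Enumerating the zeros\<close>

text \<open>Under the two hypotheses the defining description is satisfied by exactly one number: the smallest
  zero with at least \<open>m\<close> zeros up to it.\<close>

lemma pos_zero_works:
  fixes f :: "real \<Rightarrow> real"
  assumes fin: "\<And>T. finite {y. 0 < y \<and> y \<le> T \<and> f y = 0}"
    and many: "\<exists>T. m \<le> card {y. 0 < y \<and> y \<le> T \<and> f y = 0}" and m: "m \<ge> 1"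
  shows "0 < pos_zero f m" "f (pos_zero f m) = 0" "card {y. 0 < y \<and> y \<le> pos_zero f m \<and> f y = 0} = m"
proof -
  define A where "A = (\<lambda>T. {y. 0 < y \<and> y \<le> T \<and> f y = 0})"
  have fA: "finite (A T)" for T using fin by (simp add: A_def)
  obtain T where T: "m \<le> card (A T)" using many by (auto simp: A_def)
  define G where "G = {x \<in> A T. m \<le> card (A x)}"
  have "A T \<noteq> {}" using T m by auto
  then have mx: "Max (A T) \<in> A T" using fA by (simp add: Max_in)
  have "A (Max (A T)) = A T"
    using Max_ge[OF fA, of _ T] mx by (auto simp: A_def)
  then have "G \<noteq> {}" using mx T by (auto simp: G_def)
  moreover have fG: "finite G" using fA by (simp add: G_def)
  ultimately have "Min G \<in> G" by (simp add: Min_in)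
  define x where "x = Min G"
  have x: "x \<in> A T" "m \<le> card (A x)" using \<open>Min G \<in> G\<close> by (auto simp: x_def G_def)
  have xmin: "x \<le> y" if "y \<in> A T" "m \<le> card (A y)" for y
    using that fG by (simp add: x_def G_def)
  have "card (A x) = m"
  proof (rule ccontr)
    assume "card (A x) \<noteq> m"
    then have big: "m + 1 \<le> card (A x)" using x by simp
    have xA: "x \<in> A x" using x by (auto simp: A_def)
    let ?P = "A x - {x}"
    have cP: "m \<le> card ?P" using big xA fA by (simp add: card_Diff_singleton)
    have "?P \<noteq> {}"
    proof
      assume "?P = {}"
      then have "card ?P = 0" by (simp only: card.empty)
      then show False using cP m by linarith
    qed
    then have mp: "Max ?P \<in> ?P" using fA by (intro Max_in) auto
    define y where "y = Max ?P"
    have y: "y \<in> ?P" using mp by (simp add: y_def)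
    have "?P \<subseteq> A y"
    proof
      fix z assume z: "z \<in> ?P"
      then have "z \<le> y" unfolding y_def using fA by (intro Max_ge) auto
      then show "z \<in> A y" using z by (simp add: A_def)
    qed
    then have "m \<le> card (A y)" using cP card_mono[OF fA] order_trans by blast
    moreover have "y \<in> A T" using y x by (auto simp: A_def)
    ultimately have "x \<le> y" by (intro xmin)
    then show False using y by (auto simp: A_def)
  qed
  then have ex: "0 < x \<and> f x = 0 \<and> finite (A x) \<and> card (A x) = m" using x fA by (auto simp: A_def)
  have uniq: False if "0 < u" "f v = 0" "card (A u) = m" "card (A v) = m" "u < v" for u v
  proof -
    have "A u \<subseteq> A v" "v \<in> A v" "v \<notin> A u" using that(1,2,5) by (simp_all add: A_def subset_iff)
    then have "A u \<subset> A v" by blast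
    then have "card (A u) < card (A v)" by (rule psubset_card_mono[OF fA])
    then show False using that by simp
  qed
  let ?S = "\<lambda>x. {y. 0 < y \<and> y \<le> x \<and> f y = 0}"
  have "pos_zero f m = x" unfolding pos_zero_def
  proof (rule the_equality)
    show "0 < x \<and> f x = 0 \<and> finite (?S x) \<and> card (?S x) = m" using ex unfolding A_def .
    show "y = x" if "0 < y \<and> f y = 0 \<and> finite (?S y) \<and> card (?S y) = m" for y
    proof (cases x y rule: linorder_cases)
      case less
      then show ?thesis using uniq[of x y] ex that by (simp add: A_def)
    next
      case greater
      then show ?thesis using uniq[of y x] ex that by (simp add: A_def)
    qed simp
  qed
  then show "0 < pos_zero f m" "f (pos_zero f m) = 0" "card (?S (pos_zero f m)) = m"
    using ex unfolding A_def by simp_all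
qed

text \<open>The quantity whose zeros are the logarithms of the frequencies.\<close>

definition boundary_value :: "bdry \<Rightarrow> nat \<Rightarrow> real \<Rightarrow> real" where
  "boundary_value B n = (case B of Dirichlet \<Rightarrow> wave n | Neumann \<Rightarrow> slope n)"

definition zeros_upto :: "bdry \<Rightarrow> nat \<Rightarrow> real \<Rightarrow> real set" where
  "zeros_upto B n b = {s. s \<le> b \<and> boundary_value B n s = 0}"

definition bessel_BC :: "bdry \<Rightarrow> nat \<Rightarrow> real \<Rightarrow> real" where
  "bessel_BC B n = (case B of Dirichlet \<Rightarrow> bessel_J n | Neumann \<Rightarrow> deriv (bessel_J n))"

definition freq :: "bdry \<Rightarrow> nat \<Rightarrow> nat \<Rightarrow> real" where
  "freq B n m = pos_zero (bessel_BC B n) m"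

lemma freq_simps: "freq Dirichlet n m = j_zero n m" "freq Neumann n m = rho_zero n m"
  by (simp_all add: freq_def bessel_BC_def j_zero_def rho_zero_def)

lemma eigval_freq: "eigval B n m = (freq B n m)\<^sup>2"
  by (cases B) (simp_all add: freq_simps)

lemma boundary_value_separated:
  assumes "boundary_value B n a = 0" "boundary_value B n b = 0" "a < b" "0 \<le> potential n a" "potential n b \<le> q"
  shows "1 / sqrt q \<le> b - a"
  using zero_spacing[OF assms(3-5)] assms(1,2) by (cases B) (auto simp: boundary_value_def)

lemma boundary_value_exists:
  assumes "q > 0" "q \<le> potential n a"
  shows "\<exists>z\<in>{a..a + 3 * pi / sqrt q}. boundary_value B n z = 0"
proof (cases B)
  case Dirichlet
  have "a + pi / sqrt q \<le> a + 3 * pi / sqrt q" using assms by (simp add: divide_right_mono)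
  then show ?thesis using wave_zero_exists[OF assms] Dirichlet by (fastforce simp: boundary_value_def)
next
  case Neumann
  then show ?thesis using slope_zero_exists[OF assms] by (simp add: boundary_value_def)
qed

text \<open>Zeros in the oscillating region are separated by \<open>1/\<surd>Q(b)\<close>.\<close>

lemma zeros_upto_in_interval:
  assumes a: "\<And>s. boundary_value B n s = 0 \<Longrightarrow> a \<le> s" "0 \<le> potential n a"
  shows "finite (zeros_upto B n b)"
    "boundary_value B n b = 0 \<Longrightarrow> a < b \<Longrightarrow> real (card (zeros_upto B n b)) \<le> (b - a) * sqrt (potential n b) + 1"
proof -
  have sub: "zeros_upto B n b \<subseteq> {a..b}" using a by (auto simp: zeros_upto_def)
  have both: "finite (zeros_upto B n b) \<and> (zeros_upto B n b = {} \<or> real (card (zeros_upto B n b)) \<le> (b - a) * sqrt (potential n b) + 1)"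
  proof (cases "a < b")
    case False
    then have "zeros_upto B n b \<subseteq> {b}" using sub by auto
    then have f: "finite (zeros_upto B n b)" "card (zeros_upto B n b) \<le> 1"
      using finite_subset[of _ "{b}"] card_mono[of "{b}"] by auto
    show ?thesis
    proof (cases "zeros_upto B n b = {}")
      case True then show ?thesis by simp
    next
      case False
      then have "a = b" using sub \<open>\<not> a < b\<close> by fastforce
      then show ?thesis using f by simp
    qed
  next
    case True
    have Q: "potential n b > 0" using potential_strict_mono[OF True, of n] a(2) by simp
    then have d: "1 / sqrt (potential n b) > 0" by simp
    have sep: "1 / sqrt (potential n b) \<le> y - x" if "x \<in> zeros_upto B n b" "y \<in> zeros_upto B n b" "x < y" for x y
    proof (rule boundary_value_separated[of B n x y])
      show "0 \<le> potential n x" using a(2) potential_mono[of a x n] sub that by auto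
      show "potential n y \<le> potential n b" using that by (intro potential_mono) (auto simp: zeros_upto_def)
    qed (use that in \<open>auto simp: zeros_upto_def\<close>)
    from separated_card_le[OF d sub sep] show ?thesis by auto
  qed
  then show "finite (zeros_upto B n b)" by simp
  assume "boundary_value B n b = 0" "a < b"
  then have "b \<in> zeros_upto B n b" by (simp add: zeros_upto_def)
  then show "real (card (zeros_upto B n b)) \<le> (b - a) * sqrt (potential n b) + 1" using both by auto
qed

lemma zeros_upto_finite: "finite (zeros_upto B n b)"
proof -
  obtain C s0 s1 where C: "C \<ge> 1" "turning_data C n s0 s1" using turning_data_uniform by blast
  show ?thesis
  proof (rule zeros_upto_in_interval)
    show "s1 \<le> s" if "boundary_value B n s = 0" for s
      using C(2) that unfolding turning_data_def by (cases B) (auto simp: boundary_value_def not_less[symmetric])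
    have "0 < cbrt_n n ^ 4" using cbrt_n_ge_1[of n] by simp
    then have "0 < C * potential n s1" using C(2) unfolding turning_data_def by linarith
    then show "0 \<le> potential n s1" using C(1) by (simp add: zero_less_mult_iff)
  qed
qed

lemma zeros_upto_card_lower:
  assumes "q > 0" "q \<le> potential n a" "a \<le> b"
  shows "(b - a) * sqrt q / (6 * pi) - 1 \<le> real (card (zeros_upto B n b))"
proof -
  define L where "L = 3 * pi / sqrt q"
  have L: "L > 0" using assms by (simp add: L_def)
  have "(b - a) / (2 * L) - 1 \<le> real (card (zeros_upto B n b))"
  proof (rule card_ge_disjoint_intervals[OF L zeros_upto_finite assms(3)])
    fix x assume x: "a \<le> x" "x + L \<le> b"
    have "q \<le> potential n x" using assms(2) potential_mono[OF x(1), of n] by linarith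
    from boundary_value_exists[OF assms(1) this, of B] obtain z where "z \<in> {x..x + L}" "boundary_value B n z = 0"
      unfolding L_def by blast
    then show "\<exists>z\<in>zeros_upto B n b. x \<le> z \<and> z \<le> x + L"
      using x by (intro bexI[of _ z]) (auto simp: zeros_upto_def)
  qed
  moreover have "(b - a) / (2 * L) = (b - a) * sqrt q / (6 * pi)" using assms(1) by (simp add: L_def field_simps)
  ultimately show ?thesis by simp
qed

lemma zeros_upto_unbounded: "\<exists>b. m \<le> card (zeros_upto B n b)"
proof -
  define a where "a = ln (real n + 1)"
  define b where "b = a + (real m + 1) * (6 * pi)"
  have "1 \<le> potential n a" by (simp add: potential_def a_def power2_eq_square algebra_simps)
  moreover have "a \<le> b" by (simp add: b_def)
  ultimately have "(b - a) * sqrt 1 / (6 * pi) - 1 \<le> real (card (zeros_upto B n b))"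
    by (intro zeros_upto_card_lower) auto
  then have "real m \<le> real (card (zeros_upto B n b))" by (simp add: b_def)
  then show ?thesis by auto
qed

lemma bessel_BC_iff:
  assumes "t > 0"
  shows "bessel_BC B n t = 0 \<longleftrightarrow> boundary_value B n (ln t) = 0"
proof (cases B)
  case Dirichlet
  then show ?thesis using assms by (simp add: bessel_BC_def boundary_value_def wave_def)
next
  case Neumann
  have "deriv (bessel_J n) t = real n * bessel_J n t / t - bessel_J (n + 1) t"
    by (rule DERIV_imp_deriv[OF bessel_J_deriv[OF assms]])
  then have "slope n (ln t) = t * deriv (bessel_J n) t"
    using assms by (simp add: slope_def field_simps)
  then show ?thesis using Neumann assms by (simp add: bessel_BC_def boundary_value_def)
qed

lemma bessel_BC_zeros:
  assumes "T > 0"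
  shows "{y. 0 < y \<and> y \<le> T \<and> bessel_BC B n y = 0} = exp ` zeros_upto B n (ln T)"
proof (intro subset_antisym subsetI)
  fix y assume "y \<in> {y. 0 < y \<and> y \<le> T \<and> bessel_BC B n y = 0}"
  then have y: "0 < y" "y \<le> T" "bessel_BC B n y = 0" by auto
  then have "ln y \<in> zeros_upto B n (ln T)" using bessel_BC_iff[OF y(1)] assms by (simp add: zeros_upto_def)
  then show "y \<in> exp ` zeros_upto B n (ln T)" using y(1) by (intro image_eqI[of _ _ "ln y"]) auto
next
  fix y assume "y \<in> exp ` zeros_upto B n (ln T)"
  then obtain s where s: "y = exp s" "s \<le> ln T" "boundary_value B n s = 0" by (auto simp: zeros_upto_def)
  have "exp s \<le> exp (ln T)" using s(2) by (simp only: exp_le_cancel_iff)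
  then show "y \<in> {y. 0 < y \<and> y \<le> T \<and> bessel_BC B n y = 0}"
    using s assms bessel_BC_iff[of "exp s" B n] by simp
qed

lemma freq_works:
  assumes "m \<ge> 1"
  shows "freq B n m > 0" "boundary_value B n (ln (freq B n m)) = 0" "card (zeros_upto B n (ln (freq B n m))) = m"
proof -
  have inj: "card (exp ` A) = card A" for A :: "real set" by (intro card_image inj_onI) simp
  have fin: "finite {y. 0 < y \<and> y \<le> T \<and> bessel_BC B n y = 0}" for T
  proof (cases "T > 0")
    case True then show ?thesis by (simp add: bessel_BC_zeros zeros_upto_finite)
  next
    case False
    then have e: "{y. 0 < y \<and> y \<le> T \<and> bessel_BC B n y = 0} = {}" by auto
    show ?thesis unfolding e by simp
  qed
  obtain b where b: "m \<le> card (zeros_upto B n b)" using zeros_upto_unbounded by blast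
  have "m \<le> card {y. 0 < y \<and> y \<le> exp b \<and> bessel_BC B n y = 0}"
    using b by (simp add: bessel_BC_zeros inj)
  then have ex: "\<exists>T. m \<le> card {y. 0 < y \<and> y \<le> T \<and> bessel_BC B n y = 0}" by blast
  note w = pos_zero_works[OF fin ex assms, folded freq_def]
  show "freq B n m > 0" by (rule w(1))
  show "boundary_value B n (ln (freq B n m)) = 0" using w(1,2) bessel_BC_iff by simp
  show "card (zeros_upto B n (ln (freq B n m))) = m" using w(1,3) by (simp add: bessel_BC_zeros inj)
qed

lemma boundary_value_zero_beyond_turning: "n \<ge> 1 \<Longrightarrow> boundary_value B n s = 0 \<Longrightarrow> ln (real n) < s"
  using wave_pos_before_turning[of n s] slope_pos_before_turning[of n s]
  by (cases B) (auto simp: boundary_value_def not_le[symmetric])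

text \<open>All zeros lie beyond the turning point, at logarithmic distance \<open>ln (1 + D/n\<^sup>2) /
  2\<close> from \<open>b\<close>, and are separated by \<open>1/\<surd>D\<close>. Two estimates of this
  logarithm, adapted to \<open>D \<le> n\<^sup>2\<close> and to \<open>D \<ge> n\<^sup>2\<close>, give the two
  growth laws of \<open>D\<close>.\<close>

lemma zero_count_upper:
  assumes n: "n \<ge> 1" and z: "boundary_value B n b = 0"
  defines "D \<equiv> potential n b" and "m \<equiv> card (zeros_upto B n b)"
  shows "2 * (real n)\<^sup>2 * (real m - 1) \<le> D * sqrt D" "2 * (real m - 1) \<le> sqrt D * ln (1 + D)"
proof -
  have gt: "ln (real n) < b" by (rule boundary_value_zero_beyond_turning[OF n z])
  have D: "D > 0" using potential_strict_mono[OF gt, of n] potential_ln[OF n] by (simp add: D_def)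
  have "real m \<le> (b - ln (real n)) * sqrt D + 1" unfolding m_def D_def
    using boundary_value_zero_beyond_turning[OF n] potential_ln[OF n] gt z by (intro zeros_upto_in_interval) (auto intro: less_imp_le)
  moreover have "b - ln (real n) = ln (1 + D / (real n)\<^sup>2) / 2"
  proof -
    have "1 + D / (real n)\<^sup>2 = (exp (b - ln (real n)))\<^sup>2"
      using n by (simp add: D_def potential_def exp_diff power_divide diff_divide_distrib)
    then show ?thesis by (simp add: exp_double[symmetric])
  qed
  ultimately have le: "2 * (real m - 1) \<le> ln (1 + D / (real n)\<^sup>2) * sqrt D" by (simp add: field_simps)
  have n2: "(real n)\<^sup>2 \<ge> 1" using n by simp
  have "ln (1 + D / (real n)\<^sup>2) \<le> D / (real n)\<^sup>2" using D by (intro ln_add_one_self_le_self) auto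
  then have "ln (1 + D / (real n)\<^sup>2) * sqrt D \<le> D / (real n)\<^sup>2 * sqrt D" using D by (intro mult_right_mono) auto
  then have "2 * (real m - 1) \<le> D / (real n)\<^sup>2 * sqrt D" using le by linarith
  then show "2 * (real n)\<^sup>2 * (real m - 1) \<le> D * sqrt D" using n by (simp add: field_simps)
  have "D / (real n)\<^sup>2 \<le> D / 1" using n2 D n by (intro divide_left_mono) auto
  then have "ln (1 + D / (real n)\<^sup>2) \<le> ln (1 + D)" using D by (subst ln_le_cancel_iff) (auto intro!: add_pos_nonneg)
  then have "ln (1 + D / (real n)\<^sup>2) * sqrt D \<le> ln (1 + D) * sqrt D" using D by (intro mult_right_mono) auto
  then show "2 * (real m - 1) \<le> sqrt D * ln (1 + D)" using le by (simp add: mult.commute)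
qed

text \<open>Zeros are counted only where the potential lies between \<open>D/2\<close> and \<open>D\<close>;
  this part has logarithmic length at least \<open>D / (4 (n\<^sup>2 + D))\<close>.\<close>

lemma zero_count_lower:
  fixes B :: bdry
  assumes D0: "potential n b > 0"
  defines "D \<equiv> potential n b" and "m \<equiv> card (zeros_upto B n b)"
  shows "D * sqrt D \<le> 24 * sqrt 2 * pi * (real m + 1) * ((real n)\<^sup>2 + D)"
proof -
  have D: "D > 0" using D0 by (simp add: D_def)
  have eb: "(exp b)\<^sup>2 = (real n)\<^sup>2 + D" by (simp add: D_def potential_def)
  \<comment> \<open>the point where the potential equals \<open>D/2\<close>\<close>
  define a where "a = ln ((real n)\<^sup>2 + D / 2) / 2"
  have pa: "(real n)\<^sup>2 + D / 2 > 0" "(real n)\<^sup>2 + D > 0" using D by (auto intro: add_nonneg_pos)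
  have ea: "(exp a)\<^sup>2 = (real n)\<^sup>2 + D / 2" using pa by (simp add: a_def exp_double[symmetric])
  have Qa: "potential n a = D / 2" using ea by (simp add: potential_def)
  have b: "b = ln ((real n)\<^sup>2 + D) / 2" using eb by (metis exp_double ln_exp nonzero_mult_div_cancel_left zero_neq_numeral)
  have "1 - ((real n)\<^sup>2 + D / 2) / ((real n)\<^sup>2 + D) \<le> - ln (((real n)\<^sup>2 + D / 2) / ((real n)\<^sup>2 + D))"
    using ln_le_minus_one[of "((real n)\<^sup>2 + D / 2) / ((real n)\<^sup>2 + D)"] pa by simp
  also have "\<dots> = 2 * (b - a)" using pa by (simp add: a_def b ln_div)
  also have "1 - ((real n)\<^sup>2 + D / 2) / ((real n)\<^sup>2 + D) = D / (2 * ((real n)\<^sup>2 + D))"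
    using pa by (simp add: field_simps)
  finally have h: "D / (2 * ((real n)\<^sup>2 + D)) \<le> 2 * (b - a)" .
  have "D / (2 * ((real n)\<^sup>2 + D)) / 2 \<le> b - a" using h by (simp only: divide_le_eq_numeral1 mult.commute[of 2])
  moreover have "D / (2 * ((real n)\<^sup>2 + D)) / 2 = D / (4 * ((real n)\<^sup>2 + D))" by simp
  ultimately have ba: "D / (4 * ((real n)\<^sup>2 + D)) \<le> b - a" by (simp only:)
  moreover have "0 \<le> D / (4 * ((real n)\<^sup>2 + D))" using D pa by simp
  ultimately have "a \<le> b" by linarith
  then have "(b - a) * sqrt (D / 2) / (6 * pi) - 1 \<le> real m"
    unfolding m_def using D Qa by (intro zeros_upto_card_lower) auto
  moreover have "D / (4 * ((real n)\<^sup>2 + D)) * sqrt (D / 2) / (6 * pi) \<le> (b - a) * sqrt (D / 2) / (6 * pi)"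
    using ba D by (intro divide_right_mono mult_right_mono) auto
  ultimately have "D / (4 * ((real n)\<^sup>2 + D)) * sqrt (D / 2) / (6 * pi) \<le> real m + 1" by linarith
  then have "D * (sqrt D / sqrt 2) / (24 * pi * ((real n)\<^sup>2 + D)) \<le> real m + 1"
    by (simp add: real_sqrt_divide field_simps)
  moreover have Y: "24 * pi * ((real n)\<^sup>2 + D) > 0" using pa by simp
  ultimately have "D * (sqrt D / sqrt 2) \<le> (real m + 1) * (24 * pi * ((real n)\<^sup>2 + D))"
    by (simp only: pos_divide_le_eq[OF Y])
  then have "D * (sqrt D / sqrt 2) * sqrt 2 \<le> (real m + 1) * (24 * pi * ((real n)\<^sup>2 + D)) * sqrt 2"
    by (intro mult_right_mono) auto
  moreover have "D * (sqrt D / sqrt 2) * sqrt 2 = D * sqrt D" by simp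
  ultimately show ?thesis by (simp only: mult_ac)
qed

section \<open>One-dimensional power integrals\<close>

text \<open>The situation at one frequency \<open>exp b\<close>: the oscillation starts at \<open>exp
  s1\<close> with data controlled by \<open>C\<close>, and from there on the amplitude is constant up to the
  factor \<open>K\<close>. The bounds derived from it are expressed by the amplitude \<open>a\<close>, the
  scale \<open>h\<close> and the gap \<open>D\<close>.\<close>

locale bessel_window =
  fixes C K :: real and n :: nat and s0 s1 b :: real
  assumes C: "C \<ge> 1" and K: "K \<ge> 1" and td: "turning_data C n s0 s1"
    and comparable: "\<And>s t. s1 \<le> s \<Longrightarrow> s \<le> t \<Longrightarrow> amplitude_sq n t \<le> K * amplitude_sq n s \<and> amplitude_sq n s \<le> K * amplitude_sq n t"
    and b: "s1 \<le> b"
begin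

definition a where "a = sqrt (amplitude_sq n s1)"
definition h where "h = cbrt_n n"
definition D where "D = potential n b"
definition Q1 where "Q1 = potential n s1"

lemma h: "h \<ge> 1" "h ^ 4 \<ge> 1" "h > 0"
  using cbrt_n_ge_1[of n] by (simp_all add: h_def)

lemma Q1: "h ^ 4 \<le> C * Q1" "Q1 \<le> C * h ^ 4" "Q1 > 0"
proof -
  show *: "h ^ 4 \<le> C * Q1" "Q1 \<le> C * h ^ 4" using td by (simp_all add: turning_data_def h_def Q1_def)
  have "0 < C * Q1" using * h by linarith
  then show "Q1 > 0" using C by (simp add: zero_less_mult_iff)
qed

lemma Q_ge: "s1 \<le> s \<Longrightarrow> Q1 \<le> potential n s"
  unfolding Q1_def by (rule potential_mono)

lemma D_ge: "Q1 \<le> D" "D > 0" "h ^ 4 \<le> C * D"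
proof -
  show 1: "Q1 \<le> D" unfolding D_def by (rule Q_ge[OF b])
  then show "D > 0" using Q1 by linarith
  have "C * Q1 \<le> C * D" using 1 C by (intro mult_left_mono) auto
  then show "h ^ 4 \<le> C * D" using Q1 by linarith
qed

lemma a_pos: "a > 0" "a\<^sup>2 = amplitude_sq n s1"
proof -
  have "amplitude_sq n s1 > 0" using Q1(3) by (simp add: Q1_def amplitude_sq_pos)
  then show "a > 0" "a\<^sup>2 = amplitude_sq n s1" by (simp_all add: a_def)
qed

lemma sq_bound:
  assumes "s1 \<le> s"
  shows "(wave n s)\<^sup>2 \<le> K * a\<^sup>2 / sqrt (potential n s)"
proof -
  have Q: "potential n s > 0" using Q_ge[OF assms] Q1 by linarith
  have "sqrt (potential n s) * (wave n s)\<^sup>2 \<le> amplitude_sq n s"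
  proof -
    have "potential n s / sqrt (potential n s) = sqrt (potential n s)" by (rule real_div_sqrt) (use Q in simp)
    then have "sqrt (potential n s) * (wave n s)\<^sup>2 = potential n s * (wave n s)\<^sup>2 / sqrt (potential n s)"
      by (metis times_divide_eq_left)
    also have "\<dots> \<le> amplitude_sq n s" unfolding amplitude_sq_def energy_def using Q by (intro divide_right_mono) auto
    finally show ?thesis .
  qed
  also have "\<dots> \<le> K * a\<^sup>2" unfolding a_pos(2) using comparable[OF order_refl assms] by simp
  finally show ?thesis using Q by (simp add: pos_le_divide_eq mult.commute)
qed

abbreviation f where "f p t \<equiv> t * \<bar>bessel_J n t\<bar> powr p"

lemma f_cont: "p \<ge> 1 \<Longrightarrow> continuous_on S (f p)"
  by (intro continuous_intros continuous_on_powr') auto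

lemma f_int: "p \<ge> 1 \<Longrightarrow> f p integrable_on {u..v}"
  by (intro integrable_continuous_interval f_cont)

lemma ln_ge: "exp s1 \<le> t \<Longrightarrow> s1 \<le> ln t" "exp s1 \<le> t \<Longrightarrow> exp (ln t) = t" "exp s1 \<le> t \<Longrightarrow> t > 0"
proof -
  assume t: "exp s1 \<le> t"
  show t0: "t > 0" using t exp_gt_zero[of s1] by linarith
  then show "exp (ln t) = t" by simp
  show "s1 \<le> ln t" using t t0 by (simp add: ln_ge_iff)
qed

text \<open>Hoelder between the supremum bound and the bound for the mass in
  \<open>turning_data\<close>.\<close>

lemma I_upper_inner:
  assumes p: "p \<ge> 1"
  shows "integral {0..exp s1} (f p) \<le> C powr p * (a powr p * (h ^ 4) powr (1 - p / 4))"
proof -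
  define w where "w = (C * a / h) powr (p - 1)"
  have w: "w \<ge> 0" by (simp add: w_def)
  have io: "(\<lambda>t. w * (t * \<bar>bessel_J n t\<bar>)) integrable_on {0..exp s1}"
    by (intro integrable_continuous_interval continuous_intros)
  have "integral {0..exp s1} (f p) \<le> integral {0..exp s1} (\<lambda>t. w * (t * \<bar>bessel_J n t\<bar>))"
  proof (rule integral_le[OF f_int[OF p] io])
    fix t assume t: "t \<in> {0..exp s1}"
    show "f p t \<le> w * (t * \<bar>bessel_J n t\<bar>)"
    proof (cases "t = 0 \<or> bessel_J n t = 0")
      case True then show ?thesis using p by auto
    next
      case False
      then have t0: "0 < t" "t \<le> exp s1" using t by auto
      then have "ln t \<le> ln (exp s1)" by (subst ln_le_cancel_iff) auto
      then have "ln t \<le> s1" by simp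
      then have "\<bar>wave n (ln t)\<bar> * h \<le> C * a" using td by (simp add: turning_data_def h_def a_def)
      then have "\<bar>bessel_J n t\<bar> \<le> C * a / h" using t0 h by (simp add: wave_def pos_le_divide_eq)
      then have "\<bar>bessel_J n t\<bar> powr (p - 1) \<le> w" unfolding w_def using p by (intro powr_mono2) auto
      then have "\<bar>bessel_J n t\<bar> powr (p - 1) * (t * \<bar>bessel_J n t\<bar>) \<le> w * (t * \<bar>bessel_J n t\<bar>)"
        using t0 by (intro mult_right_mono) auto
      moreover have "\<bar>bessel_J n t\<bar> powr p = \<bar>bessel_J n t\<bar> powr (p - 1) * \<bar>bessel_J n t\<bar>"
        using False by (simp add: powr_diff)
      ultimately show ?thesis by (simp add: mult_ac)
    qed
  qed
  also have "\<dots> = w * integral {0..exp s1} (\<lambda>t. t * \<bar>bessel_J n t\<bar>)" by simp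
  also have "\<dots> \<le> w * (C * (a * h ^ 3))"
    using td w by (intro mult_left_mono) (auto simp: turning_data_def h_def a_def)
  also have "\<dots> = C powr p * (a powr p * (h ^ 4) powr (1 - p / 4))"
  proof -
    have "(h ^ 4) powr (1 - p / 4) = h powr (4 - p)"
      using h by (simp add: powr_powr algebra_simps flip: powr_numeral)
    also have "4 - p = 3 - (p - 1)" by simp
    also have "h powr (3 - (p - 1)) = h powr 3 / h powr (p - 1)" by (rule powr_diff)
    finally have 1: "(h ^ 4) powr (1 - p / 4) = h ^ 3 / h powr (p - 1)" using h by simp
    have 2: "w = C powr (p - 1) * a powr (p - 1) / h powr (p - 1)"
      unfolding w_def using C a_pos h by (simp add: powr_divide powr_mult)
    have 3: "x powr p = x powr (p - 1) * x" if "x > 0" for x using that by (simp add: powr_diff)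
    show ?thesis unfolding 1 2 using 3[of C] 3[of a] C a_pos by (simp add: mult_ac)
  qed
  finally show ?thesis .
qed

text \<open>On the oscillating part \<open>\<bar>J\<^sub>n\<bar>\<^sup>p\<close> is at most a multiple of
  \<open>Q\<^bsup>-p/4\<^esup> = Q\<^bsup>1-p/4\<^esup> / Q\<close>. The first factor is bounded by
  \<open>Y\<close>, and \<open>t / Q\<close> integrates to a logarithm; this crude separation treats all
  \<open>p\<close> alike, including the critical \<open>p = 4\<close>.\<close>

lemma I_upper_outer:
  assumes p: "p \<ge> 1" and Y: "\<And>q. Q1 \<le> q \<Longrightarrow> q \<le> D \<Longrightarrow> q powr (1 - p / 4) \<le> Y"
  shows "integral {exp s1..exp b} (f p) \<le> K powr (p / 2) * (a powr p * (Y * (ln (D / Q1) / 2)))"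
proof -
  define w where "w = K powr (p / 2) * a powr p * Y"
  have n0: "(exp s1)\<^sup>2 - (real n)\<^sup>2 = Q1" "(exp b)\<^sup>2 - (real n)\<^sup>2 = D" by (simp_all add: Q1_def D_def potential_def)
  have Qt: "Q1 \<le> t\<^sup>2 - (real n)\<^sup>2" "t\<^sup>2 - (real n)\<^sup>2 \<le> D" if "t \<in> {exp s1..exp b}" for t
  proof -
    have "t > 0" using that ln_ge(3)[of t] by simp
    then have "(exp s1)\<^sup>2 \<le> t\<^sup>2" "t\<^sup>2 \<le> (exp b)\<^sup>2" using that by (auto intro!: power_mono)
    then show "Q1 \<le> t\<^sup>2 - (real n)\<^sup>2" "t\<^sup>2 - (real n)\<^sup>2 \<le> D" unfolding n0[symmetric] by auto
  qed
  have ftc: "((\<lambda>t. t / (t\<^sup>2 - (real n)\<^sup>2)) has_integral (ln D / 2 - ln Q1 / 2)) {exp s1..exp b}"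
    unfolding n0[symmetric]
  proof (rule fundamental_theorem_of_calculus)
    fix t assume t: "t \<in> {exp s1..exp b}"
    then have pos: "t\<^sup>2 - (real n)\<^sup>2 > 0" using Qt(1)[OF t] Q1(3) by linarith
    have "((\<lambda>t. t\<^sup>2 - (real n)\<^sup>2) has_real_derivative 2 * t) (at t)"
      by (auto intro!: derivative_eq_intros)
    from DERIV_cdivide[OF DERIV_chain2[OF DERIV_ln_divide[OF pos] this], of 2]
    have "((\<lambda>t. ln (t\<^sup>2 - (real n)\<^sup>2) / 2) has_real_derivative (1 / (t\<^sup>2 - (real n)\<^sup>2) * (2 * t) / 2)) (at t)" .
    moreover have "1 / x * (2 * t) / 2 = t / x" for x :: real by simp
    ultimately have "((\<lambda>t. ln (t\<^sup>2 - (real n)\<^sup>2) / 2) has_real_derivative t / (t\<^sup>2 - (real n)\<^sup>2)) (at t)"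
      by (simp only:)
    then show "((\<lambda>t. ln (t\<^sup>2 - (real n)\<^sup>2) / 2) has_vector_derivative t / (t\<^sup>2 - (real n)\<^sup>2)) (at t within {exp s1..exp b})"
      by (simp add: has_real_derivative_iff_has_vector_derivative has_vector_derivative_at_within)
  qed (use b in simp)
  have "integral {exp s1..exp b} (f p) \<le> w * (ln D / 2 - ln Q1 / 2)"
  proof (rule has_integral_le[OF integrable_integral[OF f_int[OF p]] has_integral_mult_right[OF ftc]])
    fix t assume t: "t \<in> {exp s1..exp b}"
    define q where "q = t\<^sup>2 - (real n)\<^sup>2"
    have q: "Q1 \<le> q" "q \<le> D" "q > 0" using Qt[OF t] Q1(3) by (auto simp: q_def)
    note l = ln_ge[of t]
    have t0: "t > 0" using l t by auto
    have "(bessel_J n t)\<^sup>2 \<le> K * a\<^sup>2 / sqrt q"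
      using sq_bound[of "ln t"] l t by (simp add: wave_def potential_def q_def)
    then have "((bessel_J n t)\<^sup>2) powr (p / 2) \<le> (K * a\<^sup>2 / sqrt q) powr (p / 2)" using p by (intro powr_mono2) auto
    moreover have "((bessel_J n t)\<^sup>2) powr (p / 2) = \<bar>bessel_J n t\<bar> powr p"
    proof -
      have "(bessel_J n t)\<^sup>2 = \<bar>bessel_J n t\<bar> powr 2" by simp
      then show ?thesis by (simp only: powr_powr) simp
    qed
    moreover have "(K * a\<^sup>2 / sqrt q) powr (p / 2) = K powr (p / 2) * a powr p * q powr (- (p / 4))"
    proof -
      have "(a\<^sup>2) powr (p / 2) = a powr p" using a_pos(1) by (simp add: powr_powr flip: powr_numeral)
      moreover have "sqrt q powr (p / 2) = q powr (p / 4)" using q(3) by (simp add: powr_powr flip: powr_half_sqrt)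
      moreover have "(K * a\<^sup>2 / sqrt q) powr (p / 2) = K powr (p / 2) * (a\<^sup>2) powr (p / 2) / sqrt q powr (p / 2)"
        using K q(3) by (simp add: powr_mult powr_divide)
      ultimately show ?thesis by (simp only: powr_minus_divide) simp
    qed
    moreover have "q powr (- (p / 4)) = q powr (1 - p / 4) / q"
    proof -
      have "q powr (1 + - (p / 4)) = q powr 1 * q powr (- (p / 4))" by (rule powr_add)
      then show ?thesis using q(3) by simp
    qed
    moreover have "q powr (1 - p / 4) / q \<le> Y / q" using Y[OF q(1,2)] q(3) by (intro divide_right_mono) auto
    then have "K powr (p / 2) * a powr p * (q powr (1 - p / 4) / q) \<le> K powr (p / 2) * a powr p * (Y / q)"
      by (intro mult_left_mono) auto
    ultimately have "\<bar>bessel_J n t\<bar> powr p \<le> K powr (p / 2) * a powr p * (Y / q)" by simp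
    then have "\<bar>bessel_J n t\<bar> powr p \<le> w / q" by (simp add: w_def)
    then have "t * \<bar>bessel_J n t\<bar> powr p \<le> t * (w / q)" using t0 by (intro mult_left_mono) auto
    then show "f p t \<le> w * (t / (t\<^sup>2 - (real n)\<^sup>2))" by (simp add: q_def mult_ac)
  qed
  also have "ln D / 2 - ln Q1 / 2 = ln (D / Q1) / 2" using D_ge Q1 by (simp add: ln_div diff_divide_distrib)
  finally show ?thesis by (simp add: w_def mult_ac)
qed

lemma log_ratio_le: "ln (D / Q1) / 2 \<le> C * (1 + ln (1 + D))" "0 \<le> ln (1 + D)" "0 \<le> ln (D / Q1)"
proof -
  show p: "0 \<le> ln (1 + D)" using D_ge by simp
  show "0 \<le> ln (D / Q1)" using D_ge Q1 by simp
  have "D / Q1 \<le> C * (1 + D)"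
  proof -
    have "1 \<le> C * Q1" using Q1(1) h by linarith
    then have "D * 1 \<le> D * (C * Q1)" using D_ge by (intro mult_left_mono) auto
    then have "D / Q1 \<le> C * D" using Q1(3) by (simp add: pos_divide_le_eq mult_ac)
    also have "\<dots> \<le> C * (1 + D)" using C by simp
    finally show ?thesis .
  qed
  then have "ln (D / Q1) \<le> ln (C * (1 + D))" using D_ge Q1 C by (subst ln_le_cancel_iff) auto
  also have "\<dots> = ln C + ln (1 + D)" using C D_ge by (simp add: ln_mult)
  also have "\<dots> \<le> C + C * ln (1 + D)"
  proof (rule add_mono)
    have "C > 0" using C by simp
    from ln_le_minus_one[OF this] show "ln C \<le> C" by linarith
    show "ln (1 + D) \<le> C * ln (1 + D)" using C p by (simp add: mult_le_cancel_right1)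
  qed
  finally have 1: "ln (D / Q1) \<le> C * (1 + ln (1 + D))" by (simp add: algebra_simps)
  moreover have "0 \<le> C * (1 + ln (1 + D))" using C p by simp
  ultimately show "ln (D / Q1) / 2 \<le> C * (1 + ln (1 + D))" by simp
qed

text \<open>The power \<open>Q\<^bsup>1-p/4\<^esup>\<close> is largest at the outer end for \<open>p <
  4\<close> and at the crest for \<open>p \<ge> 4\<close>.\<close>

lemma I_upper:
  assumes p: "p \<ge> 1"
  defines "X \<equiv> if p < 4 then D else h ^ 4"
  shows "integral {0..exp b} (f p) \<le>
    (C powr p * C powr p + K powr (p / 2) * C powr p * C) * (a powr p * (X powr (1 - p / 4) * (1 + ln (1 + D))))"
proof -
  define Z where "Z = C powr p * X powr (1 - p / 4)"
  note lr = log_ratio_le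
  have Cp: "C powr x \<le> C powr p" if "x \<le> p" for x using that C by (intro powr_mono) auto
  have X: "X > 0" using D_ge h by (simp add: X_def)
  have 1: "(h ^ 4) powr (1 - p / 4) \<le> Z"
  proof (cases "p < 4")
    case True
    have "(h ^ 4) powr (1 - p / 4) \<le> (C * D) powr (1 - p / 4)" using D_ge(3) True h by (intro powr_mono2) auto
    also have "\<dots> = C powr (1 - p / 4) * X powr (1 - p / 4)" using C D_ge True by (simp add: powr_mult X_def)
    also have "\<dots> \<le> Z" unfolding Z_def using p by (intro mult_right_mono Cp) auto
    finally show ?thesis .
  next
    case False
    have "1 \<le> C powr p" using Cp[of 0] C p by simp
    then show ?thesis using False mult_right_mono[of 1 "C powr p" "X powr (1 - p / 4)"] by (simp add: Z_def X_def)
  qed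
  have 2: "q powr (1 - p / 4) \<le> Z" if q: "Q1 \<le> q" "q \<le> D" for q
  proof (cases "p < 4")
    case True
    have "q powr (1 - p / 4) \<le> D powr (1 - p / 4)" using q True Q1 by (intro powr_mono2) auto
    also have "\<dots> = 1 * X powr (1 - p / 4)" using True by (simp add: X_def)
    also have "\<dots> \<le> Z" unfolding Z_def using Cp[of 0] C p by (intro mult_right_mono) auto
    finally show ?thesis .
  next
    case False
    have "C * Q1 \<le> C * q" using q C by (intro mult_left_mono) auto
    then have "h ^ 4 \<le> C * q" using Q1(1) by linarith
    then have "h ^ 4 / C \<le> q" using C by (simp add: pos_divide_le_eq mult.commute)
    then have "q powr (1 - p / 4) \<le> (h ^ 4 / C) powr (1 - p / 4)" using False h C by (intro powr_mono2') auto
    also have "\<dots> = C powr (p / 4 - 1) * X powr (1 - p / 4)"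
    proof -
      have "C powr (- (1 - p / 4)) = 1 / C powr (1 - p / 4)" by (rule powr_minus_divide)
      then have "C powr (p / 4 - 1) = 1 / C powr (1 - p / 4)" by simp
      moreover have "(h ^ 4 / C) powr (1 - p / 4) = X powr (1 - p / 4) / C powr (1 - p / 4)"
        using False h C by (simp add: X_def powr_divide)
      ultimately show ?thesis by simp
    qed
    also have "\<dots> \<le> Z" unfolding Z_def using p by (intro mult_right_mono Cp) auto
    finally show ?thesis .
  qed
  have Z: "Z \<ge> 0" by (simp add: Z_def)
  have "integral {0..exp s1} (f p) \<le> C powr p * (a powr p * (Z * (1 + ln (1 + D))))"
  proof -
    have "Z * 1 \<le> Z * (1 + ln (1 + D))" using lr Z by (intro mult_left_mono) auto
    then have "Z \<le> Z * (1 + ln (1 + D))" by (simp only: mult_1_right)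
    with 1 have "(h ^ 4) powr (1 - p / 4) \<le> Z * (1 + ln (1 + D))" by (rule order_trans)
    then have "C powr p * (a powr p * (h ^ 4) powr (1 - p / 4)) \<le> C powr p * (a powr p * (Z * (1 + ln (1 + D))))"
      by (intro mult_left_mono) auto
    then show ?thesis using I_upper_inner[OF p] by linarith
  qed
  moreover have "integral {exp s1..exp b} (f p) \<le> K powr (p / 2) * (a powr p * (Z * (C * (1 + ln (1 + D)))))"
  proof -
    have "Z * (ln (D / Q1) / 2) \<le> Z * (C * (1 + ln (1 + D)))" using lr Z by (intro mult_left_mono) auto
    from mult_left_mono[OF mult_left_mono[OF this, of "a powr p"], of "K powr (p / 2)"]
    have "K powr (p / 2) * (a powr p * (Z * (ln (D / Q1) / 2))) \<le> K powr (p / 2) * (a powr p * (Z * (C * (1 + ln (1 + D)))))"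
      by simp
    moreover have "integral {exp s1..exp b} (f p) \<le> K powr (p / 2) * (a powr p * (Z * (ln (D / Q1) / 2)))"
      by (rule I_upper_outer[OF p 2])
    ultimately show ?thesis by linarith
  qed
  moreover have "integral {0..exp b} (f p) = integral {0..exp s1} (f p) + integral {exp s1..exp b} (f p)"
    using b by (intro Henstock_Kurzweil_Integration.integral_combine[symmetric] f_int p) auto
  ultimately have "integral {0..exp b} (f p) \<le> C powr p * (a powr p * (Z * (1 + ln (1 + D))))
      + K powr (p / 2) * (a powr p * (Z * (C * (1 + ln (1 + D)))))" by linarith
  also have "\<dots> = (C powr p * C powr p + K powr (p / 2) * C powr p * C) * (a powr p * (X powr (1 - p / 4) * (1 + ln (1 + D))))"
    unfolding Z_def by (simp only: algebra_simps)
  finally show ?thesis .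
qed

lemma sub_integral:
  assumes "p \<ge> 1" "0 \<le> u" "u \<le> v" "v \<le> exp b"
  shows "integral {u..v} (f p) \<le> integral {0..exp b} (f p)"
  using assms by (intro integral_subset_le f_int) auto

text \<open>The contribution of the first crest alone; it is optimal for \<open>p \<ge> 4\<close>.\<close>

lemma I_lower_bump:
  assumes p: "p \<ge> 1"
  shows "1 / (2 * C * C powr p) * (a powr p * (h ^ 4) powr (1 - p / 4)) \<le> integral {0..exp b} (f p)"
proof -
  define M where "M = (a / (C * h)) powr p"
  have le: "s0 \<le> s1" using td by (simp add: turning_data_def)
  have "M * ((exp s1)\<^sup>2 - (exp s0)\<^sup>2) / 2 \<le> integral {exp s0..exp s1} (f p)"
  proof (rule has_integral_le[OF linear_integral integrable_integral[OF f_int[OF p]]])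
    fix t assume t: "t \<in> {exp s0..exp s1}"
    have t0: "t > 0" by (rule less_le_trans[OF exp_gt_zero[of s0]]) (use t in simp)
    have "ln (exp s0) \<le> ln t" "ln t \<le> ln (exp s1)" using t t0 by (auto simp only: ln_le_cancel_iff exp_gt_zero atLeastAtMost_iff)
    then have "ln t \<in> {s0..s1}" by simp
    then have "a \<le> C * (\<bar>wave n (ln t)\<bar> * h)" using td by (simp add: turning_data_def h_def a_def)
    then have "a / (C * h) \<le> \<bar>bessel_J n t\<bar>" using t0 C h by (simp add: wave_def pos_divide_le_eq mult_ac)
    then have "M \<le> \<bar>bessel_J n t\<bar> powr p" unfolding M_def using a_pos C h p by (intro powr_mono2) auto
    then show "M * t \<le> f p t" using t0 by (simp add: mult.commute mult_left_mono)
  qed (use le in simp)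
  moreover have "integral {exp s0..exp s1} (f p) \<le> integral {0..exp b} (f p)"
    using le b by (intro sub_integral p) auto
  moreover have "M * (h ^ 4 / C) / 2 \<le> M * ((exp s1)\<^sup>2 - (exp s0)\<^sup>2) / 2"
    using td C by (intro divide_right_mono mult_left_mono) (auto simp: M_def turning_data_def h_def pos_divide_le_eq mult.commute)
  moreover have "M * (h ^ 4 / C) / 2 = 1 / (2 * C * C powr p) * (a powr p * (h ^ 4) powr (1 - p / 4))"
  proof -
    have "(h ^ 4) powr (1 - p / 4) = h powr (4 - p)"
      using h by (simp add: powr_powr algebra_simps flip: powr_numeral)
    also have "\<dots> = h ^ 4 / h powr p" using h by (simp add: powr_diff)
    finally show ?thesis unfolding M_def using C a_pos h by (simp add: powr_divide powr_mult)
  qed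
  ultimately show ?thesis by linarith
qed

end

text \<open>A pointwise substitute for Hoelder's inequality on both sides of the exponent \<open>2\<close>: a
  bounded function with enough mass in the square mean has enough mass in every power mean.\<close>

lemma power_mean_lower:
  fixes x \<beta> M \<eta> p :: real
  assumes "0 \<le> x" "x \<le> M * \<beta>" "0 < \<beta>" "0 < \<eta>" "0 < M" "1 \<le> p"
  shows "min (M powr (p / 2 - 1)) (\<eta> powr (p / 2 - 1)) * \<beta> powr (p / 2 - 1) * (x - \<eta> * \<beta>) \<le> x powr (p / 2)"
proof (cases "x \<le> \<eta> * \<beta>")
  case True
  then have "min (M powr (p / 2 - 1)) (\<eta> powr (p / 2 - 1)) * \<beta> powr (p / 2 - 1) * (x - \<eta> * \<beta>) \<le> 0"
    by (intro mult_nonneg_nonpos) auto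
  then show ?thesis using powr_ge_zero[of x "p / 2"] by linarith
next
  case False
  then have x: "x > \<eta> * \<beta>" "\<eta> * \<beta> > 0" "x > 0" using assms by (auto intro: less_trans[of 0 "\<eta> * \<beta>"])
  have "min (M powr (p / 2 - 1)) (\<eta> powr (p / 2 - 1)) * \<beta> powr (p / 2 - 1) \<le> x powr (p / 2 - 1)"
  proof (cases "p / 2 - 1 \<le> 0")
    case True
    have "(M * \<beta>) powr (p / 2 - 1) \<le> x powr (p / 2 - 1)" using assms x True by (intro powr_mono2') auto
    moreover have "(M * \<beta>) powr (p / 2 - 1) = M powr (p / 2 - 1) * \<beta> powr (p / 2 - 1)" using assms by (simp add: powr_mult)
    ultimately show ?thesis using mult_right_mono[of "min (M powr (p / 2 - 1)) (\<eta> powr (p / 2 - 1))" "M powr (p / 2 - 1)" "\<beta> powr (p / 2 - 1)"] by simp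
  next
    case False
    have "(\<eta> * \<beta>) powr (p / 2 - 1) \<le> x powr (p / 2 - 1)" using assms x False by (intro powr_mono2) auto
    moreover have "(\<eta> * \<beta>) powr (p / 2 - 1) = \<eta> powr (p / 2 - 1) * \<beta> powr (p / 2 - 1)" using assms by (simp add: powr_mult)
    ultimately show ?thesis using mult_right_mono[of "min (M powr (p / 2 - 1)) (\<eta> powr (p / 2 - 1))" "\<eta> powr (p / 2 - 1)" "\<beta> powr (p / 2 - 1)"] by simp
  qed
  then have "min (M powr (p / 2 - 1)) (\<eta> powr (p / 2 - 1)) * \<beta> powr (p / 2 - 1) * (x - \<eta> * \<beta>) \<le> x powr (p / 2 - 1) * x"
    using x by (intro mult_mono) auto
  also have "\<dots> = x powr (p / 2)" using x by (simp add: powr_diff)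
  finally show ?thesis .
qed

context bessel_window
begin

text \<open>On the region where \<open>Q\<close> lies between \<open>D/(4 K\<^sup>4)\<close> and
  \<open>D\<close>, the square of the wave is at most a multiple of \<open>\<beta> =
  a\<^sup>2/\<surd>D\<close>, and this region carries at least half of the energy. So
  \<open>J\<^sub>n\<^sup>2\<close> is of size \<open>\<beta>\<close> on a fixed proportion of it.\<close>

lemma I_lower_bulk:
  assumes p: "p \<ge> 1" and big: "C * (4 * K ^ 4) * h ^ 4 \<le> D"
  defines "c \<equiv> min ((2 * K ^ 3) powr (p / 2 - 1)) ((1 / (4 * K)) powr (p / 2 - 1))"
  shows "c / (8 * K) * (a powr p * D powr (1 - p / 4)) \<le> integral {0..exp b} (f p)"
proof -
  \<comment> \<open>With this \<open>R\<close> the energy where \<open>Q = D/R\<close> is at most half of the energy at the boundary.\<close>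
  define R where "R = 4 * K ^ 4"
  have "sqrt (K ^ 4) = K\<^sup>2" by (rule real_sqrt_unique) (simp_all flip: power_mult)
  then have R: "R \<ge> 4" "sqrt R = 2 * K\<^sup>2" using K by (simp_all add: R_def real_sqrt_mult)
  have D: "D > 0" by (rule D_ge)
  define ta where "ta = sqrt ((real n)\<^sup>2 + D / R)"
  have ta: "ta > 0" "ta\<^sup>2 = (real n)\<^sup>2 + D / R"
    unfolding ta_def using D R by (auto intro: add_nonneg_pos)
  define sa where "sa = ln ta"
  have esa: "exp sa = ta" using ta by (simp add: sa_def)
  have Qa: "potential n sa = D / R" using ta by (simp add: potential_def esa)
  have "Q1 \<le> D / R"
  proof -
    have "C * h ^ 4 * R \<le> D" using big by (simp add: R_def mult_ac)
    then have "C * h ^ 4 \<le> D / R" using R by (simp add: pos_le_divide_eq)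
    then show ?thesis using Q1(2) by linarith
  qed
  then have s1a: "s1 \<le> sa" using potential_strict_mono[of sa s1 n] Qa by (fastforce simp: Q1_def)
  have "D / R \<le> D / 1" using D R by (intro divide_left_mono) auto
  then have sab: "sa \<le> b" using potential_strict_mono[of b sa n] Qa by (fastforce simp: D_def)
  have "exp sa \<le> exp b" using sab by (simp only: exp_le_cancel_iff)
  then have tab: "ta \<le> exp b" by (simp only: esa)
  define \<beta> where "\<beta> = a\<^sup>2 / sqrt D"
  have \<beta>: "\<beta> > 0" using a_pos(1) D by (simp add: \<beta>_def)
  define M where "M = 2 * K ^ 3"
  \<comment> \<open>small enough for the part with \<open>J\<^sub>n\<^sup>2 \<le> \<eta>\<beta>\<close> to carry at most half of the mass\<close>
  define \<eta> where "\<eta> = 1 / (4 * K)"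
  have M\<eta>: "M > 0" "\<eta> > 0" using K by (simp_all add: M_def \<eta>_def)
  have c: "c \<ge> 0" by (simp add: c_def)
  define w where "w = c * \<beta> powr (p / 2 - 1)"
  have w: "w \<ge> 0" using c by (simp add: w_def)
  have Jb: "(bessel_J n t)\<^sup>2 \<le> M * \<beta>" if t: "t \<in> {ta..exp b}" for t
  proof -
    have t0: "t > 0" using t ta by auto
    have st: "sa \<le> ln t" using t t0 ta by (simp add: sa_def)
    then have Qt: "D / R \<le> potential n (ln t)" using potential_mono[OF st, of n] Qa by simp
    have "(wave n (ln t))\<^sup>2 \<le> K * a\<^sup>2 / sqrt (potential n (ln t))" using sq_bound[of "ln t"] s1a st by simp
    also have "\<dots> \<le> K * a\<^sup>2 / sqrt (D / R)"
    proof (intro divide_left_mono real_sqrt_le_mono mult_pos_pos Qt)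
      have DR: "D / R > 0" using D R by simp
      then show "0 < sqrt (D / R)" by simp
      have "0 < potential n (ln t)" using DR Qt by linarith
      then show "0 < sqrt (potential n (ln t))" by simp
    qed (use K in simp)
    also have "\<dots> = M * \<beta>"
      unfolding real_sqrt_divide R(2) M_def \<beta>_def by (simp add: power2_eq_square power3_eq_cube)
    finally show ?thesis using t0 by (simp add: wave_def)
  qed
  have EI: "((\<lambda>t. 2 * t * (bessel_J n t)\<^sup>2) has_integral (energy n b - energy n sa)) {ta..exp b}"
  proof -
    have "((\<lambda>t. 2 * t * (bessel_J n t)\<^sup>2) has_integral (energy n (ln (exp b)) - energy n (ln ta))) {ta..exp b}"
    proof (rule fundamental_theorem_of_calculus)
      fix t assume t: "t \<in> {ta..exp b}"
      then have t0: "t > 0" using ta by auto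
      have "((\<lambda>t. energy n (ln t)) has_real_derivative (2 * (exp (ln t))\<^sup>2 * (wave n (ln t))\<^sup>2) * (1 / t)) (at t)"
        using t0 by (intro DERIV_chain2[OF energy_deriv]) (auto intro!: derivative_eq_intros)
      then have "((\<lambda>t. energy n (ln t)) has_real_derivative 2 * t * (bessel_J n t)\<^sup>2) (at t)"
        using t0 by (simp add: wave_def power2_eq_square mult_ac)
      then show "((\<lambda>t. energy n (ln t)) has_vector_derivative 2 * t * (bessel_J n t)\<^sup>2) (at t within {ta..exp b})"
        by (simp add: has_real_derivative_iff_has_vector_derivative has_vector_derivative_at_within)
    qed (use tab in simp)
    then show ?thesis by (simp add: sa_def)
  qed
  have Eb: "a\<^sup>2 * sqrt D / (2 * K) \<le> energy n b - energy n sa"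
  proof -
    have "amplitude_sq n s1 \<le> K * amplitude_sq n b" using comparable[OF order_refl b] by simp
    then have 1: "a\<^sup>2 * sqrt D \<le> K * energy n b" using D by (simp add: a_pos(2) amplitude_sq_def D_def pos_le_divide_eq)
    have "amplitude_sq n sa \<le> K * amplitude_sq n s1" using comparable[OF order_refl s1a] by simp
    then have "energy n sa \<le> K * a\<^sup>2 * sqrt (D / R)" using D R by (simp add: a_pos(2) amplitude_sq_def Qa pos_divide_le_eq)
    also have "\<dots> = a\<^sup>2 * sqrt D / (2 * K)" using K by (simp add: real_sqrt_divide R power2_eq_square)
    finally have 2: "energy n sa \<le> a\<^sup>2 * sqrt D / (2 * K)" .
    have "a\<^sup>2 * sqrt D / K \<le> energy n b" using 1 K by (simp add: pos_divide_le_eq mult.commute)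
    moreover have "a\<^sup>2 * sqrt D / K = 2 * (a\<^sup>2 * sqrt D / (2 * K))" by simp
    ultimately show ?thesis using 2 by linarith
  qed
  have "((\<lambda>t. w / 2 * (2 * t * (bessel_J n t)\<^sup>2) - w * \<eta> * \<beta> * t) has_integral
     (w / 2 * (energy n b - energy n sa) - w * \<eta> * \<beta> * ((exp b)\<^sup>2 - ta\<^sup>2) / 2)) {ta..exp b}"
    by (intro has_integral_diff has_integral_mult_right EI linear_integral tab)
  then have "w / 2 * (energy n b - energy n sa) - w * \<eta> * \<beta> * ((exp b)\<^sup>2 - ta\<^sup>2) / 2 \<le> integral {ta..exp b} (f p)"
  proof (rule has_integral_le[OF _ integrable_integral[OF f_int[OF p]]])
    fix t assume t: "t \<in> {ta..exp b}"
    have t0: "t > 0" using t ta by auto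
    have "(bessel_J n t)\<^sup>2 = \<bar>bessel_J n t\<bar> powr 2" by simp
    then have pw: "((bessel_J n t)\<^sup>2) powr (p / 2) = \<bar>bessel_J n t\<bar> powr p" by (simp only: powr_powr) simp
    have "w * ((bessel_J n t)\<^sup>2 - \<eta> * \<beta>) \<le> \<bar>bessel_J n t\<bar> powr p"
      using power_mean_lower[OF zero_le_power2 Jb[OF t] \<beta> M\<eta>(2,1) p] unfolding pw w_def c_def M_def \<eta>_def .
    then have "t * (w * ((bessel_J n t)\<^sup>2 - \<eta> * \<beta>)) \<le> f p t" using t0 by (intro mult_left_mono) auto
    then show "w / 2 * (2 * t * (bessel_J n t)\<^sup>2) - w * \<eta> * \<beta> * t \<le> f p t" by (simp add: algebra_simps)
  qed
  also have "integral {ta..exp b} (f p) \<le> integral {0..exp b} (f p)" using ta tab by (intro sub_integral p) auto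
  finally have I: "w / 2 * (energy n b - energy n sa) - w * \<eta> * \<beta> * ((exp b)\<^sup>2 - ta\<^sup>2) / 2 \<le> integral {0..exp b} (f p)" .
  have \<beta>D: "a\<^sup>2 * sqrt D = \<beta> * D"
  proof -
    have "D / sqrt D = sqrt D" by (rule real_div_sqrt) (use D in simp)
    moreover have "\<beta> * D = a\<^sup>2 * (D / sqrt D)" by (simp add: \<beta>_def)
    ultimately show ?thesis by (simp only:)
  qed
  have "w / 2 * (\<beta> * D / (2 * K)) \<le> w / 2 * (energy n b - energy n sa)"
    using Eb w unfolding \<beta>D by (intro mult_left_mono) auto
  moreover have "w * \<eta> * \<beta> * ((exp b)\<^sup>2 - ta\<^sup>2) / 2 \<le> w * \<eta> * \<beta> * D / 2"
  proof (intro divide_right_mono mult_left_mono)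
    have "0 \<le> D / R" using D R by simp
    moreover have "(exp b)\<^sup>2 = (real n)\<^sup>2 + D" by (simp add: D_def potential_def)
    ultimately show "(exp b)\<^sup>2 - ta\<^sup>2 \<le> D" unfolding ta(2) by linarith
  qed (use w M\<eta> \<beta> in auto)
  moreover have "w / 2 * (\<beta> * D / (2 * K)) - w * \<eta> * \<beta> * D / 2 = w * \<beta> * D / (8 * K)"
    using K by (simp add: \<eta>_def field_simps)
  moreover have "w * \<beta> * D / (8 * K) = c / (8 * K) * (a powr p * D powr (1 - p / 4))"
  proof -
    have "\<beta> powr (p / 2 - 1) * \<beta> = \<beta> powr (p / 2)" using \<beta> by (simp add: powr_diff)
    also have "\<beta> powr (p / 2) = a powr p / D powr (p / 4)"
    proof -
      have "(a\<^sup>2) powr (p / 2) = a powr p" using a_pos(1) by (simp add: powr_powr flip: powr_numeral)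
      moreover have "sqrt D powr (p / 2) = D powr (p / 4)" using D by (simp add: powr_powr flip: powr_half_sqrt)
      ultimately show ?thesis using a_pos(1) D by (simp add: \<beta>_def powr_divide)
    qed
    finally have \<beta>p: "\<beta> powr (p / 2 - 1) * \<beta> = a powr p / D powr (p / 4)" .
    have "w * \<beta> = c * (\<beta> powr (p / 2 - 1) * \<beta>)" by (simp add: w_def)
    then have "w * \<beta> = c * (a powr p / D powr (p / 4))" by (simp only: \<beta>p)
    moreover have "D powr (1 - p / 4) = D / D powr (p / 4)" using D by (simp add: powr_diff)
    ultimately show ?thesis by (simp add: mult_ac)
  qed
  ultimately show ?thesis using I by linarith
qed

text \<open>For \<open>p < 4\<close> the outer part dominates; if \<open>D\<close> is within a constant factor
  of \<open>h\<^sup>4\<close>, the crest already suffices.\<close>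

lemma I_lower:
  assumes p: "p \<ge> 1"
  defines "X \<equiv> if p < 4 then D else h ^ 4"
    and "c \<equiv> min ((2 * K ^ 3) powr (p / 2 - 1)) ((1 / (4 * K)) powr (p / 2 - 1)) / (8 * K)"
    and "c' \<equiv> 1 / (2 * C * C powr p) * (C * (4 * K ^ 4)) powr (- \<bar>1 - p / 4\<bar>)"
  shows "min c c' * (a powr p * X powr (1 - p / 4)) \<le> integral {0..exp b} (f p)"
proof -
  have base: "1 \<le> C * (4 * K ^ 4)"
  proof -
    have "1 \<le> K ^ 4" using K by simp
    then have "1 \<le> 4 * K ^ 4" by linarith
    then have "1 * 1 \<le> C * (4 * K ^ 4)" using C by (intro mult_mono) auto
    then show ?thesis by simp
  qed
  have D: "D > 0" by (rule D_ge)
  have P: "0 \<le> a powr p * X powr (1 - p / 4)" by simp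
  have c': "c' * (a powr p * X powr (1 - p / 4)) \<le> integral {0..exp b} (f p)"
    if le: "X powr (1 - p / 4) * (C * (4 * K ^ 4)) powr (- \<bar>1 - p / 4\<bar>) \<le> (h ^ 4) powr (1 - p / 4)"
  proof -
    have "c' * (a powr p * X powr (1 - p / 4)) = 1 / (2 * C * C powr p) * (a powr p * (X powr (1 - p / 4) * (C * (4 * K ^ 4)) powr (- \<bar>1 - p / 4\<bar>)))"
      by (simp add: c'_def)
    also have "\<dots> \<le> 1 / (2 * C * C powr p) * (a powr p * (h ^ 4) powr (1 - p / 4))"
      by (rule mult_left_mono[OF mult_left_mono[OF le]]) (use C in auto)
    also have "\<dots> \<le> integral {0..exp b} (f p)" by (rule I_lower_bump[OF p])
    finally show ?thesis .
  qed
  show ?thesis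
  proof (cases "p < 4 \<and> C * (4 * K ^ 4) * h ^ 4 \<le> D")
    case True
    have "min c c' * (a powr p * X powr (1 - p / 4)) \<le> c * (a powr p * X powr (1 - p / 4))"
      using P by (intro mult_right_mono) auto
    also have "\<dots> \<le> integral {0..exp b} (f p)"
      using I_lower_bulk[OF p] True unfolding c_def X_def by simp
    finally show ?thesis .
  next
    case False
    have "X powr (1 - p / 4) * (C * (4 * K ^ 4)) powr (- \<bar>1 - p / 4\<bar>) \<le> (h ^ 4) powr (1 - p / 4)"
    proof (cases "p < 4")
      case True
      then have "D \<le> C * (4 * K ^ 4) * h ^ 4" using False by simp
      then have "D powr (1 - p / 4) \<le> (C * (4 * K ^ 4) * h ^ 4) powr (1 - p / 4)" using True D by (intro powr_mono2) auto
      also have "\<dots> = (C * (4 * K ^ 4)) powr (1 - p / 4) * (h ^ 4) powr (1 - p / 4)"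
        by (rule powr_mult)
      finally have "D powr (1 - p / 4) * (C * (4 * K ^ 4)) powr (- (1 - p / 4))
        \<le> (C * (4 * K ^ 4)) powr (1 - p / 4) * (h ^ 4) powr (1 - p / 4) * (C * (4 * K ^ 4)) powr (- (1 - p / 4))"
        by (intro mult_right_mono) auto
      also have "\<dots> = (h ^ 4) powr (1 - p / 4) * ((C * (4 * K ^ 4)) powr (1 - p / 4) * (C * (4 * K ^ 4)) powr (- (1 - p / 4)))"
        by (simp only: mult_ac)
      also have "(C * (4 * K ^ 4)) powr (1 - p / 4) * (C * (4 * K ^ 4)) powr (- (1 - p / 4)) = 1"
        using base C K unfolding powr_add[symmetric] by simp
      finally show ?thesis using True by (simp add: X_def)
    next
      case False
      have "(C * (4 * K ^ 4)) powr (- \<bar>1 - p / 4\<bar>) \<le> (C * (4 * K ^ 4)) powr 0"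
        using base by (intro powr_mono) auto
      also have "\<dots> \<le> 1" by simp
      finally have "(C * (4 * K ^ 4)) powr (- \<bar>1 - p / 4\<bar>) \<le> 1" .
      from mult_left_mono[OF this, of "(h ^ 4) powr (1 - p / 4)"] show ?thesis using False by (simp add: X_def)
    qed
    then have "c' * (a powr p * X powr (1 - p / 4)) \<le> integral {0..exp b} (f p)" by (rule c')
    moreover have "min c c' * (a powr p * X powr (1 - p / 4)) \<le> c' * (a powr p * X powr (1 - p / 4))"
      using P by (intro mult_right_mono) auto
    ultimately show ?thesis by linarith
  qed
qed

lemma J_upper:
  assumes "0 < t"
  shows "\<bar>bessel_J n t\<bar> \<le> C * K * (a / h)"
proof (cases "ln t \<le> s1")
  case True
  then have "\<bar>wave n (ln t)\<bar> * h \<le> C * a" using td by (simp add: turning_data_def h_def a_def)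
  then have "\<bar>bessel_J n t\<bar> \<le> C * a / h" using assms h by (simp add: wave_def pos_le_divide_eq)
  also have "\<dots> = 1 * (C * a / h)" by simp
  also have "\<dots> \<le> K * (C * a / h)" by (rule mult_right_mono[OF K]) (use C a_pos(1) h in simp)
  finally show ?thesis by (simp add: mult_ac)
next
  case False
  then have s: "s1 \<le> ln t" by simp
  have "(bessel_J n t)\<^sup>2 \<le> K * a\<^sup>2 / sqrt (potential n (ln t))" using sq_bound[OF s] assms by (simp add: wave_def)
  also have "\<dots> \<le> K * a\<^sup>2 / (h\<^sup>2 / C)"
  proof (rule divide_left_mono)
    have "(h\<^sup>2 / C)\<^sup>2 = h ^ 4 / C\<^sup>2" by (simp add: power_divide flip: power_mult)
    also have "\<dots> \<le> h ^ 4 / C" using C h by (intro divide_left_mono) (auto simp: power2_eq_square mult_le_cancel_right1)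
    also have "\<dots> \<le> Q1" using Q1(1) C by (simp add: pos_divide_le_eq mult.commute)
    also have "\<dots> \<le> potential n (ln t)" by (rule Q_ge[OF s])
    finally show 1: "h\<^sup>2 / C \<le> sqrt (potential n (ln t))" by (rule real_le_rsqrt)
    have "0 < h\<^sup>2 / C" using h C by simp
    moreover from this 1 have "0 < sqrt (potential n (ln t))" by (rule less_le_trans)
    ultimately show "0 < sqrt (potential n (ln t)) * (h\<^sup>2 / C)" by (rule mult_pos_pos[rotated])
  qed (use K in simp)
  also have "\<dots> = (C * K) * (a / h)\<^sup>2" by (simp add: power_divide)
  also have "\<dots> \<le> (C * K)\<^sup>2 * (a / h)\<^sup>2"
  proof (rule mult_right_mono)
    have "1 * 1 \<le> C * K" using C K by (intro mult_mono) auto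
    then show "C * K \<le> (C * K)\<^sup>2" by (simp add: power2_eq_square mult_le_cancel_left1)
  qed simp
  also have "\<dots> = (C * K * (a / h))\<^sup>2" by (rule power_mult_distrib[symmetric])
  finally have "\<bar>bessel_J n t\<bar>\<^sup>2 \<le> (C * K * (a / h))\<^sup>2" by (simp only: power2_abs)
  then show ?thesis by (rule power2_le_imp_le) (use C K a_pos(1) h in simp)
qed

lemma J_lower: "\<exists>t. 0 < t \<and> t < exp b \<and> a / h \<le> C * \<bar>bessel_J n t\<bar>"
proof (intro exI conjI)
  have "h ^ 4 \<le> C * ((exp s1)\<^sup>2 - (exp s0)\<^sup>2)" using td by (simp add: turning_data_def h_def)
  then have "s0 \<noteq> s1" using h by auto
  then have "s0 < s1" using td by (simp add: turning_data_def)
  then show "exp s0 < exp b" using b by simp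
  have "a \<le> C * (\<bar>wave n s0\<bar> * h)" using td by (simp add: turning_data_def h_def a_def)
  then show "a / h \<le> C * \<bar>bessel_J n (exp s0)\<bar>" using h by (simp add: wave_def pos_divide_le_eq mult_ac)
qed simp

text \<open>The energy at the boundary, hence the normalizing constant, in terms of the amplitude.\<close>

lemma energy_comparable: "energy n b \<le> K * (a\<^sup>2 * sqrt D)" "a\<^sup>2 * sqrt D \<le> K * energy n b"
proof -
  have D: "sqrt D > 0" using D_ge by simp
  have e: "energy n b = amplitude_sq n b * sqrt D" using D by (simp add: amplitude_sq_def D_def)
  have c: "amplitude_sq n b \<le> K * a\<^sup>2" "a\<^sup>2 \<le> K * amplitude_sq n b" unfolding a_pos(2) using comparable[OF order_refl b] by auto
  show "energy n b \<le> K * (a\<^sup>2 * sqrt D)" using mult_right_mono[OF c(1), of "sqrt D"] D unfolding e by (simp add: mult_ac)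
  show "a\<^sup>2 * sqrt D \<le> K * energy n b" using mult_right_mono[OF c(2), of "sqrt D"] D unfolding e by (simp add: mult_ac)
qed

end

section \<open>Norms of the eigenfunctions\<close>

text \<open>The constant comes from the mean square of \<open>cos (n\<theta>)\<close>, which is
  \<open>1\<close> for \<open>n = 0\<close> and \<open>1/2\<close> otherwise.\<close>

definition eig_const :: "nat \<Rightarrow> real" where
  "eig_const n = (if n = 0 then 1 / sqrt pi else sqrt (2 / pi))"

text \<open>The common form of the radial factor for both boundary conditions, normalized by the energy at the
  boundary.\<close>

definition eig_radial :: "nat \<Rightarrow> real \<Rightarrow> real \<Rightarrow> real" where
  "eig_radial n \<mu> r = eig_const n * (\<mu> / sqrt (energy n (ln \<mu>))) * bessel_J n (\<mu> * r)"

lemma eig_radial_cont: "continuous_on S (eig_radial n \<mu>)"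
  unfolding eig_radial_def[abs_def] by (intro continuous_intros)

lemma eig_radial_0: "n \<ge> 1 \<Longrightarrow> eig_radial n \<mu> 0 = 0"
  by (simp add: eig_radial_def bessel_J_at_0)

lemma angular_eq_cos:
  assumes "z \<noteq> 0"
  shows "angular n z = cos (real n * Arg z)"
proof -
  have "cis (Arg z) = sgn z" using assms by (rule cis_Arg)
  then have "sgn z ^ n = cis (real n * Arg z)" by (metis Complex.DeMoivre)
  then show ?thesis by (simp add: angular_def)
qed

lemma freq_potential: "m \<ge> 1 \<Longrightarrow> potential n (ln (freq B n m)) = (freq B n m)\<^sup>2 - (real n)\<^sup>2"
  using freq_works(1)[of m B n] by (simp add: potential_def)

text \<open>At a Dirichlet frequency the energy is \<open>\<mu>\<^sup>2
  J\<^bsub>n+1\<^esub>(\<mu>)\<^sup>2\<close>, at a Neumann frequency it is \<open>(\<mu>\<^sup>2 - n\<^sup>2)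
  J\<^sub>n(\<mu>)\<^sup>2\<close>; in both cases its root divided by \<open>\<mu>\<close> is the denominator
  of the normalized eigenfunction.\<close>

lemma eigfun_eq:
  assumes m: "m \<ge> 1"
  shows "eigfun B n m z = eig_radial n (freq B n m) (cmod z) * angular n z"
proof -
  define \<mu> where "\<mu> = freq B n m"
  have \<mu>: "\<mu> > 0" "boundary_value B n (ln \<mu>) = 0" using freq_works[OF m] by (simp_all add: \<mu>_def)
  have E0: "energy n (ln \<mu>) > 0" by (rule energy_pos)
  have W: "wave n (ln \<mu>) = bessel_J n \<mu>" using \<mu> by (simp add: wave_def)
  have ang: "bessel_J n (\<mu> * cmod z) * angular n z = bessel_J n (\<mu> * cmod z) * cos (real n * Arg z)"
  proof (cases "z = 0")
    case True
    then show ?thesis by (cases "n = 0") (simp_all add: bessel_J_at_0 angular_def)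
  next
    case False then show ?thesis by (simp add: angular_eq_cos)
  qed
  show ?thesis
  proof (cases B)
    case Dirichlet
    have \<mu>j: "\<mu> = j_zero n m" using Dirichlet by (simp add: \<mu>_def freq_simps)
    have J: "bessel_J n \<mu> = 0" using \<mu> Dirichlet W by (simp add: boundary_value_def)
    then have "energy n (ln \<mu>) = (\<mu> * bessel_J (n + 1) \<mu>)\<^sup>2" using \<mu> W by (simp add: energy_def slope_def)
    then have "sqrt (energy n (ln \<mu>)) = \<mu> * \<bar>bessel_J (n + 1) \<mu>\<bar>" using \<mu> by (simp add: abs_mult)
    then have "\<mu> / sqrt (energy n (ln \<mu>)) = 1 / \<bar>bessel_J (n + 1) \<mu>\<bar>" using \<mu> by simp
    then have "eig_radial n \<mu> (cmod z) * angular n z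
       = eig_const n * (1 / \<bar>bessel_J (n + 1) \<mu>\<bar>) * (bessel_J n (\<mu> * cmod z) * cos (real n * Arg z))"
      unfolding eig_radial_def ang[symmetric] by simp
    then show ?thesis unfolding \<mu>_def[symmetric] unfolding \<mu>j
      by (simp add: eigfun_def Dirichlet eig_const_def)
  next
    case Neumann
    have \<mu>j: "\<mu> = rho_zero n m" using Neumann by (simp add: \<mu>_def freq_simps)
    have V: "slope n (ln \<mu>) = 0" using \<mu> Neumann by (simp add: boundary_value_def)
    have Q: "potential n (ln \<mu>) = \<mu>\<^sup>2 - (real n)\<^sup>2" using \<mu> by (simp add: potential_def)
    then have E: "energy n (ln \<mu>) = (\<mu>\<^sup>2 - (real n)\<^sup>2) * (bessel_J n \<mu>)\<^sup>2" using V W by (simp add: energy_def)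
    then have Qp: "\<mu>\<^sup>2 - (real n)\<^sup>2 > 0" using E0 by (simp add: zero_less_mult_iff)
    have "\<mu> / sqrt (energy n (ln \<mu>)) = \<mu> / sqrt (\<mu>\<^sup>2 - (real n)\<^sup>2) * (1 / \<bar>bessel_J n \<mu>\<bar>)"
      by (simp add: E real_sqrt_mult)
    moreover have "\<mu> / sqrt (\<mu>\<^sup>2 - (real n)\<^sup>2) = sqrt (1 / (1 - (real n)\<^sup>2 / \<mu>\<^sup>2))"
    proof -
      have "1 / (1 - (real n)\<^sup>2 / \<mu>\<^sup>2) = \<mu>\<^sup>2 / (\<mu>\<^sup>2 - (real n)\<^sup>2)" using \<mu> by (simp add: field_simps)
      then show ?thesis using \<mu> by (simp add: real_sqrt_divide)
    qed
    ultimately have "eig_radial n \<mu> (cmod z) * angular n z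
       = eig_const n * sqrt (1 / (1 - (real n)\<^sup>2 / \<mu>\<^sup>2)) * (1 / \<bar>bessel_J n \<mu>\<bar>) * (bessel_J n (\<mu> * cmod z) * cos (real n * Arg z))"
      unfolding eig_radial_def ang[symmetric] by simp
    moreover have "sqrt (2 / (pi * x)) = sqrt (2 / pi) * sqrt (1 / x)" for x
      by (simp add: real_sqrt_mult[symmetric])
    ultimately show ?thesis unfolding \<mu>_def[symmetric] unfolding \<mu>j
      by (simp add: eigfun_def Neumann eig_const_def)
  qed
qed

lemma eig_const_pos: "eig_const n > 0"
  by (simp add: eig_const_def)

lemma eig_const_bound: "\<bar>ln (eig_const n)\<bar> \<le> \<bar>ln (1 / sqrt pi)\<bar> + \<bar>ln (sqrt (2 / pi))\<bar>"
  unfolding eig_const_def by auto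

lemma radial_Lp_integral:
  assumes \<mu>: "\<mu> > 0" and p: "p \<ge> 1"
  shows "integral {0..1} (\<lambda>r. r * \<bar>eig_radial n \<mu> r\<bar> powr p)
    = (eig_const n * (\<mu> / sqrt (energy n (ln \<mu>)))) powr p * (integral {0..\<mu>} (\<lambda>t. t * \<bar>bessel_J n t\<bar> powr p) / \<mu>\<^sup>2)"
proof -
  define f where "f = (\<lambda>t. t * \<bar>bessel_J n t\<bar> powr p)"
  define A where "A = eig_const n * (\<mu> / sqrt (energy n (ln \<mu>)))"
  have A: "A \<ge> 0" using \<mu> eig_const_pos[of n] energy_pos[of n "ln \<mu>"] by (simp add: A_def)
  have "continuous_on {0..\<mu>} f" unfolding f_def using p by (intro continuous_intros continuous_on_powr') auto
  then have "(f has_integral integral {0..\<mu>} f) (cbox 0 \<mu>)"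
    by (simp add: integrable_integral integrable_continuous_interval)
  from has_integral_affinity[OF this, of \<mu> 0] \<mu>
  have "((\<lambda>r. f (\<mu> * r)) has_integral (integral {0..\<mu>} f / \<mu>)) ((\<lambda>x. x / \<mu>) ` {0..\<mu>})"
    by (simp add: divide_inverse mult.commute)
  moreover have "(\<lambda>x. x / \<mu>) ` {0..\<mu>} = {0..1}" using \<mu> by (simp add: image_divide_atLeastAtMost)
  ultimately have "((\<lambda>r. f (\<mu> * r)) has_integral (integral {0..\<mu>} f / \<mu>)) {0..1}" by simp
  from has_integral_mult_right[OF this, of "A powr p / \<mu>"]
  have "((\<lambda>r. A powr p / \<mu> * f (\<mu> * r)) has_integral (A powr p * (integral {0..\<mu>} f / \<mu>\<^sup>2))) {0..1}"
    by (simp add: power2_eq_square)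
  moreover have "A powr p / \<mu> * f (\<mu> * r) = r * \<bar>eig_radial n \<mu> r\<bar> powr p" if "r \<in> {0..1}" for r
  proof -
    have "\<bar>eig_radial n \<mu> r\<bar> powr p = A powr p * \<bar>bessel_J n (\<mu> * r)\<bar> powr p"
      unfolding eig_radial_def A_def[symmetric] using A by (simp add: abs_mult powr_mult)
    then show ?thesis using \<mu> by (simp add: f_def)
  qed
  ultimately have "((\<lambda>r. r * \<bar>eig_radial n \<mu> r\<bar> powr p) has_integral (A powr p * (integral {0..\<mu>} f / \<mu>\<^sup>2))) {0..1}"
    by (rule has_integral_eq[rotated])
  then show ?thesis by (simp add: integral_unique A_def f_def)
qed

text \<open>Two-sided bounds with multiplicative constants become additive errors; the factor \<open>l\<close>
  is the logarithmic loss.\<close>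

lemma ln_between:
  fixes x y l c1 c2 :: real
  assumes "0 < c1" "0 < c2" "0 < x" "1 \<le> l" "c1 * x \<le> y" "y \<le> c2 * (x * l)"
  shows "\<bar>ln y - ln x\<bar> \<le> \<bar>ln c1\<bar> + \<bar>ln c2\<bar> + ln l"
proof -
  have "0 < c1 * x" using assms by simp
  then have y: "y > 0" using assms by linarith
  have "ln (c1 * x) \<le> ln y" using \<open>0 < c1 * x\<close> assms y by (subst ln_le_cancel_iff) auto
  moreover have "ln y \<le> ln (c2 * (x * l))" using assms y by (subst ln_le_cancel_iff) auto
  moreover have "ln (c1 * x) = ln c1 + ln x" "ln (c2 * (x * l)) = ln c2 + (ln x + ln l)"
    using assms by (simp_all add: ln_mult)
  moreover have "ln l \<ge> 0" using assms by simp
  ultimately show ?thesis by linarith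
qed

text \<open>The logarithm of \<open>\<mu>\<^bsup>1-2\<tau>\<^esup> D\<^bsup>-1/4\<^esup>
  X\<^bsup>\<tau>-1/4\<^esup>\<close> with \<open>\<tau> = 1/p\<close>.\<close>

definition main_term :: "real \<Rightarrow> real \<Rightarrow> real \<Rightarrow> real \<Rightarrow> real" where
  "main_term \<tau> \<mu> D X = (1 - 2 * \<tau>) * ln \<mu> - ln D / 4 + (\<tau> - 1 / 4) * ln X"

text \<open>The value of the potential at which the \<open>p\<close>-th power of the wave carries its mass: at
  the boundary of the disk or at the first crest.\<close>

definition window_level :: "bool \<Rightarrow> nat \<Rightarrow> real \<Rightarrow> real" where
  "window_level bulk n D = (if bulk then D else cbrt_n n ^ 4)"

lemma uniform_windows:
  "\<exists>C\<ge>1. \<exists>K\<ge>1. \<forall>n B m. m \<ge> 1 \<longrightarrow> (\<exists>s0 s1. bessel_window C K n s0 s1 (ln (freq B n m)))"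
proof -
  obtain C where C: "C \<ge> 1" "\<And>n. \<exists>s0 s1. turning_data C n s0 s1" using turning_data_uniform by blast
  have "1 / C > 0" using C by simp
  from amplitude_sq_almost_constant[OF this] obtain K where K: "K \<ge> 1"
    "\<And>n s t. 1 / C * cbrt_n n ^ 4 \<le> potential n s \<Longrightarrow> s \<le> t \<Longrightarrow> amplitude_sq n t \<le> K * amplitude_sq n s \<and> amplitude_sq n s \<le> K * amplitude_sq n t"
    by blast
  have "\<exists>s0 s1. bessel_window C K n s0 s1 (ln (freq B n m))" if m: "m \<ge> 1" for n B m
  proof -
    obtain s0 s1 where td: "turning_data C n s0 s1" using C by blast
    have "cbrt_n n ^ 4 \<le> C * potential n s1" using td by (simp add: turning_data_def)
    then have Q: "1 / C * cbrt_n n ^ 4 \<le> potential n s1" using C(1) by (simp add: pos_divide_le_eq mult.commute)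
    have "bessel_window C K n s0 s1 (ln (freq B n m))"
    proof
      fix s t assume st: "s1 \<le> s" "s \<le> t"
      have "1 / C * cbrt_n n ^ 4 \<le> potential n s" using Q potential_mono[OF st(1), of n] by linarith
      then show "amplitude_sq n t \<le> K * amplitude_sq n s \<and> amplitude_sq n s \<le> K * amplitude_sq n t" using K(2) st(2) by blast
    next
      show "s1 \<le> ln (freq B n m)"
        using td freq_works(2)[OF m, of B n] unfolding turning_data_def
        by (cases B) (auto simp: boundary_value_def not_less[symmetric])
    qed (use C K td in auto)
    then show ?thesis by blast
  qed
  then show ?thesis using C(1) K(1) by blast
qed

context bessel_window
begin

lemma ln_energy: "\<bar>ln (energy n b) - (2 * ln a + ln D / 2)\<bar> \<le> ln K"
proof -
  have pos: "a\<^sup>2 * sqrt D > 0" using a_pos(1) D_ge by simp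
  have E: "energy n b > 0" by (rule energy_pos)
  have "ln (energy n b) \<le> ln (K * (a\<^sup>2 * sqrt D))" using energy_comparable(1) E by (subst ln_le_cancel_iff) (use K pos in auto)
  moreover have "ln (a\<^sup>2 * sqrt D) \<le> ln (K * energy n b)" using energy_comparable(2) pos by (subst ln_le_cancel_iff) (use K E in auto)
  moreover have "ln (K * (a\<^sup>2 * sqrt D)) = ln K + ln (a\<^sup>2 * sqrt D)" "ln (K * energy n b) = ln K + ln (energy n b)"
    by (rule ln_mult_pos; use K pos E in simp)+
  moreover have "ln (a\<^sup>2 * sqrt D) = 2 * ln a + ln D / 2"
    using a_pos(1) D_ge by (simp add: ln_mult ln_realpow ln_sqrt)
  ultimately show ?thesis by linarith
qed

lemma ln_Lp_integral:
  assumes p: "p \<ge> 1"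
  defines "X \<equiv> window_level (p < 4) n D"
    and "c \<equiv> min ((2 * K ^ 3) powr (p / 2 - 1)) ((1 / (4 * K)) powr (p / 2 - 1)) / (8 * K)"
    and "c' \<equiv> 1 / (2 * C * C powr p) * (C * (4 * K ^ 4)) powr (- \<bar>1 - p / 4\<bar>)"
    and "d \<equiv> C powr p * C powr p + K powr (p / 2) * C powr p * C"
  shows "integral {0..exp b} (f p) > 0"
    "\<bar>ln (integral {0..exp b} (f p)) - (p * ln a + (1 - p / 4) * ln X)\<bar> \<le> \<bar>ln (min c c')\<bar> + \<bar>ln d\<bar> + ln (1 + ln (1 + D))"
proof -
  have X: "X = (if p < 4 then D else h ^ 4)" by (simp add: X_def window_level_def h_def)
  have Xp: "X > 0" using D_ge h by (simp add: X)
  have cp: "min c c' > 0" using C K by (auto simp: c_def c'_def)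
  have dp: "d > 0" using C K by (simp add: d_def add_pos_pos)
  have pos: "a powr p * X powr (1 - p / 4) > 0" using a_pos(1) Xp by simp
  have low: "min c c' * (a powr p * X powr (1 - p / 4)) \<le> integral {0..exp b} (f p)"
    using I_lower[OF p] unfolding X c_def c'_def .
  have "0 < min c c' * (a powr p * X powr (1 - p / 4))" using pos cp by (rule mult_pos_pos[rotated])
  then show "integral {0..exp b} (f p) > 0" using low by linarith
  have "integral {0..exp b} (f p) \<le> d * ((a powr p * X powr (1 - p / 4)) * (1 + ln (1 + D)))"
    using I_upper[OF p] unfolding X[symmetric] d_def by (simp only: mult.assoc)
  moreover have "1 \<le> 1 + ln (1 + D)" using log_ratio_le(2) by simp
  ultimately have "\<bar>ln (integral {0..exp b} (f p)) - ln (a powr p * X powr (1 - p / 4))\<bar>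
    \<le> \<bar>ln (min c c')\<bar> + \<bar>ln d\<bar> + ln (1 + ln (1 + D))"
    by (intro ln_between cp dp pos low)
  moreover have "ln (a powr p * X powr (1 - p / 4)) = p * ln a + (1 - p / 4) * ln X"
    using a_pos(1) Xp by (simp add: ln_mult ln_powr)
  ultimately show "\<bar>ln (integral {0..exp b} (f p)) - (p * ln a + (1 - p / 4) * ln X)\<bar> \<le> \<bar>ln (min c c')\<bar> + \<bar>ln d\<bar> + ln (1 + ln (1 + D))"
    by simp
qed

end

text \<open>The amplitude enters the power integral as \<open>a\<^sup>p\<close> and the energy as
  \<open>a\<^sup>2\<close>, so it cancels in the normalized norm.\<close>

lemma norm_estimate_finite:
  assumes p: "p \<ge> 1"
  shows "\<exists>c\<ge>0. \<forall>n B m. m \<ge> 1 \<longrightarrow> (let \<mu> = freq B n m; D = \<mu>\<^sup>2 - (real n)\<^sup>2 in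
     \<bar>ln (disk_norm (ereal p) (eigfun B n m)) - main_term (1 / p) \<mu> D (window_level (p < 4) n D)\<bar>
       \<le> c + ln (1 + ln (1 + D)))"
proof -
  obtain C K where C: "C \<ge> 1" and K: "K \<ge> 1"
    and win: "\<And>n B m. m \<ge> 1 \<Longrightarrow> \<exists>s0 s1. bessel_window C K n s0 s1 (ln (freq B n m))"
    using uniform_windows by blast
  define c where "c = \<bar>ln (min (min ((2 * K ^ 3) powr (p / 2 - 1)) ((1 / (4 * K)) powr (p / 2 - 1)) / (8 * K))
      (1 / (2 * C * C powr p) * (C * (4 * K ^ 4)) powr (- \<bar>1 - p / 4\<bar>)))\<bar>
      + \<bar>ln (C powr p * C powr p + K powr (p / 2) * C powr p * C)\<bar>"
  define k where "k = \<bar>ln (1 / sqrt pi)\<bar> + \<bar>ln (sqrt (2 / pi))\<bar>"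
  define k2 where "k2 = \<bar>ln ((1 / 2) powr p * pi)\<bar> + \<bar>ln (2 * pi)\<bar>"
  define c0 where "c0 = k2 / p + k + ln K / 2 + c / p"
  have c0: "c0 \<ge> 0" using p K by (simp add: c0_def k2_def k_def c_def)
  show ?thesis
  proof (intro exI[of _ c0] conjI allI impI c0)
    fix n B m assume m: "(1::nat) \<le> m"
    define \<mu> where "\<mu> = freq B n m"
    define D where "D = \<mu>\<^sup>2 - (real n)\<^sup>2"
    have \<mu>: "\<mu> > 0" using freq_works[OF m] by (simp add: \<mu>_def)
    obtain s0 s1 where w: "bessel_window C K n s0 s1 (ln \<mu>)" using win[OF m] unfolding \<mu>_def by blast
    interpret w: bessel_window C K n s0 s1 "ln \<mu>" by (rule w)
    have wD: "w.D = D" using \<mu> by (simp add: w.D_def D_def potential_def)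
    define X where "X = window_level (p < 4) n D"
    define I where "I = integral {0..\<mu>} (\<lambda>t. t * \<bar>bessel_J n t\<bar> powr p)"
    have I: "I > 0" "\<bar>ln I - (p * ln w.a + (1 - p / 4) * ln X)\<bar> \<le> c + ln (1 + ln (1 + D))"
      using w.ln_Lp_integral[OF p] \<mu> unfolding wD X_def c_def I_def by simp_all
    define E where "E = energy n (ln \<mu>)"
    have E: "E > 0" "\<bar>ln E - (2 * ln w.a + ln D / 2)\<bar> \<le> ln K"
      using w.ln_energy unfolding wD E_def by (simp_all add: energy_pos)
    define A where "A = eig_const n * (\<mu> / sqrt E)"
    have A: "A > 0" using eig_const_pos E \<mu> by (simp add: A_def)
    have lnA: "ln A = ln (eig_const n) + ln \<mu> - ln E / 2"
      using eig_const_pos[of n] E \<mu> by (simp add: A_def ln_mult ln_div ln_sqrt)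
    define G where "G = integral {0..1} (\<lambda>r. r * \<bar>eig_radial n \<mu> r\<bar> powr p)"
    have G: "G = A powr p * (I / \<mu>\<^sup>2)"
      using radial_Lp_integral[OF \<mu> p, of n] by (simp add: G_def A_def E_def I_def)
    have Gp: "G > 0" using A I \<mu> by (simp add: G)
    have lnG: "ln G = p * ln A + ln I - 2 * ln \<mu>"
      using A I \<mu> by (simp add: G ln_mult ln_div ln_powr ln_realpow)
    define U where "U = (LINT z|lebesgue_on (ball 0 1). \<bar>eig_radial n \<mu> (cmod z) * angular n z\<bar> powr p)"
    have U: "U \<le> 2 * pi * G" "(1 / 2) powr p * (pi * G) \<le> U"
      using disk_norm_finite_bounds[OF eig_radial_cont p eig_radial_0] unfolding U_def G_def by auto
    have lnU: "\<bar>ln U - ln G\<bar> \<le> k2"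
      using ln_between[of "(1 / 2) powr p * pi" "2 * pi" G 1 U] U Gp by (simp add: k2_def mult.assoc)
    have "0 < (1 / 2) powr p * (pi * G)" using Gp by simp
    then have Up: "U > 0" using U by linarith
    have "disk_norm (ereal p) (eigfun B n m) = U powr (1 / p)"
      by (simp add: disk_norm_def Lp_norm_def eigfun_eq[OF m] U_def \<mu>_def)
    then have lnN: "ln (disk_norm (ereal p) (eigfun B n m)) = ln U / p" using Up by (simp add: ln_powr)
    have "ln (disk_norm (ereal p) (eigfun B n m)) - main_term (1 / p) \<mu> D X
       = (ln U - ln G) / p + ln (eig_const n) - (ln E - (2 * ln w.a + ln D / 2)) / 2
         + (ln I - (p * ln w.a + (1 - p / 4) * ln X)) / p"
    proof -
      have e1: "ln G / p = (ln (eig_const n) + ln \<mu> - ln E / 2) + ln I / p - 2 * ln \<mu> / p"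
        unfolding lnG lnA[symmetric] using p by (simp add: field_simps)
      have e2: "(p * ln w.a + (1 - p / 4) * ln X) / p = ln w.a + (1 / p - 1 / 4) * ln X"
        using p by (simp add: field_simps)
      have e3: "(1 - 2 * (1 / p)) * ln \<mu> = ln \<mu> - 2 * ln \<mu> / p" by (simp add: algebra_simps)
      have "u - ((m - r) - d / 4 + y) = u - ((k + m - e / 2) + i - r) + k - (e - (2 * a + d / 2)) / 2 + (i - (a + y))"
        for u m r d y k e i a :: real by (simp add: field_simps)
      then show ?thesis
        unfolding lnN main_term_def diff_divide_distrib[of "ln U"] diff_divide_distrib[of "ln I"] e1 e2 e3 .
    qed
    also have "\<bar>\<dots>\<bar> \<le> k2 / p + k + ln K / 2 + (c + ln (1 + ln (1 + D))) / p"
    proof -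
      have "\<bar>(ln U - ln G) / p\<bar> \<le> k2 / p" using lnU p by (simp add: divide_right_mono)
      moreover have "\<bar>ln (eig_const n)\<bar> \<le> k" using eig_const_bound by (simp add: k_def)
      moreover have "\<bar>(ln E - (2 * ln w.a + ln D / 2)) / 2\<bar> \<le> ln K / 2" using E(2) by simp
      moreover have "\<bar>(ln I - (p * ln w.a + (1 - p / 4) * ln X)) / p\<bar> \<le> (c + ln (1 + ln (1 + D))) / p"
        using I(2) p by (simp add: divide_right_mono)
      ultimately show ?thesis by linarith
    qed
    also have "\<dots> \<le> c0 + ln (1 + ln (1 + D))"
    proof -
      have "ln (1 + D) \<ge> 0" using w.log_ratio_le(2) by (simp add: wD)
      then have l0: "ln (1 + ln (1 + D)) \<ge> 0" by simp
      then have "ln (1 + ln (1 + D)) / p \<le> ln (1 + ln (1 + D)) / 1" using p by (intro divide_left_mono) auto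
      then show ?thesis by (simp add: c0_def add_divide_distrib)
    qed
    finally show "let \<mu> = freq B n m; D = \<mu>\<^sup>2 - (real n)\<^sup>2 in
     \<bar>ln (disk_norm (ereal p) (eigfun B n m)) - main_term (1 / p) \<mu> D (window_level (p < 4) n D)\<bar>
       \<le> c0 + ln (1 + ln (1 + D))"
      unfolding Let_def \<mu>_def[symmetric] D_def[symmetric] X_def .
  qed
qed

text \<open>The supremum of \<open>\<bar>J\<^sub>n\<bar>\<close> up to the boundary is comparable to the
  height \<open>a/h\<close> of the first crest.\<close>

lemma norm_estimate_infinity:
  shows "\<exists>c\<ge>0. \<forall>n B m. m \<ge> 1 \<longrightarrow> (let \<mu> = freq B n m; D = \<mu>\<^sup>2 - (real n)\<^sup>2 in
     \<bar>ln (disk_norm \<infinity> (eigfun B n m)) - main_term 0 \<mu> D (window_level False n D)\<bar> \<le> c)"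
proof -
  obtain C K where C: "C \<ge> 1" and K: "K \<ge> 1"
    and win: "\<And>n B m. m \<ge> 1 \<Longrightarrow> \<exists>s0 s1. bessel_window C K n s0 s1 (ln (freq B n m))"
    using uniform_windows by blast
  define k where "k = \<bar>ln (1 / sqrt pi)\<bar> + \<bar>ln (sqrt (2 / pi))\<bar>"
  define c0 where "c0 = k + ln K / 2 + (\<bar>ln (1 / (2 * C))\<bar> + \<bar>ln (C * K)\<bar>)"
  have c0: "c0 \<ge> 0" using K by (simp add: c0_def k_def)
  show ?thesis
  proof (intro exI[of _ c0] conjI allI impI c0)
    fix n B m assume m: "(1::nat) \<le> m"
    define \<mu> where "\<mu> = freq B n m"
    define D where "D = \<mu>\<^sup>2 - (real n)\<^sup>2"
    have \<mu>: "\<mu> > 0" using freq_works[OF m] by (simp add: \<mu>_def)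
    obtain s0 s1 where w: "bessel_window C K n s0 s1 (ln \<mu>)" using win[OF m] unfolding \<mu>_def by blast
    interpret w: bessel_window C K n s0 s1 "ln \<mu>" by (rule w)
    have wD: "w.D = D" using \<mu> by (simp add: w.D_def D_def potential_def)
    define E where "E = energy n (ln \<mu>)"
    have E: "E > 0" "\<bar>ln E - (2 * ln w.a + ln D / 2)\<bar> \<le> ln K"
      using w.ln_energy unfolding wD E_def by (simp_all add: energy_pos)
    define A where "A = eig_const n * (\<mu> / sqrt E)"
    have A: "A > 0" using eig_const_pos E \<mu> by (simp add: A_def)
    have lnA: "ln A = ln (eig_const n) + ln \<mu> - ln E / 2"
      using eig_const_pos[of n] E \<mu> by (simp add: A_def ln_mult ln_div ln_sqrt)
    have g: "\<bar>eig_radial n \<mu> r\<bar> = A * \<bar>bessel_J n (\<mu> * r)\<bar>" for r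
      unfolding eig_radial_def E_def[symmetric] A_def[symmetric] using A by (simp add: abs_mult)
    define H where "H = A * (w.a / w.h)"
    have H: "H > 0" using A w.a_pos(1) w.h(3) by (simp add: H_def)
    have gB: "\<bar>eig_radial n \<mu> r\<bar> \<le> C * K * H" if r: "0 \<le> r" "r < 1" for r
    proof (cases "r = 0")
      case False
      then have "\<bar>bessel_J n (\<mu> * r)\<bar> \<le> C * K * (w.a / w.h)" using r \<mu> by (intro w.J_upper) auto
      then have "A * \<bar>bessel_J n (\<mu> * r)\<bar> \<le> A * (C * K * (w.a / w.h))" using A by (intro mult_left_mono) auto
      then show ?thesis unfolding g H_def by (simp add: mult_ac)
    next
      case True
      have lim: "((\<lambda>r. \<bar>eig_radial n \<mu> r\<bar>) \<longlongrightarrow> \<bar>eig_radial n \<mu> 0\<bar>) (at_right 0)"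
        using eig_radial_cont[of UNIV n \<mu>]
        by (intro tendsto_rabs) (auto simp: continuous_on_def intro: tendsto_within_subset)
      have "\<forall>\<^sub>F r in at_right 0. \<bar>eig_radial n \<mu> r\<bar> \<le> C * K * H"
      proof (rule eventually_at_rightI[of 0 1])
        fix r :: real assume r: "r \<in> {0<..<1}"
        then have "\<bar>bessel_J n (\<mu> * r)\<bar> \<le> C * K * (w.a / w.h)" using \<mu> by (intro w.J_upper) auto
        then have "A * \<bar>bessel_J n (\<mu> * r)\<bar> \<le> A * (C * K * (w.a / w.h))" using A by (intro mult_left_mono) auto
        then show "\<bar>eig_radial n \<mu> r\<bar> \<le> C * K * H" unfolding g H_def by (simp add: mult_ac)
      qed simp
      then show ?thesis unfolding True by (intro tendsto_upperbound[OF lim]) auto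
    qed
    define N where "N = disk_norm \<infinity> (eigfun B n m)"
    have N: "N = Lp_norm \<infinity> (lebesgue_on (ball 0 1)) (\<lambda>z. eig_radial n \<mu> (cmod z) * angular n z)"
      unfolding N_def disk_norm_def by (simp add: eigfun_eq[OF m, abs_def] \<mu>_def)
    have sup1: "N \<le> C * K * H"
      unfolding N by (rule disk_esssup_bounds(1)) (auto intro: eig_radial_cont eig_radial_0 gB)
    have sup2: "\<bar>eig_radial n \<mu> r\<bar> \<le> 2 * N" if "0 \<le> r" "r < 1" for r
      unfolding N by (rule disk_esssup_bounds(2)[OF _ _ _ that]) (auto intro: eig_radial_cont eig_radial_0 gB)
    obtain t where t: "0 < t" "t < \<mu>" "w.a / w.h \<le> C * \<bar>bessel_J n t\<bar>" using w.J_lower \<mu> by auto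
    have "H \<le> C * (A * \<bar>bessel_J n (\<mu> * (t / \<mu>))\<bar>)"
      using mult_left_mono[OF t(3), of A] A \<mu> by (simp add: H_def mult_ac)
    also have "\<dots> \<le> C * (2 * N)"
      using sup2[of "t / \<mu>"] t \<mu> C unfolding g by (intro mult_left_mono) auto
    finally have low: "1 / (2 * C) * H \<le> N" using C by (simp add: pos_divide_le_eq mult_ac)
    have up: "N \<le> C * K * (H * 1)" using sup1 by simp
    have lnN: "\<bar>ln N - ln H\<bar> \<le> \<bar>ln (1 / (2 * C))\<bar> + \<bar>ln (C * K)\<bar>"
      using ln_between[OF _ _ H _ low up] C K by simp
    have lnH: "ln H = ln A + ln w.a - ln w.h" using A w.a_pos(1) w.h(3) by (simp add: H_def ln_mult ln_div)
    have lnX: "ln (window_level False n D) = 4 * ln w.h"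
      using w.h(3) by (simp add: window_level_def w.h_def ln_realpow)
    have "ln N - main_term 0 \<mu> D (window_level False n D)
       = (ln N - ln H) + ln (eig_const n) - (ln E - (2 * ln w.a + ln D / 2)) / 2"
      unfolding main_term_def lnX lnH lnA by (simp add: field_simps)
    also have "\<bar>\<dots>\<bar> \<le> c0"
    proof -
      have "\<bar>ln (eig_const n)\<bar> \<le> k" using eig_const_bound by (simp add: k_def)
      moreover have "\<bar>(ln E - (2 * ln w.a + ln D / 2)) / 2\<bar> \<le> ln K / 2" using E(2) by simp
      ultimately show ?thesis unfolding c0_def using lnN by linarith
    qed
    finally show "let \<mu> = freq B n m; D = \<mu>\<^sup>2 - (real n)\<^sup>2 in
     \<bar>ln (disk_norm \<infinity> (eigfun B n m)) - main_term 0 \<mu> D (window_level False n D)\<bar> \<le> c0"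
      unfolding Let_def \<mu>_def[symmetric] D_def[symmetric] N_def .
  qed
qed

section \<open>Size of the spectral gap\<close>

text \<open>No frequency lies below the first crest.\<close>

lemma freq_gap_lower:
  "\<exists>c>0. \<forall>n B m. m \<ge> 1 \<longrightarrow> c * cbrt_n n ^ 4 \<le> (freq B n m)\<^sup>2 - (real n)\<^sup>2"
proof -
  obtain C K where C: "C \<ge> 1"
    and win: "\<And>n B m. m \<ge> 1 \<Longrightarrow> \<exists>s0 s1. bessel_window C K n s0 s1 (ln (freq B n m))"
    using uniform_windows by blast
  have "1 / C * cbrt_n n ^ 4 \<le> (freq B n m)\<^sup>2 - (real n)\<^sup>2" if m: "m \<ge> 1" for n B m
  proof -
    obtain s0 s1 where w: "bessel_window C K n s0 s1 (ln (freq B n m))" using win[OF m] by blast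
    interpret w: bessel_window C K n s0 s1 "ln (freq B n m)" by (rule w)
    have "cbrt_n n ^ 4 \<le> C * w.D" using w.D_ge(3) by (simp add: w.h_def)
    then show ?thesis using C freq_potential[OF m] by (simp add: w.D_def pos_divide_le_eq mult.commute)
  qed
  then show ?thesis using C by (intro exI[of _ "1 / C"]) auto
qed

lemma ln_cbrt_n: "ln (cbrt_n n ^ 4) = 4 / 3 * ln (real (max 1 n))"
proof -
  have "ln (cbrt_n n ^ 3) = 3 * ln (cbrt_n n)" by (simp add: ln_realpow)
  then have "3 * ln (cbrt_n n) = ln (real (max 1 n))" by (simp add: cbrt_n_cube)
  then show ?thesis by (simp add: ln_realpow)
qed

text \<open>The zero counts solved for \<open>D\<close>. For \<open>m = 1\<close> the upper count is void, and
  the distance of the first crest from the turning point takes its place.\<close>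

lemma ln_gap_bounds:
  "\<exists>c\<ge>0. \<forall>n B m. n \<ge> 1 \<longrightarrow> m \<ge> 1 \<longrightarrow>
     (let D = (freq B n m)\<^sup>2 - (real n)\<^sup>2; T = max (4 / 3 * ln (real n) + 2 / 3 * ln (real m)) (2 * ln (real m)) in
       D > 0 \<and> ln D \<le> T + c \<and> T \<le> ln D + c + 2 * ln (1 + ln (1 + D)))"
proof -
  obtain c1 where c1: "c1 > 0" "\<And>n B m. m \<ge> 1 \<Longrightarrow> c1 * cbrt_n n ^ 4 \<le> (freq B n m)\<^sup>2 - (real n)\<^sup>2"
    using freq_gap_lower by blast
  define c2 where "c2 = 96 * sqrt 2 * pi"
  have c2: "c2 > 0" by (simp add: c2_def)
  define c where "c = 2 * \<bar>ln c2\<bar> + \<bar>ln c1\<bar>"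
  have c: "c \<ge> 0" by (simp add: c_def)
  have cl: "2 / 3 * ln c2 \<le> c" "2 * ln c2 \<le> c" "\<bar>ln c1\<bar> \<le> c" unfolding c_def by linarith+
  show ?thesis
  proof (intro exI[of _ c] conjI allI impI c)
    fix n B m assume n: "(1::nat) \<le> n" and m: "(1::nat) \<le> m"
    define \<mu> where "\<mu> = freq B n m"
    define D where "D = \<mu>\<^sup>2 - (real n)\<^sup>2"
    define x where "x = ln (real n)"
    define y where "y = ln (real m)"
    define T where "T = max (4 / 3 * x + 2 / 3 * y) (2 * y)"
    have x: "x \<ge> 0" and y: "y \<ge> 0" using n m by (simp_all add: x_def y_def)
    have h: "cbrt_n n > 0" using cbrt_n_ge_1[of n] by simp
    have low: "c1 * cbrt_n n ^ 4 \<le> D" using c1(2)[OF m] by (simp add: D_def \<mu>_def)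
    then have D: "D > 0" using c1(1) h by (meson less_le_trans mult_pos_pos zero_less_power)
    have DQ: "potential n (ln \<mu>) = D" using freq_potential[OF m] by (simp add: D_def \<mu>_def)
    have z: "boundary_value B n (ln \<mu>) = 0" "card (zeros_upto B n (ln \<mu>)) = m" using freq_works[OF m] by (simp_all add: \<mu>_def)
    have lnD32: "ln (D * sqrt D) = 3 / 2 * ln D" using D by (simp add: ln_mult ln_sqrt)
    have l0: "ln (1 + D) > 0" using D by simp
    \<comment> \<open>According to whether \<open>D\<close> or \<open>n\<^sup>2\<close> is larger, the factor \<open>n\<^sup>2 + D\<close> in the lower count is replaced by the larger one.\<close>
    have up: "ln D \<le> T + c"
    proof -
      have "24 * sqrt 2 * pi * (real m + 1) * ((real n)\<^sup>2 + D) \<le> 24 * sqrt 2 * pi * (2 * real m) * ((real n)\<^sup>2 + D)"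
        using m D by (intro mult_right_mono mult_left_mono) (auto intro: add_nonneg_nonneg)
      moreover have "D * sqrt D \<le> 24 * sqrt 2 * pi * (real m + 1) * ((real n)\<^sup>2 + D)"
        using zero_count_lower[of n "ln \<mu>" B] D unfolding DQ z(2) by simp
      ultimately have b: "D * sqrt D \<le> 24 * sqrt 2 * pi * (2 * real m) * ((real n)\<^sup>2 + D)" by linarith
      show ?thesis
      proof (cases "D \<le> (real n)\<^sup>2")
        case True
        have "24 * sqrt 2 * pi * (2 * real m) * ((real n)\<^sup>2 + D) \<le> 24 * sqrt 2 * pi * (2 * real m) * (2 * (real n)\<^sup>2)"
          using True by (intro mult_left_mono) auto
        from order_trans[OF b this]
        have "D * sqrt D \<le> 24 * sqrt 2 * pi * (2 * real m) * (2 * (real n)\<^sup>2)" .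
        also have "\<dots> = c2 * (real m * (real n)\<^sup>2)" by (simp add: c2_def)
        finally have "D * sqrt D \<le> c2 * (real m * (real n)\<^sup>2)" .
        moreover have "D * sqrt D > 0" using D by simp
        ultimately have "ln (D * sqrt D) \<le> ln (c2 * (real m * (real n)\<^sup>2))"
          using m n c2 by (subst ln_le_cancel_iff) auto
        also have "\<dots> = ln c2 + (y + 2 * x)" using m n c2 by (simp add: ln_mult ln_realpow x_def y_def)
        finally have "ln D \<le> 2 / 3 * ln c2 + (4 / 3 * x + 2 / 3 * y)" unfolding lnD32 by simp
        then show ?thesis using cl(1) unfolding T_def by linarith
      next
        case False
        have "24 * sqrt 2 * pi * (2 * real m) * ((real n)\<^sup>2 + D) \<le> 24 * sqrt 2 * pi * (2 * real m) * (2 * D)"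
          using False by (intro mult_left_mono) auto
        from order_trans[OF b this]
        have "D * sqrt D \<le> 24 * sqrt 2 * pi * (2 * real m) * (2 * D)" .
        also have "\<dots> = D * (c2 * real m)" by (simp add: c2_def)
        finally have "D * sqrt D \<le> D * (c2 * real m)" .
        then have "sqrt D \<le> c2 * real m" using D by (simp only: mult_le_cancel_left_pos)
        moreover have "sqrt D > 0" using D by simp
        ultimately have "ln (sqrt D) \<le> ln (c2 * real m)" using m c2 by (subst ln_le_cancel_iff) auto
        also have "\<dots> = ln c2 + y" using m c2 by (simp add: ln_mult y_def)
        finally have "ln D \<le> 2 * ln c2 + 2 * y" using D by (simp add: ln_sqrt)
        then show ?thesis using cl(2) unfolding T_def by linarith
      qed
    qed
    have lc: "ln (c1 * cbrt_n n ^ 4) \<le> ln D" using low D c1(1) h by (subst ln_le_cancel_iff) auto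
    have "ln (c1 * cbrt_n n ^ 4) = ln c1 + 4 / 3 * x"
      using c1(1) h n by (simp add: ln_mult ln_cbrt_n x_def max_def split: if_splits)
    then have base: "4 / 3 * x \<le> ln D + \<bar>ln c1\<bar>" using lc by linarith
    have ll: "ln (1 + ln (1 + D)) \<ge> 0" using l0 by simp
    have dn: "T \<le> ln D + c + 2 * ln (1 + ln (1 + D))"
    proof (cases "m = 1")
      case True
      then have "T = 4 / 3 * x" using x by (simp add: T_def y_def)
      then show ?thesis using base ll cl(3) by linarith
    next
      case False
      then have m2: "real m \<le> 2 * (real m - 1)" "real m - 1 > 0" using m by auto
      note cu = zero_count_upper[OF n z(1), unfolded z(2) DQ]
      have "(real n)\<^sup>2 * real m \<le> (real n)\<^sup>2 * (2 * (real m - 1))" using m2 by (intro mult_left_mono) auto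
      also have "\<dots> = 2 * (real n)\<^sup>2 * (real m - 1)" by simp
      also note cu(1)
      finally have "(real n)\<^sup>2 * real m \<le> D * sqrt D" .
      moreover have "(real n)\<^sup>2 * real m > 0" using n m by simp
      ultimately have "ln ((real n)\<^sup>2 * real m) \<le> ln (D * sqrt D)" using D by (subst ln_le_cancel_iff) auto
      moreover have "ln ((real n)\<^sup>2 * real m) = 2 * x + y" using n m by (simp add: ln_mult ln_realpow x_def y_def)
      ultimately have 1: "4 / 3 * x + 2 / 3 * y \<le> ln D" unfolding lnD32 by linarith
      have "real m \<le> sqrt D * ln (1 + D)" using cu(2) m2 by linarith
      then have "ln (real m) \<le> ln (sqrt D * ln (1 + D))" using m D l0 by (subst ln_le_cancel_iff) auto
      also have "\<dots> = ln D / 2 + ln (ln (1 + D))" using D l0 by (simp add: ln_mult ln_sqrt)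
      also have "ln (ln (1 + D)) \<le> ln (1 + ln (1 + D))" using l0 by (subst ln_le_cancel_iff) auto
      finally have "2 * y \<le> ln D + 2 * ln (1 + ln (1 + D))" by (simp add: y_def)
      then show ?thesis using 1 ll c by (simp add: T_def)
    qed
    show "let D = (freq B n m)\<^sup>2 - (real n)\<^sup>2; T = max (4 / 3 * ln (real n) + 2 / 3 * ln (real m)) (2 * ln (real m)) in
       D > 0 \<and> ln D \<le> T + c \<and> T \<le> ln D + c + 2 * ln (1 + ln (1 + D))"
      unfolding Let_def \<mu>_def[symmetric] D_def[symmetric] x_def[symmetric] y_def[symmetric] T_def[symmetric]
      using D up dn by simp
  qed
qed

section \<open>Logarithmic log_scales\<close>

lemma norm_estimate:
  fixes p :: ereal
  assumes p: "1 \<le> p"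
  shows "\<exists>c\<ge>0. \<forall>n B m. m \<ge> 1 \<longrightarrow>
     \<bar>ln (disk_norm p (eigfun B n m))
        - main_term (recip p) (freq B n m) ((freq B n m)\<^sup>2 - (real n)\<^sup>2) (window_level (p < 4) n ((freq B n m)\<^sup>2 - (real n)\<^sup>2))\<bar>
       \<le> c + ln (1 + ln (1 + ((freq B n m)\<^sup>2 - (real n)\<^sup>2)))"
proof (cases p)
  case (real r)
  then have r: "r \<ge> 1" using p by simp
  have "recip p = 1 / r" using r by (simp add: recip_def real divide_inverse)
  moreover have "(p < 4) = (r < 4)" using real by (metis ereal_less_eq(3) not_less numeral_eq_ereal)
  ultimately show ?thesis using norm_estimate_finite[OF r] unfolding real Let_def by simp
next
  case PInf
  obtain c where c: "c \<ge> 0" "\<And>n B m. m \<ge> 1 \<Longrightarrow> \<bar>ln (disk_norm \<infinity> (eigfun B n m)) - main_term 0 (freq B n m) ((freq B n m)\<^sup>2 - (real n)\<^sup>2) (window_level False n ((freq B n m)\<^sup>2 - (real n)\<^sup>2))\<bar> \<le> c"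
    using norm_estimate_infinity unfolding Let_def by blast
  obtain c1 where c1: "c1 > 0" "\<And>n B m. m \<ge> 1 \<Longrightarrow> c1 * cbrt_n n ^ 4 \<le> (freq B n m)\<^sup>2 - (real n)\<^sup>2"
    using freq_gap_lower by blast
  have "\<bar>ln (disk_norm p (eigfun B n m))
        - main_term (recip p) (freq B n m) ((freq B n m)\<^sup>2 - (real n)\<^sup>2) (window_level (p < 4) n ((freq B n m)\<^sup>2 - (real n)\<^sup>2))\<bar>
       \<le> c + ln (1 + ln (1 + ((freq B n m)\<^sup>2 - (real n)\<^sup>2)))" if m: "m \<ge> 1" for n B m
  proof -
    have "0 < c1 * cbrt_n n ^ 4" using c1(1) cbrt_n_ge_1[of n] by simp
    then have "0 < (freq B n m)\<^sup>2 - (real n)\<^sup>2" using c1(2)[OF m] by (rule less_le_trans)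
    then have "0 \<le> ln (1 + ln (1 + ((freq B n m)\<^sup>2 - (real n)\<^sup>2)))" by simp
    moreover have "recip p = 0" "(p < 4) = False" using PInf by (simp_all add: recip_def)
    ultimately show ?thesis using c(2)[OF m, of B n] PInf by simp
  qed
  then show ?thesis using c(1) by blast
next
  case MInf
  then show ?thesis using p by simp
qed

text \<open>Here \<open>\<omega>\<close> stands for \<open>ln \<mu>\<close>; the denominator \<open>2
  \<omega>\<close> is the logarithm of the eigenvalue.\<close>

lemma ratio_limit:
  fixes \<omega> d x e N :: "nat \<Rightarrow> real"
  assumes \<omega>: "filterlim \<omega> at_top sequentially"
    and d: "(\<lambda>k. d k / \<omega> k) \<longlonglongrightarrow> \<delta>" and a: "(\<lambda>k. x k / \<omega> k) \<longlonglongrightarrow> \<xi>"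
    and err: "(\<lambda>k. e k / \<omega> k) \<longlonglongrightarrow> 0"
    and N: "\<And>k. \<bar>N k - ((1 - 2 * \<tau>) * \<omega> k - d k / 4 + (\<tau> - 1 / 4) * x k)\<bar> \<le> e k"
  shows "(\<lambda>k. N k / (2 * \<omega> k)) \<longlonglongrightarrow> ((1 - 2 * \<tau>) - \<delta> / 4 + (\<tau> - 1 / 4) * \<xi>) / 2"
proof -
  have pos: "\<forall>\<^sub>F k in sequentially. \<omega> k > 0" using \<omega> by (simp add: filterlim_at_top_dense)
  define M where "M = (\<lambda>k. (1 - 2 * \<tau>) * \<omega> k - d k / 4 + (\<tau> - 1 / 4) * x k)"
  have "(\<lambda>k. (1 - 2 * \<tau>) - d k / \<omega> k / 4 + (\<tau> - 1 / 4) * (x k / \<omega> k)) \<longlonglongrightarrow> (1 - 2 * \<tau>) - \<delta> / 4 + (\<tau> - 1 / 4) * \<xi>"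
    by (intro tendsto_intros d a) auto
  moreover have "\<forall>\<^sub>F k in sequentially. (1 - 2 * \<tau>) - d k / \<omega> k / 4 + (\<tau> - 1 / 4) * (x k / \<omega> k) = M k / \<omega> k"
    using pos by eventually_elim (simp add: M_def field_simps)
  ultimately have M: "(\<lambda>k. M k / \<omega> k) \<longlonglongrightarrow> (1 - 2 * \<tau>) - \<delta> / 4 + (\<tau> - 1 / 4) * \<xi>"
    by (rule Lim_transform_eventually)
  have diff: "(\<lambda>k. (N k - M k) / \<omega> k) \<longlonglongrightarrow> 0"
  proof (rule Lim_null_comparison[OF _ err])
    show "\<forall>\<^sub>F k in sequentially. norm ((N k - M k) / \<omega> k) \<le> e k / \<omega> k"
      using pos by eventually_elim (use N in \<open>simp add: M_def divide_right_mono\<close>)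
  qed
  have "(\<lambda>k. ((N k - M k) / \<omega> k + M k / \<omega> k) / 2) \<longlonglongrightarrow> (0 + ((1 - 2 * \<tau>) - \<delta> / 4 + (\<tau> - 1 / 4) * \<xi>)) / 2"
    by (intro tendsto_intros diff M) auto
  then show ?thesis by (simp add: diff_divide_distrib mult.commute)
qed

text \<open>The accumulated errors are iterated logarithms of the frequency.\<close>

lemma loglog_negligible:
  fixes \<omega> D :: "nat \<Rightarrow> real"
  assumes \<omega>: "filterlim \<omega> at_top sequentially" and D: "\<And>k. 0 < D k" "\<And>k. D k \<le> (exp (\<omega> k))\<^sup>2"
  shows "(\<lambda>k. (c + c' * ln (1 + ln (1 + D k))) / \<omega> k) \<longlonglongrightarrow> 0"
proof -
  have lim1: "(\<lambda>k. c / \<omega> k) \<longlonglongrightarrow> 0" by (rule real_tendsto_divide_at_top[OF tendsto_const \<omega>])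
  have inv: "(\<lambda>k. 2 / \<omega> k) \<longlonglongrightarrow> 0" by (rule real_tendsto_divide_at_top[OF tendsto_const \<omega>])
  have pos: "\<forall>\<^sub>F k in sequentially. \<omega> k > 0" using \<omega> by (simp add: filterlim_at_top_dense)
  have top: "filterlim (\<lambda>k. 2 + 2 * \<omega> k) at_top sequentially"
    by (intro filterlim_tendsto_add_at_top[OF tendsto_const] filterlim_tendsto_pos_mult_at_top[OF tendsto_const _ \<omega>]) auto
  have "(\<lambda>k. ln (2 + 2 * \<omega> k) / (2 + 2 * \<omega> k)) \<longlonglongrightarrow> 0"
    using filterlim_compose[OF ln_x_over_x_tendsto_0 top] by simp
  moreover have "(\<lambda>k. 2 / \<omega> k + 2) \<longlonglongrightarrow> 0 + 2" by (intro tendsto_intros inv)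
  ultimately have "(\<lambda>k. ln (2 + 2 * \<omega> k) / (2 + 2 * \<omega> k) * (2 / \<omega> k + 2)) \<longlonglongrightarrow> 0 * (0 + 2)"
    by (rule tendsto_mult)
  moreover have "\<forall>\<^sub>F k in sequentially. ln (2 + 2 * \<omega> k) / (2 + 2 * \<omega> k) * (2 / \<omega> k + 2) = ln (2 + 2 * \<omega> k) / \<omega> k"
    using pos
  proof eventually_elim
    case (elim k)
    have "2 / \<omega> k + 2 = (2 + 2 * \<omega> k) / \<omega> k" using elim by (simp add: add_divide_distrib)
    moreover have "2 + 2 * \<omega> k \<noteq> 0" using elim by linarith
    ultimately show ?case by simp
  qed
  ultimately have ll: "(\<lambda>k. ln (2 + 2 * \<omega> k) / \<omega> k) \<longlonglongrightarrow> 0"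
    using Lim_transform_eventually by fastforce
  have "(\<lambda>k. ln (1 + ln (1 + D k)) / \<omega> k) \<longlonglongrightarrow> 0"
  proof (rule Lim_null_comparison[OF _ ll])
    show "\<forall>\<^sub>F k in sequentially. norm (ln (1 + ln (1 + D k)) / \<omega> k) \<le> ln (2 + 2 * \<omega> k) / \<omega> k"
      using pos
    proof eventually_elim
      case (elim k)
      have "1 \<le> (exp (\<omega> k))\<^sup>2" using elim by (simp add: one_le_power)
      then have "1 + D k \<le> 2 * (exp (\<omega> k))\<^sup>2" using D(2)[of k] by linarith
      then have "ln (1 + D k) \<le> ln (2 * (exp (\<omega> k))\<^sup>2)" using D(1)[of k] by (subst ln_le_cancel_iff) auto
      also have "\<dots> = ln 2 + 2 * \<omega> k" by (simp add: ln_mult ln_realpow)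
      also have "\<dots> \<le> 1 + 2 * \<omega> k" using ln_2_less_1 by simp
      finally have 1: "ln (1 + D k) \<le> 1 + 2 * \<omega> k" .
      have 0: "0 < ln (1 + D k)" using D(1)[of k] by simp
      have "ln (1 + ln (1 + D k)) \<le> ln (2 + 2 * \<omega> k)" using 0 1 elim by (subst ln_le_cancel_iff) auto
      moreover have "0 \<le> ln (1 + ln (1 + D k))" using 0 by simp
      ultimately show ?case using elim by (simp add: divide_right_mono)
    qed
  qed
  then have "(\<lambda>k. c / \<omega> k + c' * (ln (1 + ln (1 + D k)) / \<omega> k)) \<longlonglongrightarrow> 0 + c' * 0"
    by (intro tendsto_intros lim1)
  then show ?thesis by (simp add: add_divide_distrib)
qed

text \<open>With \<open>\<omega> = ln \<mu>\<close>, \<open>d = ln D\<close>, \<open>a = ln n\<close>,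
  \<open>b = ln m\<close>: since \<open>\<mu>\<^sup>2 = D + n\<^sup>2\<close>, the larger of \<open>d\<close>
  and \<open>2 a\<close> is \<open>2 \<omega>\<close> up to a bounded error, and \<open>d\<close> is known in
  terms of \<open>a\<close> and \<open>b\<close>.\<close>

lemma log_scales:
  fixes \<omega> d a b e :: "nat \<Rightarrow> real"
  assumes \<omega>: "filterlim \<omega> at_top sequentially" and e: "(\<lambda>k. e k / \<omega> k) \<longlonglongrightarrow> 0"
    and d: "\<And>k. \<bar>d k - max (4 / 3 * a k + 2 / 3 * b k) (2 * b k)\<bar> \<le> e k"
    and l: "\<And>k. \<bar>2 * \<omega> k - max (d k) (2 * a k)\<bar> \<le> ln 2"
  shows "(\<lambda>k. max (max (4 / 3 * a k + 2 / 3 * b k) (2 * b k)) (2 * a k) / \<omega> k) \<longlonglongrightarrow> 2"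
    and "(\<lambda>k. d k / \<omega> k - max (4 / 3 * a k + 2 / 3 * b k) (2 * b k) / \<omega> k) \<longlonglongrightarrow> 0"
proof -
  have pos: "\<forall>\<^sub>F k in sequentially. \<omega> k > 0" using \<omega> by (simp add: filterlim_at_top_dense)
  define T where "T = (\<lambda>k. max (4 / 3 * a k + 2 / 3 * b k) (2 * b k))"
  have "(\<lambda>k. ln 2 / \<omega> k) \<longlonglongrightarrow> 0" by (rule real_tendsto_divide_at_top[OF tendsto_const \<omega>])
  then have e2: "(\<lambda>k. e k / \<omega> k + ln 2 / \<omega> k) \<longlonglongrightarrow> 0 + 0" by (intro tendsto_add e)
  have "(\<lambda>k. (max (T k) (2 * a k) - 2 * \<omega> k) / \<omega> k) \<longlonglongrightarrow> 0"
  proof (rule Lim_null_comparison[OF _ e2[simplified]])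
    show "\<forall>\<^sub>F k in sequentially. norm ((max (T k) (2 * a k) - 2 * \<omega> k) / \<omega> k) \<le> e k / \<omega> k + ln 2 / \<omega> k"
      using pos
    proof eventually_elim
      case (elim k)
      have "\<bar>max (T k) (2 * a k) - 2 * \<omega> k\<bar> \<le> e k + ln 2"
      proof -
        have "\<bar>d k - T k\<bar> \<le> e k" using d[of k] by (simp only: T_def)
        then show ?thesis using l[of k] by linarith
      qed
      then show ?case using elim by (simp add: divide_right_mono flip: add_divide_distrib)
    qed
  qed
  then have "(\<lambda>k. (max (T k) (2 * a k) - 2 * \<omega> k) / \<omega> k + 2) \<longlonglongrightarrow> 0 + 2" by (intro tendsto_intros)
  moreover have "\<forall>\<^sub>F k in sequentially. (max (T k) (2 * a k) - 2 * \<omega> k) / \<omega> k + 2 = max (T k) (2 * a k) / \<omega> k"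
    using pos by eventually_elim (simp add: diff_divide_distrib)
  ultimately show "(\<lambda>k. max (max (4 / 3 * a k + 2 / 3 * b k) (2 * b k)) (2 * a k) / \<omega> k) \<longlonglongrightarrow> 2"
    unfolding T_def by (simp add: Lim_transform_eventually)
  have "(\<lambda>k. (d k - T k) / \<omega> k) \<longlonglongrightarrow> 0"
  proof (rule Lim_null_comparison[OF _ e])
    show "\<forall>\<^sub>F k in sequentially. norm ((d k - T k) / \<omega> k) \<le> e k / \<omega> k"
      using pos by eventually_elim (use d in \<open>simp add: T_def divide_right_mono\<close>)
  qed
  then show "(\<lambda>k. d k / \<omega> k - max (4 / 3 * a k + 2 / 3 * b k) (2 * b k) / \<omega> k) \<longlonglongrightarrow> 0"
    by (simp add: T_def diff_divide_distrib)
qed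

lemma max_mult_pos: "0 < (c::real) \<Longrightarrow> max (c * x) (c * y) = c * max x y"
  by (simp add: max_mult_distrib_left)

lemma log_scales_finite:
  fixes \<omega> d a b e :: "nat \<Rightarrow> real"
  assumes \<omega>: "filterlim \<omega> at_top sequentially" and e: "(\<lambda>k. e k / \<omega> k) \<longlonglongrightarrow> 0"
    and d: "\<And>k. \<bar>d k - max (4 / 3 * a k + 2 / 3 * b k) (2 * b k)\<bar> \<le> e k"
    and l: "\<And>k. \<bar>2 * \<omega> k - max (d k) (2 * a k)\<bar> \<le> ln 2"
    and a: "\<And>k. a k > 0" and g: "(\<lambda>k. b k / a k) \<longlonglongrightarrow> \<gamma>" and \<gamma>: "\<gamma> \<ge> 0"
  shows "(\<lambda>k. a k / \<omega> k) \<longlonglongrightarrow> 1 / max 1 \<gamma>"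
    and "(\<lambda>k. d k / \<omega> k) \<longlonglongrightarrow> max (4 / 3 + 2 / 3 * \<gamma>) (2 * \<gamma>) / max 1 \<gamma>"
proof -
  have pos: "\<forall>\<^sub>F k in sequentially. \<omega> k > 0" using \<omega> by (simp add: filterlim_at_top_dense)
  note s = log_scales[OF \<omega> e d l]
  define M where "M = max (max (4 / 3 + 2 / 3 * \<gamma>) (2 * \<gamma>)) 2"
  have M: "M = 2 * max 1 \<gamma>" using \<gamma> by (auto simp: M_def max_def)
  have T: "max (4 / 3 * a k + 2 / 3 * b k) (2 * b k) = a k * max (4 / 3 + 2 / 3 * (b k / a k)) (2 * (b k / a k))" for k
    using a[of k] by (simp add: max_mult_distrib_left algebra_simps)
  have T2: "max (max (4 / 3 * a k + 2 / 3 * b k) (2 * b k)) (2 * a k) / a k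
     = max (max (4 / 3 + 2 / 3 * (b k / a k)) (2 * (b k / a k))) 2" for k
  proof -
    have "max (max (4 / 3 * a k + 2 / 3 * b k) (2 * b k)) (2 * a k) = a k * max (max (4 / 3 + 2 / 3 * (b k / a k)) (2 * (b k / a k))) 2"
      unfolding T using max_mult_pos[OF a[of k], of "max (4 / 3 + 2 / 3 * (b k / a k)) (2 * (b k / a k))" 2] by (simp add: mult.commute)
    then show ?thesis using a[of k] by simp
  qed
  have "(\<lambda>k. max (max (4 / 3 + 2 / 3 * (b k / a k)) (2 * (b k / a k))) 2) \<longlonglongrightarrow> M"
    unfolding M_def by (intro tendsto_intros g)
  from tendsto_divide[OF s(1) this]
  have "(\<lambda>k. max (max (4 / 3 * a k + 2 / 3 * b k) (2 * b k)) (2 * a k) / \<omega> k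
     / (max (max (4 / 3 * a k + 2 / 3 * b k) (2 * b k)) (2 * a k) / a k)) \<longlonglongrightarrow> 2 / M"
    unfolding T2[symmetric] using M by simp
  moreover have "max (max (4 / 3 * a k + 2 / 3 * b k) (2 * b k)) (2 * a k) / \<omega> k
     / (max (max (4 / 3 * a k + 2 / 3 * b k) (2 * b k)) (2 * a k) / a k) = a k / \<omega> k" for k
  proof -
    have "max (max (4 / 3 * a k + 2 / 3 * b k) (2 * b k)) (2 * a k) > 0" using a[of k] by (simp add: less_max_iff_disj)
    then show ?thesis by simp
  qed
  ultimately show al: "(\<lambda>k. a k / \<omega> k) \<longlonglongrightarrow> 1 / max 1 \<gamma>" by (simp add: M)
  have "(\<lambda>k. (a k / \<omega> k) * max (4 / 3 + 2 / 3 * (b k / a k)) (2 * (b k / a k))) \<longlonglongrightarrow> (1 / max 1 \<gamma>) * max (4 / 3 + 2 / 3 * \<gamma>) (2 * \<gamma>)"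
    by (intro tendsto_intros al g)
  from tendsto_add[OF s(2) this] show "(\<lambda>k. d k / \<omega> k) \<longlonglongrightarrow> max (4 / 3 + 2 / 3 * \<gamma>) (2 * \<gamma>) / max 1 \<gamma>"
    unfolding T by simp
qed

lemma log_scales_infinite:
  fixes \<omega> d a b e :: "nat \<Rightarrow> real"
  assumes \<omega>: "filterlim \<omega> at_top sequentially" and e: "(\<lambda>k. e k / \<omega> k) \<longlonglongrightarrow> 0"
    and d: "\<And>k. \<bar>d k - max (4 / 3 * a k + 2 / 3 * b k) (2 * b k)\<bar> \<le> e k"
    and l: "\<And>k. \<bar>2 * \<omega> k - max (d k) (2 * a k)\<bar> \<le> ln 2"
    and a: "\<And>k. a k > 0" and g: "filterlim (\<lambda>k. b k / a k) at_top sequentially"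
  shows "(\<lambda>k. a k / \<omega> k) \<longlonglongrightarrow> 0" and "(\<lambda>k. d k / \<omega> k) \<longlonglongrightarrow> 2"
proof -
  note s = log_scales[OF \<omega> e d l]
  have big: "\<forall>\<^sub>F k in sequentially. b k / a k > 2" using g by (simp add: filterlim_at_top_dense)
  have ev: "\<forall>\<^sub>F k in sequentially. max (max (4 / 3 * a k + 2 / 3 * b k) (2 * b k)) (2 * a k) = 2 * b k
     \<and> max (4 / 3 * a k + 2 / 3 * b k) (2 * b k) = 2 * b k"
    using big
  proof eventually_elim
    case (elim k)
    then have "2 * a k < b k" using a[of k] by (simp add: pos_less_divide_eq)
    then show ?case using a[of k] by (auto simp: max_def)
  qed
  have b2: "(\<lambda>k. 2 * b k / \<omega> k) \<longlonglongrightarrow> 2"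
    by (rule Lim_transform_eventually[OF s(1)], rule eventually_mono[OF ev], elim conjE, simp only:)
  have "(\<lambda>k. d k / \<omega> k - 2 * b k / \<omega> k) \<longlonglongrightarrow> 0"
    by (rule Lim_transform_eventually[OF s(2)], rule eventually_mono[OF ev], elim conjE, simp only:)
  from tendsto_add[OF this b2] show "(\<lambda>k. d k / \<omega> k) \<longlonglongrightarrow> 2" by simp
  have "(\<lambda>k. inverse (b k / a k)) \<longlonglongrightarrow> 0" using g by (rule tendsto_inverse_0_at_top)
  from tendsto_mult[OF this b2] have "(\<lambda>k. inverse (b k / a k) * (2 * b k / \<omega> k)) \<longlonglongrightarrow> 0" by simp
  from tendsto_mult[OF this tendsto_const[of "1 / 2"]]
  have "(\<lambda>k. inverse (b k / a k) * (2 * b k / \<omega> k) * (1 / 2)) \<longlonglongrightarrow> 0" by simp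
  then show "(\<lambda>k. a k / \<omega> k) \<longlonglongrightarrow> 0"
  proof (rule Lim_transform_eventually)
    show "\<forall>\<^sub>F k in sequentially. inverse (b k / a k) * (2 * b k / \<omega> k) * (1 / 2) = a k / \<omega> k"
      using big
    proof eventually_elim
      case (elim k)
      then have "b k \<noteq> 0" using a[of k] by auto
      then show ?case by simp
    qed
  qed
qed

section \<open>The exponent sets\<close>

lemma freq_gap_pos: "m \<ge> 1 \<Longrightarrow> 0 < (freq B n m)\<^sup>2 - (real n)\<^sup>2"
proof -
  assume m: "m \<ge> 1"
  obtain c1 where c1: "c1 > 0" "\<And>n B m. m \<ge> 1 \<Longrightarrow> c1 * cbrt_n n ^ 4 \<le> (freq B n m)\<^sup>2 - (real n)\<^sup>2"
    using freq_gap_lower by blast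
  have "0 < c1 * cbrt_n n ^ 4" using c1(1) cbrt_n_ge_1[of n] by simp
  then show ?thesis using c1(2)[OF m] by (rule less_le_trans)
qed

lemma freq_max_bounds:
  assumes m: "m \<ge> 1" and n: "n \<ge> 1"
  shows "\<bar>2 * ln (freq B n m) - max (ln ((freq B n m)\<^sup>2 - (real n)\<^sup>2)) (2 * ln (real n))\<bar> \<le> ln 2"
proof -
  define \<mu> where "\<mu> = freq B n m"
  define D where "D = \<mu>\<^sup>2 - (real n)\<^sup>2"
  have D: "D > 0" using freq_gap_pos[OF m] by (simp add: D_def \<mu>_def)
  have \<mu>: "\<mu> > 0" using freq_works(1)[OF m] by (simp add: \<mu>_def)
  have n2: "(real n)\<^sup>2 > 0" using n by simp
  have e: "2 * ln \<mu> = ln (D + (real n)\<^sup>2)" by (simp add: D_def ln_realpow)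
  have nn: "2 * ln (real n) = ln ((real n)\<^sup>2)" by (simp add: ln_realpow)
  have "ln D \<le> 2 * ln \<mu>" "2 * ln (real n) \<le> 2 * ln \<mu>"
  proof -
    have "D + (real n)\<^sup>2 > 0" using D n2 by linarith
    then show "ln D \<le> 2 * ln \<mu>" "2 * ln (real n) \<le> 2 * ln \<mu>"
      unfolding e nn using D n2 by (simp_all only: ln_le_cancel_iff)
  qed
  moreover have "2 * ln \<mu> \<le> ln 2 + max (ln D) (2 * ln (real n))"
  proof (cases "D \<le> (real n)\<^sup>2")
    case True
    have "ln (D + (real n)\<^sup>2) \<le> ln (2 * (real n)\<^sup>2)" by (rule ln_mono) (use D n2 True in linarith)+
    also have "\<dots> = ln 2 + 2 * ln (real n)" unfolding nn using n2 by (intro ln_mult_pos) auto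
    finally show ?thesis unfolding e by linarith
  next
    case False
    have "ln (D + (real n)\<^sup>2) \<le> ln (2 * D)" by (rule ln_mono) (use D n2 False in linarith)+
    also have "\<dots> = ln 2 + ln D" using D by (intro ln_mult_pos) auto
    finally show ?thesis unfolding e by linarith
  qed
  moreover have "0 \<le> ln (2::real)" by simp
  ultimately show ?thesis unfolding \<mu>_def[symmetric] D_def[symmetric] by linarith
qed

lemma ln_freq_at_top:
  fixes B :: bdry and n m :: "nat \<Rightarrow> nat"
  assumes "\<And>k. m k \<ge> 1" and "filterlim (\<lambda>k. eigval B (n k) (m k)) at_top sequentially"
  shows "filterlim (\<lambda>k. ln (freq B (n k) (m k))) at_top sequentially"
proof -
  have "filterlim (\<lambda>k. ln (eigval B (n k) (m k))) at_top sequentially"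
    by (rule filterlim_compose[OF ln_at_top assms(2)])
  then have "filterlim (\<lambda>k. 1 / 2 * ln (eigval B (n k) (m k))) at_top sequentially"
    by (intro filterlim_tendsto_pos_mult_at_top[OF tendsto_const]) auto
  then show ?thesis by (simp add: eigval_freq ln_realpow)
qed

lemma recip_ereal: "recip (ereal r) = 1 / r"
  by (cases "r = 0") (simp_all add: recip_def divide_inverse)

lemma recip_PInf: "recip \<infinity> = 0"
  by (simp add: recip_def)

text \<open>The limit of \<open>ln D / ln \<mu>\<close> in the regime \<open>\<gamma>\<close>.\<close>

definition gap_exponent :: "ereal \<Rightarrow> real" where
  "gap_exponent \<gamma> = (if \<gamma> < 1 then 4 / 3 + 2 / 3 * real_of_ereal \<gamma> else 2)"

text \<open>The limit of \<open>ln n / ln \<mu>\<close> in the regime \<open>\<gamma>\<close>.\<close>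

definition angular_exponent :: "ereal \<Rightarrow> real" where
  "angular_exponent \<gamma> = (if \<gamma> < 1 then 1 else recip \<gamma>)"

lemma Phi_eq:
  assumes p: "1 \<le> p" and \<gamma>: "0 \<le> \<gamma>"
  shows "Phi p \<gamma> = ((1 - 2 * recip p) - gap_exponent \<gamma> / 4
     + (recip p - 1 / 4) * (if p < 4 then gap_exponent \<gamma> else 4 / 3 * angular_exponent \<gamma>)) / 2"
proof (cases "p < 4")
  case True
  then obtain r where r: "p = ereal r" "r \<ge> 1" using p by (cases p) auto
  show ?thesis
  proof (cases "\<gamma> < 1")
    case lt: True
    then obtain g where g: "\<gamma> = ereal g" using \<gamma> by (cases \<gamma>) auto
    show ?thesis using True lt r unfolding Phi_def gap_exponent_def by (simp add: recip_ereal g field_simps)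
  next
    case False
    then show ?thesis using True by (simp add: Phi_def gap_exponent_def field_simps)
  qed
next
  case False
  then show ?thesis
    by (simp add: Phi_def gap_exponent_def angular_exponent_def field_simps)
qed

text \<open>If \<open>n\<close> stays in \<open>{0, 1}\<close>, the gap is the squared frequency up to a
  bounded amount; otherwise the two scales follow from the zero counts. The maximum with \<open>1\<close>
  makes the first logarithm vanish for \<open>n = 0\<close>.\<close>

lemma regime_exponents:
  fixes n m :: "nat \<Rightarrow> nat"
  assumes m: "\<And>k. m k \<ge> 1" and top: "filterlim (\<lambda>k. eigval B (n k) (m k)) at_top sequentially"
    and reg: "regime \<gamma> n m" and \<gamma>: "0 \<le> \<gamma>"
  shows "(\<lambda>k. ln (real (max 1 (n k))) / ln (freq B (n k) (m k))) \<longlonglongrightarrow> angular_exponent \<gamma>"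
    and "(\<lambda>k. ln ((freq B (n k) (m k))\<^sup>2 - (real (n k))\<^sup>2) / ln (freq B (n k) (m k))) \<longlonglongrightarrow> gap_exponent \<gamma>"
proof -
  define \<omega> where "\<omega> = (\<lambda>k. ln (freq B (n k) (m k)))"
  define D where "D = (\<lambda>k. (freq B (n k) (m k))\<^sup>2 - (real (n k))\<^sup>2)"
  have \<omega>: "filterlim \<omega> at_top sequentially" unfolding \<omega>_def by (rule ln_freq_at_top[OF m top])
  have pos: "\<forall>\<^sub>F k in sequentially. \<omega> k > 0" using \<omega> by (simp add: filterlim_at_top_dense)
  have D: "0 < D k" for k using freq_gap_pos[OF m] by (simp add: D_def)
  have e\<omega>: "exp (\<omega> k) = freq B (n k) (m k)" for k using freq_works(1)[OF m] by (simp add: \<omega>_def)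
  have D2: "D k \<le> (exp (\<omega> k))\<^sup>2" for k unfolding e\<omega> by (simp add: D_def)
  have "(\<lambda>k. ln (real (max 1 (n k))) / \<omega> k) \<longlonglongrightarrow> angular_exponent \<gamma> \<and> (\<lambda>k. ln (D k) / \<omega> k) \<longlonglongrightarrow> gap_exponent \<gamma>"
  proof (cases "\<forall>k. n k \<ge> 2")
    case True
    obtain c where c: "c \<ge> 0" "\<And>n B m. n \<ge> 1 \<Longrightarrow> m \<ge> 1 \<Longrightarrow>
     (let D = (freq B n m)\<^sup>2 - (real n)\<^sup>2; T = max (4 / 3 * ln (real n) + 2 / 3 * ln (real m)) (2 * ln (real m)) in
       D > 0 \<and> ln D \<le> T + c \<and> T \<le> ln D + c + 2 * ln (1 + ln (1 + D)))"
      using ln_gap_bounds by blast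
    have n1: "n k \<ge> 1" for k using True[rule_format, of k] by simp
    define a where "a = (\<lambda>k. ln (real (n k)))"
    define b where "b = (\<lambda>k. ln (real (m k)))"
    define e where "e = (\<lambda>k. c + 2 * ln (1 + ln (1 + D k)))"
    have max1: "max 1 (n k) = n k" for k using n1[of k] by simp
    have e: "(\<lambda>k. e k / \<omega> k) \<longlonglongrightarrow> 0" unfolding e_def by (rule loglog_negligible[OF \<omega> D D2])
    have d: "\<bar>ln (D k) - max (4 / 3 * a k + 2 / 3 * b k) (2 * b k)\<bar> \<le> e k" for k
    proof -
      have "0 \<le> ln (1 + ln (1 + D k))" using D[of k] by simp
      moreover from c(2)[OF n1 m, of B k k, unfolded Let_def]
      have "ln (D k) \<le> max (4 / 3 * a k + 2 / 3 * b k) (2 * b k) + c"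
        "max (4 / 3 * a k + 2 / 3 * b k) (2 * b k) \<le> ln (D k) + c + 2 * ln (1 + ln (1 + D k))"
        unfolding D_def a_def b_def by blast+
      ultimately show ?thesis unfolding e_def by linarith
    qed
    have l: "\<bar>2 * \<omega> k - max (ln (D k)) (2 * a k)\<bar> \<le> ln 2" for k
      using freq_max_bounds[OF m n1] by (simp add: \<omega>_def D_def a_def)
    have a: "a k > 0" for k using True[rule_format, of k] by (simp add: a_def)
    have reg': "(\<lambda>k. ereal (b k / a k)) \<longlonglongrightarrow> \<gamma>"
    proof -
      have "\<not> (\<forall>k. n k \<in> {0, 1})" using True by (metis insertE le_antisym not_numeral_le_zero numeral_le_one_iff semiring_norm(69) singletonD)
      then show ?thesis using reg unfolding regime_def a_def b_def by blast
    qed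
    show ?thesis
    proof (cases \<gamma>)
      case (real g)
      then have g: "g \<ge> 0" "(\<lambda>k. b k / a k) \<longlonglongrightarrow> g" using \<gamma> reg' by (simp_all add: lim_ereal)
      note s = log_scales_finite[OF \<omega> e d l a g(2,1)]
      show ?thesis
      proof (cases "g < 1")
        case True
        then have "max 1 g = 1" "max (4 / 3 + 2 / 3 * g) (2 * g) = 4 / 3 + 2 / 3 * g" by auto
        then show ?thesis using s True unfolding max1 a_def[symmetric]
          by (simp add: angular_exponent_def gap_exponent_def real a_def)
      next
        case False
        then have "max 1 g = g" "max (4 / 3 + 2 / 3 * g) (2 * g) = 2 * g" by auto
        then show ?thesis using s False unfolding max1
          by (simp add: angular_exponent_def gap_exponent_def real recip_ereal a_def)
      qed
    next
      case PInf
      then have "filterlim (\<lambda>k. b k / a k) at_top sequentially" using reg' by (simp add: tendsto_PInfty_eq_at_top)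
      from log_scales_infinite[OF \<omega> e d l a this] show ?thesis unfolding max1
        by (simp add: angular_exponent_def gap_exponent_def PInf recip_PInf a_def)
    next
      case MInf
      then show ?thesis using \<gamma> by simp
    qed
  next
    case False
    then have inf: "\<gamma> = \<infinity>" and n01: "\<And>k. n k \<in> {0, 1}" using reg by (auto simp: regime_def)
    have "max 1 (n k) = 1" for k using n01[of k] by auto
    moreover have "(\<lambda>k. ln (D k) / \<omega> k) \<longlonglongrightarrow> 2"
    proof -
      have "(\<lambda>k. ln 2 / \<omega> k) \<longlonglongrightarrow> 0" by (rule real_tendsto_divide_at_top[OF tendsto_const \<omega>])
      then have "(\<lambda>k. ln (D k) / \<omega> k - 2) \<longlonglongrightarrow> 0"
      proof (rule Lim_null_comparison[rotated])
        have "\<forall>\<^sub>F k in sequentially. \<omega> k > 1" using \<omega> by (simp add: filterlim_at_top_dense)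
        then show "\<forall>\<^sub>F k in sequentially. norm (ln (D k) / \<omega> k - 2) \<le> ln 2 / \<omega> k"
        proof eventually_elim
          case (elim k)
          have "1 + 2 * \<omega> k \<le> exp (2 * \<omega> k)" by (rule exp_ge_add_one_self)
          then have "2 \<le> (exp (\<omega> k))\<^sup>2" using elim by (simp add: exp_double)
          moreover have "(real (n k))\<^sup>2 \<le> 1" using n01[of k] by auto
          moreover have "D k = (exp (\<omega> k))\<^sup>2 - (real (n k))\<^sup>2" by (simp add: e\<omega> D_def)
          ultimately have lo: "(exp (\<omega> k))\<^sup>2 / 2 \<le> D k" by linarith
          then have "ln ((exp (\<omega> k))\<^sup>2 / 2) \<le> ln (D k)" using D[of k] by (subst ln_le_cancel_iff) auto
          moreover have "ln ((exp (\<omega> k))\<^sup>2 / 2) = 2 * \<omega> k - ln 2" by (simp add: ln_div ln_realpow)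
          moreover have "ln (D k) \<le> ln ((exp (\<omega> k))\<^sup>2)" using D[of k] D2[of k] by (subst ln_le_cancel_iff) auto
          moreover have "ln ((exp (\<omega> k))\<^sup>2) = 2 * \<omega> k" by (simp add: ln_realpow)
          ultimately have "\<bar>ln (D k) - 2 * \<omega> k\<bar> \<le> ln 2" by simp
          then have "\<bar>(ln (D k) - 2 * \<omega> k) / \<omega> k\<bar> \<le> ln 2 / \<omega> k" using elim by (simp add: divide_right_mono)
          then show ?case using elim by (simp add: diff_divide_distrib)
        qed
      qed
      from tendsto_add[OF this tendsto_const[of 2]] show ?thesis by simp
    qed
    ultimately show ?thesis by (simp add: angular_exponent_def gap_exponent_def inf recip_PInf)
  qed
  then show "(\<lambda>k. ln (real (max 1 (n k))) / ln (freq B (n k) (m k))) \<longlonglongrightarrow> angular_exponent \<gamma>"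
    "(\<lambda>k. ln ((freq B (n k) (m k))\<^sup>2 - (real (n k))\<^sup>2) / ln (freq B (n k) (m k))) \<longlonglongrightarrow> gap_exponent \<gamma>"
    by (simp_all add: \<omega>_def D_def)
qed

lemma exponent_limit:
  fixes n m :: "nat \<Rightarrow> nat"
  assumes p: "1 \<le> p" and \<gamma>: "0 \<le> \<gamma>" and m: "\<And>k. m k \<ge> 1"
    and top: "filterlim (\<lambda>k. eigval B (n k) (m k)) at_top sequentially" and reg: "regime \<gamma> n m"
  shows "(\<lambda>k. ln (disk_norm p (eigfun B (n k) (m k))) / ln (eigval B (n k) (m k))) \<longlonglongrightarrow> Phi p \<gamma>"
proof -
  define \<omega> where "\<omega> = (\<lambda>k. ln (freq B (n k) (m k)))"
  define D where "D = (\<lambda>k. (freq B (n k) (m k))\<^sup>2 - (real (n k))\<^sup>2)"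
  define x where "x = (\<lambda>k. ln (window_level (p < 4) (n k) (D k)))"
  define N where "N = (\<lambda>k. ln (disk_norm p (eigfun B (n k) (m k))))"
  have \<omega>: "filterlim \<omega> at_top sequentially" unfolding \<omega>_def by (rule ln_freq_at_top[OF m top])
  note ex = regime_exponents[OF m top reg \<gamma>, folded \<omega>_def D_def]
  obtain c where c: "c \<ge> 0" "\<And>n B m. m \<ge> 1 \<Longrightarrow>
     \<bar>ln (disk_norm p (eigfun B n m))
        - main_term (recip p) (freq B n m) ((freq B n m)\<^sup>2 - (real n)\<^sup>2) (window_level (p < 4) n ((freq B n m)\<^sup>2 - (real n)\<^sup>2))\<bar>
       \<le> c + ln (1 + ln (1 + ((freq B n m)\<^sup>2 - (real n)\<^sup>2)))"
    using norm_estimate[OF p] by blast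
  have D: "0 < D k" for k using freq_gap_pos[OF m] by (simp add: D_def)
  have "exp (\<omega> k) = freq B (n k) (m k)" for k using freq_works(1)[OF m] by (simp add: \<omega>_def)
  then have D2: "D k \<le> (exp (\<omega> k))\<^sup>2" for k by (simp add: D_def)
  have e: "(\<lambda>k. (c + 1 * ln (1 + ln (1 + D k))) / \<omega> k) \<longlonglongrightarrow> 0" by (rule loglog_negligible[OF \<omega> D D2])
  have x: "(\<lambda>k. x k / \<omega> k) \<longlonglongrightarrow> (if p < 4 then gap_exponent \<gamma> else 4 / 3 * angular_exponent \<gamma>)"
  proof (cases "p < 4")
    case True
    then show ?thesis using ex(2) by (simp add: x_def window_level_def D_def \<omega>_def)
  next
    case False
    have "(\<lambda>k. 4 / 3 * (ln (real (max 1 (n k))) / ln (freq B (n k) (m k)))) \<longlonglongrightarrow> 4 / 3 * angular_exponent \<gamma>"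
      by (intro tendsto_intros regime_exponents(1)[OF m top reg \<gamma>])
    then show ?thesis using False by (simp add: x_def window_level_def \<omega>_def ln_cbrt_n)
  qed
  have "(\<lambda>k. N k / (2 * \<omega> k)) \<longlonglongrightarrow> ((1 - 2 * recip p) - gap_exponent \<gamma> / 4
     + (recip p - 1 / 4) * (if p < 4 then gap_exponent \<gamma> else 4 / 3 * angular_exponent \<gamma>)) / 2"
  proof (rule ratio_limit[OF \<omega> _ x e])
    show "(\<lambda>k. ln (D k) / \<omega> k) \<longlonglongrightarrow> gap_exponent \<gamma>"
      using regime_exponents(2)[OF m top reg \<gamma>] by (simp add: D_def \<omega>_def)
    show "\<bar>N k - ((1 - 2 * recip p) * \<omega> k - ln (D k) / 4 + (recip p - 1 / 4) * x k)\<bar> \<le> c + 1 * ln (1 + ln (1 + D k))" for k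
      using c(2)[OF m, of B "n k" k] by (simp add: N_def \<omega>_def D_def x_def main_term_def)
  qed
  then show ?thesis unfolding Phi_eq[OF p \<gamma>] by (simp add: N_def \<omega>_def eigval_freq ln_realpow)
qed

lemma eigval_ge: "m \<ge> 1 \<Longrightarrow> (real n)\<^sup>2 \<le> eigval B n m"
  using freq_gap_pos[of m B n] by (simp add: eigval_freq)

text \<open>For finite \<open>\<gamma>\<close> let \<open>n\<close> grow and \<open>m\<close> be
  \<open>n\<^sup>\<gamma>\<close> rounded up; for \<open>\<gamma> = \<infinity>\<close> keep \<open>n =
  2\<close> and let \<open>m\<close> grow.\<close>

lemma admissible_sequence_exists:
  assumes \<gamma>: "0 \<le> \<gamma>"
  shows "\<exists>n m :: nat \<Rightarrow> nat. (\<forall>k. m k \<ge> 1) \<and> filterlim (\<lambda>k. eigval B (n k) (m k)) at_top sequentially \<and> regime \<gamma> n m"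
proof (cases \<gamma>)
  case (real g)
  then have g: "g \<ge> 0" using \<gamma> by simp
  define n where "n = (\<lambda>k. k + 2 :: nat)"
  define m where "m = (\<lambda>k. nat \<lceil>real (n k) powr g\<rceil>)"
  have n2: "real (n k) \<ge> 2" for k by (simp add: n_def)
  have pw: "real (n k) powr g \<ge> 1" for k using n2[of k] g by (intro ge_one_powr_ge_zero) auto
  have m: "real (n k) powr g \<le> real (m k)" "real (m k) \<le> 2 * (real (n k) powr g)" for k
    using pw[of k] unfolding m_def by linarith+
  have m1: "m k \<ge> 1" for k using m(1)[of k] pw[of k] by linarith
  have lnn: "filterlim (\<lambda>k. ln (real (n k))) at_top sequentially"
  proof (rule filterlim_compose[OF ln_at_top])
    show "filterlim (\<lambda>k. real (n k)) at_top sequentially"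
      unfolding n_def by (intro filterlim_compose[OF filterlim_real_sequentially] filterlim_add_const_nat_at_top)
  qed
  have "(\<lambda>k. ln (real (m k)) / ln (real (n k)) - g) \<longlonglongrightarrow> 0"
  proof (rule Lim_null_comparison[OF always_eventually])
    show "\<forall>k. norm (ln (real (m k)) / ln (real (n k)) - g) \<le> ln 2 / ln (real (n k))"
    proof
      fix k
      have ln0: "ln (real (n k)) > 0" using n2[of k] by simp
      have "ln (real (n k) powr g) \<le> ln (real (m k))" using m(1)[of k] pw[of k] n2[of k] by (subst ln_le_cancel_iff) auto
      moreover have "ln (real (m k)) \<le> ln (2 * (real (n k) powr g))" using m[of k] pw[of k] n2[of k] by (subst ln_le_cancel_iff) auto
      moreover have "ln (2 * (real (n k) powr g)) = ln 2 + ln (real (n k) powr g)" using pw[of k] by (intro ln_mult_pos) linarith+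
      moreover have "ln (real (n k) powr g) = g * ln (real (n k))" using n2[of k] by (simp add: ln_powr)
      ultimately have "\<bar>ln (real (m k)) - g * ln (real (n k))\<bar> \<le> ln 2" by simp
      then have "\<bar>(ln (real (m k)) - g * ln (real (n k))) / ln (real (n k))\<bar> \<le> ln 2 / ln (real (n k))"
        using ln0 by (simp add: divide_right_mono)
      then show "norm (ln (real (m k)) / ln (real (n k)) - g) \<le> ln 2 / ln (real (n k))"
        using ln0 by (simp add: diff_divide_distrib)
    qed
    show "(\<lambda>k. ln 2 / ln (real (n k))) \<longlonglongrightarrow> 0" by (rule real_tendsto_divide_at_top[OF tendsto_const lnn])
  qed
  from tendsto_add[OF this tendsto_const[of g]] have lim: "(\<lambda>k. ln (real (m k)) / ln (real (n k))) \<longlonglongrightarrow> g" by simp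
  have "filterlim (\<lambda>k. eigval B (n k) (m k)) at_top sequentially"
  proof (rule filterlim_at_top_mono)
    show "filterlim (\<lambda>k. real k) at_top sequentially" by (rule filterlim_real_sequentially)
    have "real k \<le> eigval B (n k) (m k)" for k
    proof -
      have "real k \<le> (real (n k))\<^sup>2" by (simp add: n_def power2_eq_square algebra_simps)
      then show ?thesis using eigval_ge[OF m1, of "n k" B k] by linarith
    qed
    then show "\<forall>\<^sub>F k in sequentially. real k \<le> eigval B (n k) (m k)" by simp
  qed
  moreover have "regime \<gamma> n m" unfolding regime_def using lim n2 by (auto simp: real lim_ereal n_def)
  ultimately show ?thesis using m1 by blast
next
  case PInf
  define n where "n = (\<lambda>k::nat. 2 :: nat)"
  define m where "m = (\<lambda>k::nat. k + 1)"
  have lm: "filterlim (\<lambda>k. ln (real (m k))) at_top sequentially"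
    unfolding m_def by (intro filterlim_compose[OF ln_at_top] filterlim_compose[OF filterlim_real_sequentially] filterlim_add_const_nat_at_top)
  have l2: "ln (2::real) > 0" by simp
  have "filterlim (\<lambda>k. (1 / ln 2) * ln (real (m k))) at_top sequentially"
    by (rule filterlim_tendsto_pos_mult_at_top[OF tendsto_const _ lm]) simp
  then have "regime \<gamma> n m" unfolding regime_def PInf by (simp add: tendsto_PInfty_eq_at_top n_def)
  moreover have "filterlim (\<lambda>k. eigval B (n k) (m k)) at_top sequentially"
  proof -
    obtain c where c: "c \<ge> 0" "\<And>n B m. n \<ge> 1 \<Longrightarrow> m \<ge> 1 \<Longrightarrow>
     (let D = (freq B n m)\<^sup>2 - (real n)\<^sup>2; T = max (4 / 3 * ln (real n) + 2 / 3 * ln (real m)) (2 * ln (real m)) in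
       D > 0 \<and> ln D \<le> T + c \<and> T \<le> ln D + c + 2 * ln (1 + ln (1 + D)))"
      using ln_gap_bounds by blast
    have low: "(2 * ln (real (m k)) - c) / 3 \<le> eigval B (n k) (m k)" for k
    proof -
      define D where "D = (freq B (n k) (m k))\<^sup>2 - (real (n k))\<^sup>2"
      have "m k \<ge> 1" "n k \<ge> 1" by (simp_all add: m_def n_def)
      from c(2)[OF this(2,1), of B, unfolded Let_def, folded D_def]
      have D: "D > 0" and "2 * ln (real (m k)) \<le> ln D + c + 2 * ln (1 + ln (1 + D))" by auto
      moreover have l1: "ln (1 + D) \<le> D" using D by (intro ln_add_one_self_le_self) auto
      moreover have "ln (1 + ln (1 + D)) \<le> ln (1 + D)" using D l1 by (subst ln_le_cancel_iff) (auto intro: add_pos_nonneg)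
      moreover have "ln D \<le> D" using ln_le_minus_one[OF D] by linarith
      ultimately have "(2 * ln (real (m k)) - c) / 3 \<le> D" by simp
      also have "D \<le> eigval B (n k) (m k)" by (simp add: D_def eigval_freq)
      finally show ?thesis .
    qed
    have "filterlim (\<lambda>k. - (c / 3) + (2 / 3) * ln (real (m k))) at_top sequentially"
      by (intro filterlim_tendsto_add_at_top[OF tendsto_const] filterlim_tendsto_pos_mult_at_top[OF tendsto_const _ lm]) simp
    then show ?thesis
    proof (rule filterlim_at_top_mono)
      show "\<forall>\<^sub>F k in sequentially. - (c / 3) + (2 / 3) * ln (real (m k)) \<le> eigval B (n k) (m k)"
        using low by (intro always_eventually allI) (simp add: diff_divide_distrib)
    qed
  qed
  ultimately show ?thesis by (intro exI[of _ n] exI[of _ m]) (simp add: m_def)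
next
  case MInf
  then show ?thesis using \<gamma> by simp
qed

lemma exponent_set_singleton:
  assumes "1 \<le> p" "0 \<le> \<gamma>"
  shows "exponent_set B p \<gamma> = {Phi p \<gamma>}"
proof (intro subset_antisym subsetI)
  fix l assume "l \<in> exponent_set B p \<gamma>"
  then obtain n m :: "nat \<Rightarrow> nat" where *: "\<forall>k. m k \<ge> 1" "filterlim (\<lambda>k. eigval B (n k) (m k)) at_top sequentially"
     "regime \<gamma> n m" "(\<lambda>k. ln (disk_norm p (eigfun B (n k) (m k))) / ln (eigval B (n k) (m k))) \<longlonglongrightarrow> l"
    unfolding exponent_set_def by blast
  have "(\<lambda>k. ln (disk_norm p (eigfun B (n k) (m k))) / ln (eigval B (n k) (m k))) \<longlonglongrightarrow> Phi p \<gamma>"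
    using *(1-3) by (intro exponent_limit assms) auto
  then show "l \<in> {Phi p \<gamma>}" using LIMSEQ_unique[OF *(4)] by simp
next
  fix l assume "l \<in> {Phi p \<gamma>}"
  then have l: "l = Phi p \<gamma>" by simp
  obtain n m :: "nat \<Rightarrow> nat" where *: "\<forall>k. m k \<ge> 1" "filterlim (\<lambda>k. eigval B (n k) (m k)) at_top sequentially" "regime \<gamma> n m"
    using admissible_sequence_exists[OF assms(2)] by blast
  have "(\<lambda>k. ln (disk_norm p (eigfun B (n k) (m k))) / ln (eigval B (n k) (m k))) \<longlonglongrightarrow> Phi p \<gamma>"
    using * by (intro exponent_limit assms) auto
  then show "l \<in> exponent_set B p \<gamma>" unfolding exponent_set_def l using * by blast
qed

theorem theorem1p2:
  fixes p \<gamma> :: ereal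
  assumes "1 \<le> p" and "0 \<le> \<gamma>"
  shows "exponent_set Dirichlet p \<gamma> = {Phi p \<gamma>} \<and> exponent_set Neumann p \<gamma> = {Phi p \<gamma>}"
  using exponent_set_singleton[OF assms] by blast

end
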